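(* Let $G$ be a finite group, $p$ a prime number, and $\mathcal{F}_p$ a family of subgroups of $G$ such that every $p$-quasi-elementary subgroup of $G$ is conjugate to a subgroup of some $Q\in\mathcal{F}_p$. For $S,T\in\mathcal{F}_p$ write $\alpha_{S,T}=\mathrm{Res}_T\,\mathrm{Ind}^G_S:\hat{\mathrm{C}}(S)\to\hat{\mathrm{C}}(T)$. Then $$\hat{\mathrm{C}}(G)_p\;\cong\;\mathrm{Image}\Bigl(\prod_{T}\sum_{S}\alpha_{S,T}:\ \prod_{S\in\mathcal{F}_p}\hat{\mathrm{C}}(S)\longrightarrow\prod_{T\in\mathcal{F}_p}\hat{\mathrm{C}}(T)\Bigr).$$ In particular, $\hat{\mathrm{C}}(G)_p=1$ if and only if for all pairs $S,T\in\mathcal{F}_p$ and all $\rho\in R_{\mathbb{Q}}(S)$ (equivalently, for those $\rho$ whose class in $\mathrm{C}(S)$ is nontrivial), we have $\mathrm{Res}^G_T\,\mathrm{Ind}_S^G\rho\in\mathrm{Perm}(T)$. The same also holds for $\mathrm{C}(G)$ (that is, with $\mathrm{C}$ in place of $\hat{\mathrm{C}}$).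
   Context: For a finite group $G$: $\mathrm{Char}_{\mathbb{Q}}(G)$ is the ring of $\mathbb{Q}$-valued (virtual) characters of $G$; $R_{\mathbb{Q}}(G)\subseteq\mathrm{Char}_{\mathbb{Q}}(G)$ is the ring of characters of virtual $\mathbb{Q}G$-representations; $\mathrm{Perm}(G)\subseteq R_{\mathbb{Q}}(G)$ is the ring of characters of virtual permutation representations, i.e. the $\mathbb{Z}$-span of the characters of $\mathbb{Q}[G/H]$ for $H\le G$. Set $\mathrm{C}(G)=R_{\mathbb{Q}}(G)/\mathrm{Perm}(G)$ and $\hat{\mathrm{C}}(G)=\mathrm{Char}_{\mathbb{Q}}(G)/\mathrm{Perm}(G)$. Restriction and induction of characters preserve $\mathrm{Char}_{\mathbb{Q}}$, $R_{\mathbb{Q}}$ and $\mathrm{Perm}$, hence induce maps on $\mathrm{C}$ and $\hat{\mathrm{C}}$. The subscript $p$ denotes tensoring with the ring $\mathbb{Z}_p$ of $p$-adic integers: $\hat{\mathrm{C}}(G)_p=\hat{\mathrm{C}}(G)\otimes\mathbb{Z}_p$ and $\mathrm{C}(G)_p=\mathrm{C}(G)\otimes\mathbb{Z}_p$. A group is $p$-quasi-elementary if it is of the form $C\rtimes P$ with $C$ cyclic of order prime to $p$ and $P$ a $p$-group.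
   Formalization: For arbitrary F_p the image and the criterion Res Ind ρ∈Perm(T) are also tensored with Z_p; the literal forms are stated if all members of F_p are p-quasi-elementary. In the Ĉ criterion ρ ranges over Char_Q(S), with classes in Ĉ(S), not R_Q(S). As printed, G=Q_8 is a counterexample. *)

theory Defs
  imports "HOL-Algebra.Free_Abelian_Groups" "HOL-Algebra.Left_Coset"
    "HOL-Computational_Algebra.Primes" "Jordan_Normal_Form.Matrix"
begin

section \<open>Rings of characters of a finite group\<close>

text \<open>
  A class function on \<open>G\<close> is represented by a function that is \<open>0\<close> outside \<open>carrier G\<close>.
  All groups, also the additive ones, are written multiplicatively, as in HOL-Algebra.
\<close>

definition class_functions :: "('a, 'b) monoid_scheme \<Rightarrow> ('a \<Rightarrow> complex) monoid" where
  "class_functions G =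
     \<lparr>carrier = {f. (\<forall>g. g \<notin> carrier G \<longrightarrow> f g = 0) \<and>
                    (\<forall>g\<in>carrier G. \<forall>x\<in>carrier G. f (x \<otimes>\<^bsub>G\<^esub> g \<otimes>\<^bsub>G\<^esub> inv\<^bsub>G\<^esub> x) = f g)},
      monoid.mult = (\<lambda>f f' g. f g + f' g), one = (\<lambda>g. 0)\<rparr>"

definition matrix_reps :: "('a, 'b) monoid_scheme \<Rightarrow> nat \<Rightarrow> ('a \<Rightarrow> 'k :: field mat) set" where
  "matrix_reps G n = hom G (units_of (ring_mat TYPE('k) n ()))"

definition rep_character ::
    "('a, 'b) monoid_scheme \<Rightarrow> nat \<Rightarrow> ('a \<Rightarrow> 'k :: field mat) \<Rightarrow> 'a \<Rightarrow> 'k" where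
  "rep_character G n \<rho> g = (if g \<in> carrier G then \<Sum>i<n. \<rho> g $$ (i, i) else 0)"

definition virtual_characters :: "('a, 'b) monoid_scheme \<Rightarrow> ('a \<Rightarrow> complex) set" where
  "virtual_characters G =
     generate (class_functions G) {rep_character G n \<rho> | n \<rho>. \<rho> \<in> matrix_reps G n}"

definition Char_Q :: "('a, 'b) monoid_scheme \<Rightarrow> ('a \<Rightarrow> complex) set" where
  "Char_Q G = {\<chi> \<in> virtual_characters G. \<forall>g\<in>carrier G. \<chi> g \<in> \<rat>}"

definition R_Q :: "('a, 'b) monoid_scheme \<Rightarrow> ('a \<Rightarrow> complex) set" where
  "R_Q G = generate (class_functions G)
     {(\<lambda>g. of_rat (rep_character G n \<rho> g)) | n (\<rho> :: 'a \<Rightarrow> rat mat). \<rho> \<in> matrix_reps G n}"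

text \<open>
  On the basis of \<open>\<rat>[G/H]\<close> formed by the left cosets of \<open>H\<close>, the element \<open>g\<close> acts by the
  permutation matrix whose \<open>(X, Y)\<close> entry is \<open>1\<close> if \<open>X = gY\<close> and \<open>0\<close> otherwise; the
  character is its trace.
\<close>

definition perm_character :: "('a, 'b) monoid_scheme \<Rightarrow> 'a set \<Rightarrow> 'a \<Rightarrow> complex" where
  "perm_character G H g =
     (if g \<in> carrier G then \<Sum>X \<in> lcosets\<^bsub>G\<^esub> H. of_bool (X = g <#\<^bsub>G\<^esub> X) else 0)"

definition Perm :: "('a, 'b) monoid_scheme \<Rightarrow> ('a \<Rightarrow> complex) set" where
  "Perm G = generate (class_functions G) {perm_character G H | H. subgroup H G}"

definition C_hat :: "('a, 'b) monoid_scheme \<Rightarrow> ('a \<Rightarrow> complex) set monoid" where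
  "C_hat G = (class_functions G)\<lparr>carrier := Char_Q G\<rparr> Mod Perm G"

definition C_rat :: "('a, 'b) monoid_scheme \<Rightarrow> ('a \<Rightarrow> complex) set monoid" where
  "C_rat G = (class_functions G)\<lparr>carrier := R_Q G\<rparr> Mod Perm G"

text \<open>The class of a character in \<open>C_hat G\<close> or \<open>C_rat G\<close>; it is the same coset in both.\<close>

definition char_class :: "('a, 'b) monoid_scheme \<Rightarrow> ('a \<Rightarrow> complex) \<Rightarrow> ('a \<Rightarrow> complex) set" where
  "char_class G \<chi> = Perm G #>\<^bsub>class_functions G\<^esub> \<chi>"


section \<open>Restriction and induction\<close>

definition Res :: "'a set \<Rightarrow> ('a \<Rightarrow> complex) \<Rightarrow> 'a \<Rightarrow> complex" where
  "Res T \<chi> g = (if g \<in> T then \<chi> g else 0)"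

text \<open>As \<open>\<chi>\<close> vanishes outside \<open>S\<close>, only the \<open>x\<close> with \<open>x\<inverse> g x \<in> S\<close> contribute to the sum.\<close>

definition Ind :: "('a, 'b) monoid_scheme \<Rightarrow> 'a set \<Rightarrow> ('a \<Rightarrow> complex) \<Rightarrow> 'a \<Rightarrow> complex" where
  "Ind G S \<chi> g =
     (if g \<in> carrier G
      then (\<Sum>x\<in>carrier G. \<chi> (inv\<^bsub>G\<^esub> x \<otimes>\<^bsub>G\<^esub> g \<otimes>\<^bsub>G\<^esub> x)) / of_nat (card S) else 0)"

text \<open>
  For a homomorphism \<open>\<phi>\<close> from \<open>A\<close> to \<open>B\<close> that maps a subgroup \<open>M\<close> into the normal subgroup \<open>N\<close>,
  this is the induced map \<open>A/M \<rightarrow> B/N\<close>: if \<open>X\<close> is the coset of \<open>x\<close>, then \<open>N \<phi>(X) = N \<phi>(x)\<close>.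
\<close>

definition quotient_map ::
    "('b, 'c) monoid_scheme \<Rightarrow> 'b set \<Rightarrow> ('a \<Rightarrow> 'b) \<Rightarrow> 'a set \<Rightarrow> 'b set" where
  "quotient_map B N \<phi> X = N <#>\<^bsub>B\<^esub> (\<phi> ` X)"

definition alpha ::
    "('a, 'b) monoid_scheme \<Rightarrow> 'a set \<Rightarrow> 'a set \<Rightarrow> ('a \<Rightarrow> complex) set \<Rightarrow> ('a \<Rightarrow> complex) set" where
  "alpha G S T =
     quotient_map (class_functions (G\<lparr>carrier := T\<rparr>)) (Perm (G\<lparr>carrier := T\<rparr>))
       (\<lambda>\<chi>. Res T (Ind G S \<chi>))"


section \<open>Tensor products with the \<open>p\<close>-adic integers\<close>

text \<open>The inverse limit of the rings \<open>\<int>/p\<^sup>n\<close>, with residues represented in \<open>{0..<p\<^sup>n}\<close>.\<close>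

definition padic_integers :: "nat \<Rightarrow> (nat \<Rightarrow> int) ring" where
  "padic_integers p =
     \<lparr>carrier = {z. \<forall>n. z n \<in> {0..<int p ^ n} \<and> z (Suc n) mod int p ^ n = z n},
      monoid.mult = (\<lambda>x y n. (x n * y n) mod int p ^ n),
      one = (\<lambda>n. 1 mod int p ^ n),
      zero = (\<lambda>n. 0),
      add = (\<lambda>x y n. (x n + y n) mod int p ^ n)\<rparr>"

text \<open>The tensor product over \<open>\<int>\<close> of two abelian groups.\<close>

definition tensor_relations ::
    "('a, 'c) monoid_scheme \<Rightarrow> ('b, 'd) monoid_scheme \<Rightarrow> (('a \<times> 'b) \<Rightarrow>\<^sub>0 int) set" where
  "tensor_relations A B =
     generate (free_Abelian_group (carrier A \<times> carrier B))
       ({frag_of (a \<otimes>\<^bsub>A\<^esub> a', b) - frag_of (a, b) - frag_of (a', b) | a a' b.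
           a \<in> carrier A \<and> a' \<in> carrier A \<and> b \<in> carrier B} \<union>
        {frag_of (a, b \<otimes>\<^bsub>B\<^esub> b') - frag_of (a, b) - frag_of (a, b') | a b b'.
           a \<in> carrier A \<and> b \<in> carrier B \<and> b' \<in> carrier B})"

definition tensor ::
    "('a, 'c) monoid_scheme \<Rightarrow> ('b, 'd) monoid_scheme \<Rightarrow> (('a \<times> 'b) \<Rightarrow>\<^sub>0 int) set monoid" where
  "tensor A B = free_Abelian_group (carrier A \<times> carrier B) Mod tensor_relations A B"

definition pure_tensor ::
    "('a, 'c) monoid_scheme \<Rightarrow> ('b, 'd) monoid_scheme \<Rightarrow> 'a \<Rightarrow> 'b \<Rightarrow> (('a \<times> 'b) \<Rightarrow>\<^sub>0 int) set" where
  "pure_tensor A B a b =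
     tensor_relations A B #>\<^bsub>free_Abelian_group (carrier A \<times> carrier B)\<^esub> frag_of (a, b)"

text \<open>The map \<open>\<phi> \<otimes> id\<close> into \<open>tensor A B\<close>, for a homomorphism \<open>\<phi>\<close> into \<open>A\<close>.\<close>

definition tensor_map ::
    "('a, 'c) monoid_scheme \<Rightarrow> ('b, 'd) monoid_scheme \<Rightarrow> ('e \<Rightarrow> 'a)
     \<Rightarrow> (('e \<times> 'b) \<Rightarrow>\<^sub>0 int) set \<Rightarrow> (('a \<times> 'b) \<Rightarrow>\<^sub>0 int) set" where
  "tensor_map A B \<phi> =
     quotient_map (free_Abelian_group (carrier A \<times> carrier B)) (tensor_relations A B)
       (frag_extend (\<lambda>(x, b). frag_of (\<phi> x, b)))"

abbreviation tensor_Zp ::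
    "nat \<Rightarrow> ('a, 'c) monoid_scheme \<Rightarrow> (('a \<times> (nat \<Rightarrow> int)) \<Rightarrow>\<^sub>0 int) set monoid" where
  "tensor_Zp p A \<equiv> tensor A (add_monoid (padic_integers p))"

abbreviation to_tensor_Zp ::
    "nat \<Rightarrow> ('a, 'c) monoid_scheme \<Rightarrow> 'a \<Rightarrow> (('a \<times> (nat \<Rightarrow> int)) \<Rightarrow>\<^sub>0 int) set" where
  "to_tensor_Zp p A a \<equiv>
     pure_tensor A (add_monoid (padic_integers p)) a \<one>\<^bsub>padic_integers p\<^esub>"

abbreviation map_Zp ::
    "nat \<Rightarrow> ('a, 'c) monoid_scheme \<Rightarrow> ('e \<Rightarrow> 'a)
     \<Rightarrow> (('e \<times> (nat \<Rightarrow> int)) \<Rightarrow>\<^sub>0 int) set \<Rightarrow> (('a \<times> (nat \<Rightarrow> int)) \<Rightarrow>\<^sub>0 int) set" where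
  "map_Zp p A \<phi> \<equiv> tensor_map A (add_monoid (padic_integers p)) \<phi>"


section \<open>Products of maps and quasi-elementary groups\<close>

text \<open>The map \<open>\<Prod>\<^sub>T \<Sum>\<^sub>S f\<^sub>S\<^sub>T\<close> into the product of the abelian groups \<open>B T\<close>.\<close>

definition prod_sum_map ::
    "'i set \<Rightarrow> ('i \<Rightarrow> ('b, 'c) monoid_scheme) \<Rightarrow> ('i \<Rightarrow> 'i \<Rightarrow> 'a \<Rightarrow> 'b)
     \<Rightarrow> ('i \<Rightarrow> 'a) \<Rightarrow> 'i \<Rightarrow> 'b" where
  "prod_sum_map I B f x = (\<lambda>T\<in>I. finprod (B T) (\<lambda>S. f S T (x S)) I)"

definition image_group ::
    "('a \<Rightarrow> 'b) \<Rightarrow> ('a, 'c) monoid_scheme \<Rightarrow> ('b, 'd) monoid_scheme \<Rightarrow> ('b, 'd) monoid_scheme" where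
  "image_group f A B = B\<lparr>carrier := f ` carrier A\<rparr>"

definition p_quasi_elementary :: "nat \<Rightarrow> ('a, 'b) monoid_scheme \<Rightarrow> bool" where
  "p_quasi_elementary p H \<longleftrightarrow>
     group H \<and> finite (carrier H) \<and>
     (\<exists>C P. C \<lhd> H \<and> cyclic_group (H\<lparr>carrier := C\<rparr>) \<and> coprime (card C) p \<and>
            subgroup P H \<and> (\<exists>k. card P = p ^ k) \<and>
            C \<inter> P = {\<one>\<^bsub>H\<^esub>} \<and> C <#>\<^bsub>H\<^esub> P = carrier H)"

end

theory Submission
  imports Defs "HOL-Number_Theory.Number_Theory" "HOL-Algebra.Sylow"
    "Jordan_Normal_Form.Schur_Decomposition"
begin

text \<open>
  By Solomon's induction theorem localised at \<open>p\<close>, some integer \<open>m\<close> prime to \<open>p\<close> satisfies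
  \<open>m 1\<^sub>G = \<Sum>\<^sub>S Ind\<^sub>S \<psi>\<^sub>S\<close> with \<open>S \<in> F\<close> and \<open>\<psi>\<^sub>S \<in> Perm S\<close>. The projection formula gives
  \<open>m \<chi> = \<Sum>\<^sub>S Ind\<^sub>S (\<psi>\<^sub>S Res\<^sub>S \<chi>)\<close> for every character \<open>\<chi>\<close> of \<open>G\<close>. As \<open>m\<close> is invertible in \<open>\<int>\<^sub>p\<close>, after
  tensoring with \<open>\<int>\<^sub>p\<close> the map \<open>\<Prod>\<^sub>T Res\<^sub>T\<close> is injective and \<open>\<Sum>\<^sub>S Ind\<^sub>S\<close> is surjective, and the image of
  their composite is a copy of the group attached to \<open>G\<close>.

  If \<open>Q\<close> is \<open>p\<close>-quasi-elementary, then for every prime \<open>q \<noteq> p\<close> its \<open>q\<close>-quasi-elementary subgroups are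
  cyclic. Rational-valued characters of cyclic groups are virtual permutation characters, so Solomon's
  theorem for all these \<open>q\<close> shows that the quotient attached to \<open>Q\<close> has exponent a power of \<open>p\<close>;
  tensoring such a group with \<open>\<int>\<^sub>p\<close> changes nothing.
\<close>

text \<open>The family \<open>F\<close> may contain subgroups that are not p-quasi-elementary, and
  this shapes the statement. For F = {G} the only \<open>alpha\<close> is the identity, so the image
  of the untensored map is the whole quotient attached to G, with any torsion prime to p that it
  has. Hence in general \<open>alpha\<close> is tensored with Z_p before the image is formed, and
  triviality is tested on Res Ind rho (x) 1; the image of \<open>alpha\<close> itself and membership
  in Perm(T) appear once all members of \<open>F\<close> are p-quasi-elementary.

  The two quotients are treated together: the tensored statement rests on stability under
  restriction and induction and on the inclusion of Perm, because multiplication by a permutation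
  character is induction after restriction.

  For cyclic groups one must know that a rational-valued character gives equal weight to all linear
  characters with the same kernel. This comes from comparing values at g^k and g^(t k) by
  congruences modulo the prime factors of t, with t chosen so that all these primes exceed a bound
  given by the coefficients.\<close>

section \<open>Maps between quotient groups\<close>

lemma hom_generate_subset:
  assumes "group A" "group B" "h \<in> hom A B" "K \<subseteq> carrier A" "subgroup L B" "h ` K \<subseteq> L"
  shows "h ` generate A K \<subseteq> L"
proof -
  interpret group_hom A B h using assms by (simp add: group_hom_def group_hom_axioms_def)
  show ?thesis
    using generate_img[OF assms(4)] H.generate_subgroup_incl[OF assms(6,5)] by simp
qed

text \<open>phi(Mx) = phi(M) phi(x), and N absorbs phi(M). This converts the choice-free definition
  of \<open>quotient_map\<close> as a product of sets into its value on a representative, the form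
  in which induced maps are used later.\<close>

lemma quotient_map_rcoset:
  assumes "group A" "group B" "\<phi> \<in> hom A B" "subgroup M A" "subgroup N B" "\<phi> ` M \<subseteq> N" "x \<in> carrier A"
  shows "quotient_map B N \<phi> (M #>\<^bsub>A\<^esub> x) = N #>\<^bsub>B\<^esub> \<phi> x"
proof -
  interpret B: group B by fact
  interpret N: subgroup N B by fact
  interpret M: subgroup M A by fact
  have phx: "\<phi> x \<in> carrier B" using assms(3,7) by (auto simp: hom_def)
  have *: "\<phi> (m \<otimes>\<^bsub>A\<^esub> x) = \<phi> m \<otimes>\<^bsub>B\<^esub> \<phi> x" if "m \<in> M" for m
    using that assms(3,7) M.subset by (auto simp: hom_def)
  have **: "\<phi> m \<in> N" if "m \<in> M" for m using that assms(6) by auto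
  have assoc: "n \<otimes>\<^bsub>B\<^esub> (\<phi> m \<otimes>\<^bsub>B\<^esub> \<phi> x) = (n \<otimes>\<^bsub>B\<^esub> \<phi> m) \<otimes>\<^bsub>B\<^esub> \<phi> x" if "n \<in> N" "m \<in> M" for n m
    using that ** phx N.mem_carrier by (simp add: B.m_assoc)
  have one: "\<phi> \<one>\<^bsub>A\<^esub> = \<one>\<^bsub>B\<^esub>"
    using assms by (simp add: hom_one)
  show ?thesis
  proof
    show "quotient_map B N \<phi> (M #>\<^bsub>A\<^esub> x) \<subseteq> N #>\<^bsub>B\<^esub> \<phi> x"
    proof
      fix y assume "y \<in> quotient_map B N \<phi> (M #>\<^bsub>A\<^esub> x)"
      then obtain n m where "n \<in> N" "m \<in> M" "y = n \<otimes>\<^bsub>B\<^esub> \<phi> (m \<otimes>\<^bsub>A\<^esub> x)"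
        unfolding quotient_map_def set_mult_def r_coset_def by blast
      then show "y \<in> N #>\<^bsub>B\<^esub> \<phi> x"
        unfolding r_coset_def using *[of m] assoc[of n m] N.m_closed[of n "\<phi> m"] **[of m] by auto
    qed
    show "N #>\<^bsub>B\<^esub> \<phi> x \<subseteq> quotient_map B N \<phi> (M #>\<^bsub>A\<^esub> x)"
    proof
      fix y assume "y \<in> N #>\<^bsub>B\<^esub> \<phi> x"
      then obtain n where n: "n \<in> N" "y = n \<otimes>\<^bsub>B\<^esub> \<phi> x" unfolding r_coset_def by blast
      then have "y = n \<otimes>\<^bsub>B\<^esub> \<phi> (\<one>\<^bsub>A\<^esub> \<otimes>\<^bsub>A\<^esub> x)"
        using *[OF M.one_closed] one phx by simp
      then show "y \<in> quotient_map B N \<phi> (M #>\<^bsub>A\<^esub> x)"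
        unfolding quotient_map_def set_mult_def r_coset_def using n(1) M.one_closed by blast
    qed
  qed
qed

lemma rcoset_eq_iff:
  assumes "group G" "subgroup H G" "x \<in> carrier G" "y \<in> carrier G"
  shows "H #>\<^bsub>G\<^esub> x = H #>\<^bsub>G\<^esub> y \<longleftrightarrow> x \<otimes>\<^bsub>G\<^esub> inv\<^bsub>G\<^esub> y \<in> H"
proof -
  interpret group G by fact
  interpret subgroup H G by fact
  show ?thesis
  proof
    assume "H #>\<^bsub>G\<^esub> x = H #>\<^bsub>G\<^esub> y"
    then have "x \<in> H #>\<^bsub>G\<^esub> y" using rcos_self[OF assms(3,2)] by simp
    then show "x \<otimes>\<^bsub>G\<^esub> inv\<^bsub>G\<^esub> y \<in> H" using rcos_module[OF assms(1,4,3)] by simp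
  next
    assume "x \<otimes>\<^bsub>G\<^esub> inv\<^bsub>G\<^esub> y \<in> H"
    then have "x \<in> H #>\<^bsub>G\<^esub> y" using rcos_module[OF assms(1,4,3)] by simp
    then show "H #>\<^bsub>G\<^esub> x = H #>\<^bsub>G\<^esub> y" using repr_independence[OF _ assms(4,2)] by simp
  qed
qed

lemma FactGroup_universal_comm:
  assumes A: "comm_group A" and B: "comm_group B" and h: "h \<in> hom A B" and N: "subgroup N A"
    and tr: "\<And>x. x \<in> N \<Longrightarrow> h x = \<one>\<^bsub>B\<^esub>"
  obtains g where "g \<in> hom (A Mod N) B" "\<And>x. x \<in> carrier A \<Longrightarrow> g (N #>\<^bsub>A\<^esub> x) = h x"
proof (rule FactGroup_universal[OF h])
  interpret A: comm_group A by fact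
  interpret B: comm_group B by fact
  interpret group_hom A B h using h by unfold_locales
  show "N \<lhd> A" using N A.normal_iff_subgroup by blast
  fix x y assume xy: "x \<in> carrier A" "y \<in> carrier A" "N #>\<^bsub>A\<^esub> x = N #>\<^bsub>A\<^esub> y"
  then have "x \<otimes>\<^bsub>A\<^esub> inv\<^bsub>A\<^esub> y \<in> N" using rcoset_eq_iff N A.is_group by metis
  then have "h (x \<otimes>\<^bsub>A\<^esub> inv\<^bsub>A\<^esub> y) = \<one>\<^bsub>B\<^esub>" by (rule tr)
  then have "h x \<otimes>\<^bsub>B\<^esub> inv\<^bsub>B\<^esub> h y = \<one>\<^bsub>B\<^esub>" using xy by simp
  then show "h x = h y" using xy by (metis B.inv_equality B.inv_inv hom_closed B.inv_closed)
qed (use that in blast)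

lemma comm_group_FactGroup:
  assumes "comm_group A" "subgroup N A" shows "comm_group (A Mod N)"
  using assms comm_group.abelian_FactGroup by blast

subsection \<open>Tensor products\<close>

lemma frag_of_diff_closed:
  assumes "u \<in> S" "v \<in> S" "w \<in> S"
  shows "frag_of u - frag_of v - frag_of w \<in> carrier (free_Abelian_group S)"
proof -
  have "Poly_Mapping.keys (frag_of u - frag_of v - frag_of w) \<subseteq> {u, v, w}"
    by (rule order_trans[OF keys_diff]) (use keys_diff[of "frag_of u" "frag_of v"] in auto)
  then show ?thesis using assms unfolding carrier_free_Abelian_group_iff by blast
qed

lemma tensor_relations_gens:
  assumes "comm_group A" "comm_group B"
  shows "{frag_of (a \<otimes>\<^bsub>A\<^esub> a', b) - frag_of (a, b) - frag_of (a', b) | a a' b.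
           a \<in> carrier A \<and> a' \<in> carrier A \<and> b \<in> carrier B} \<union>
        {frag_of (a, b \<otimes>\<^bsub>B\<^esub> b') - frag_of (a, b) - frag_of (a, b') | a b b'.
           a \<in> carrier A \<and> b \<in> carrier B \<and> b' \<in> carrier B}
     \<subseteq> carrier (free_Abelian_group (carrier A \<times> carrier B))" (is "?R \<subseteq> _")
proof -
  interpret A: comm_group A by fact
  interpret B: comm_group B by fact
  show ?thesis
    by (rule Un_least; clarify; rule frag_of_diff_closed) simp_all
qed

lemma tensor_relations_subgroup:
  assumes "comm_group A" "comm_group B"
  shows "subgroup (tensor_relations A B) (free_Abelian_group (carrier A \<times> carrier B))"
  unfolding tensor_relations_def
  by (rule group.generate_is_subgroup[OF group_free_Abelian_group tensor_relations_gens[OF assms]])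

lemma comm_group_tensor:
  assumes "comm_group A" "comm_group B" shows "comm_group (tensor A B)"
  unfolding tensor_def
  by (rule comm_group_FactGroup[OF abelian_free_Abelian_group tensor_relations_subgroup[OF assms]])

lemma pure_tensor_closed:
  assumes "a \<in> carrier A" "b \<in> carrier B"
  shows "pure_tensor A B a b \<in> carrier (tensor A B)"
  unfolding pure_tensor_def tensor_def carrier_FactGroup using assms by auto

lemma rcoset_sum_tensor:
  assumes "comm_group A" "comm_group B" "u \<in> carrier (free_Abelian_group (carrier A \<times> carrier B))"
     "v \<in> carrier (free_Abelian_group (carrier A \<times> carrier B))"
  shows "(tensor_relations A B #>\<^bsub>free_Abelian_group (carrier A \<times> carrier B)\<^esub> u) \<otimes>\<^bsub>tensor A B\<^esub>
    (tensor_relations A B #>\<^bsub>free_Abelian_group (carrier A \<times> carrier B)\<^esub> v) =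
    tensor_relations A B #>\<^bsub>free_Abelian_group (carrier A \<times> carrier B)\<^esub> (u + v)"
proof -
  interpret comm_group "free_Abelian_group (carrier A \<times> carrier B)"
    by (rule abelian_free_Abelian_group)
  interpret normal "tensor_relations A B" "free_Abelian_group (carrier A \<times> carrier B)"
    using tensor_relations_subgroup[OF assms(1,2)] normal_iff_subgroup by blast
  show ?thesis unfolding tensor_def using rcos_sum[OF assms(3,4)] by simp
qed

text \<open>Both families of tensor relations have the shape u - v - w on generators, so additivity
  in either argument is an instance of this one lemma.\<close>

lemma pure_tensor_eqI:
  assumes "comm_group A" "comm_group B"
    and "frag_of u - frag_of v - frag_of w \<in> tensor_relations A B"
    and uvw: "u \<in> carrier A \<times> carrier B" "v \<in> carrier A \<times> carrier B" "w \<in> carrier A \<times> carrier B"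
  shows "pure_tensor A B (fst u) (snd u) =
    pure_tensor A B (fst v) (snd v) \<otimes>\<^bsub>tensor A B\<^esub> pure_tensor A B (fst w) (snd w)"
proof -
  have k: "Poly_Mapping.keys (frag_of v + frag_of w) \<subseteq> carrier A \<times> carrier B"
    by (rule order_trans[OF keys_add]) (use uvw in auto)
  have "tensor_relations A B #>\<^bsub>free_Abelian_group (carrier A \<times> carrier B)\<^esub> frag_of u =
     tensor_relations A B #>\<^bsub>free_Abelian_group (carrier A \<times> carrier B)\<^esub> (frag_of v + frag_of w)"
    using uvw k assms(3)
    by (subst rcoset_eq_iff[OF group_free_Abelian_group tensor_relations_subgroup[OF assms(1,2)]])
       (auto simp: inv_free_Abelian_group algebra_simps)
  then show ?thesis
    unfolding pure_tensor_def using rcoset_sum_tensor[OF assms(1,2), of "frag_of v" "frag_of w"] uvw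
    by simp
qed

lemma pure_tensor_add_left:
  assumes "comm_group A" "comm_group B" "a \<in> carrier A" "a' \<in> carrier A" "b \<in> carrier B"
  shows "pure_tensor A B (a \<otimes>\<^bsub>A\<^esub> a') b = pure_tensor A B a b \<otimes>\<^bsub>tensor A B\<^esub> pure_tensor A B a' b"
proof -
  interpret A: comm_group A by fact
  have "frag_of (a \<otimes>\<^bsub>A\<^esub> a', b) - frag_of (a, b) - frag_of (a', b) \<in> tensor_relations A B"
    unfolding tensor_relations_def by (rule generate.incl) (use assms(3-) in blast)
  from pure_tensor_eqI[OF assms(1,2) this] show ?thesis using assms(3-) by simp
qed

lemma pure_tensor_add_right:
  assumes "comm_group A" "comm_group B" "a \<in> carrier A" "b \<in> carrier B" "b' \<in> carrier B"
  shows "pure_tensor A B a (b \<otimes>\<^bsub>B\<^esub> b') = pure_tensor A B a b \<otimes>\<^bsub>tensor A B\<^esub> pure_tensor A B a b'"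
proof -
  interpret B: comm_group B by fact
  have "frag_of (a, b \<otimes>\<^bsub>B\<^esub> b') - frag_of (a, b) - frag_of (a, b') \<in> tensor_relations A B"
    unfolding tensor_relations_def by (rule generate.incl) (use assms(3-) in blast)
  from pure_tensor_eqI[OF assms(1,2) this] show ?thesis using assms(3-) by simp
qed

lemma pure_tensor_hom_left:
  assumes "comm_group A" "comm_group B" "b \<in> carrier B"
  shows "(\<lambda>a. pure_tensor A B a b) \<in> hom A (tensor A B)"
  by (intro homI pure_tensor_closed pure_tensor_add_left assms)

lemma pure_tensor_hom_right:
  assumes "comm_group A" "comm_group B" "a \<in> carrier A"
  shows "(\<lambda>b. pure_tensor A B a b) \<in> hom B (tensor A B)"
  by (intro homI pure_tensor_closed pure_tensor_add_right assms)

text \<open>Pulled back along the projection, both maps are homomorphisms on a free abelian group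
  that agree on its basis. Later identities between maps on tensor products are reduced to pure
  tensors in this way.\<close>

lemma tensor_hom_eqI:
  assumes A: "comm_group A" and B: "comm_group B" and D: "group D"
    and h: "h \<in> hom (tensor A B) D" "h' \<in> hom (tensor A B) D"
    and eq: "\<And>a b. a \<in> carrier A \<Longrightarrow> b \<in> carrier B \<Longrightarrow> h (pure_tensor A B a b) = h' (pure_tensor A B a b)"
    and t: "t \<in> carrier (tensor A B)"
  shows "h t = h' t"
proof -
  let ?F = "free_Abelian_group (carrier A \<times> carrier B)"
  let ?q = "\<lambda>x. tensor_relations A B #>\<^bsub>?F\<^esub> x"
  interpret T: comm_group "tensor A B" using comm_group_tensor A B .
  interpret D: group D by fact
  interpret F: comm_group ?F by (rule abelian_free_Abelian_group)
  interpret N: normal "tensor_relations A B" ?F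
    using tensor_relations_subgroup[OF A B] F.normal_iff_subgroup by blast
  have q: "?q \<in> hom ?F (tensor A B)" unfolding tensor_def by (rule N.r_coset_hom_Mod)
  interpret h1: group_hom ?F D "h \<circ> ?q" using hom_compose[OF q h(1)] by unfold_locales
  interpret h2: group_hom ?F D "h' \<circ> ?q" using hom_compose[OF q h(2)] by unfold_locales
  obtain x where x: "x \<in> carrier ?F" "t = ?q x" using t unfolding tensor_def carrier_FactGroup by auto
  from x(1) have "Poly_Mapping.keys x \<subseteq> carrier A \<times> carrier B" by simp
  then have "(h \<circ> ?q) x = (h' \<circ> ?q) x"
  proof (rule free_Abelian_group_induct)
    show "(h \<circ> ?q) 0 = (h' \<circ> ?q) 0" using h1.hom_one h2.hom_one by simp
  next
    fix x y assume xy: "Poly_Mapping.keys x \<subseteq> carrier A \<times> carrier B"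
      "Poly_Mapping.keys y \<subseteq> carrier A \<times> carrier B"
      "(h \<circ> ?q) x = (h' \<circ> ?q) x" "(h \<circ> ?q) y = (h' \<circ> ?q) y"
    have "x - y = x \<otimes>\<^bsub>?F\<^esub> inv\<^bsub>?F\<^esub> y" using xy by simp
    then show "(h \<circ> ?q) (x - y) = (h' \<circ> ?q) (x - y)"
      using xy h1.hom_mult[of x "inv\<^bsub>?F\<^esub> y"] h2.hom_mult[of x "inv\<^bsub>?F\<^esub> y"]
        h1.hom_inv[of y] h2.hom_inv[of y] F.inv_closed[of y]
      by (metis carrier_free_Abelian_group_iff)
  next
    fix u assume "u \<in> carrier A \<times> carrier B"
    then show "(h \<circ> ?q) (frag_of u) = (h' \<circ> ?q) (frag_of u)"
      using eq[of "fst u" "snd u"] by (auto simp: pure_tensor_def)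
  qed
  then show ?thesis unfolding x(2) comp_apply .
qed

lemma tensor_universal:
  assumes A: "comm_group A" and B: "comm_group B" and D: "comm_group D"
    and f: "\<And>a b. a \<in> carrier A \<Longrightarrow> b \<in> carrier B \<Longrightarrow> f a b \<in> carrier D"
    and fl: "\<And>a a' b. a \<in> carrier A \<Longrightarrow> a' \<in> carrier A \<Longrightarrow> b \<in> carrier B \<Longrightarrow>
        f (a \<otimes>\<^bsub>A\<^esub> a') b = f a b \<otimes>\<^bsub>D\<^esub> f a' b"
    and fr: "\<And>a b b'. a \<in> carrier A \<Longrightarrow> b \<in> carrier B \<Longrightarrow> b' \<in> carrier B \<Longrightarrow>
        f a (b \<otimes>\<^bsub>B\<^esub> b') = f a b \<otimes>\<^bsub>D\<^esub> f a b'"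
  obtains h where "h \<in> hom (tensor A B) D"
    "\<And>a b. a \<in> carrier A \<Longrightarrow> b \<in> carrier B \<Longrightarrow> h (pure_tensor A B a b) = f a b"
proof -
  let ?F = "free_Abelian_group (carrier A \<times> carrier B)"
  interpret A: comm_group A by fact
  interpret B: comm_group B by fact
  interpret D: comm_group D by fact
  interpret F: comm_group ?F by (rule abelian_free_Abelian_group)
  have img: "case_prod f ` (carrier A \<times> carrier B) \<subseteq> carrier D" using f by auto
  obtain k where k: "k \<in> hom ?F D" "\<And>x. x \<in> carrier A \<times> carrier B \<Longrightarrow> k (frag_of x) = case_prod f x"
    by (rule D.free_Abelian_group_universal[OF img]) blast
  interpret k: group_hom ?F D k using k(1) by unfold_locales
  have diff: "k (u - v) = k u \<otimes>\<^bsub>D\<^esub> inv\<^bsub>D\<^esub> k v" if "u \<in> carrier ?F" "v \<in> carrier ?F" for u v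
  proof -
    have "u - v = u \<otimes>\<^bsub>?F\<^esub> inv\<^bsub>?F\<^esub> v" using that by simp
    then show ?thesis using that k.hom_mult[of u "inv\<^bsub>?F\<^esub> v"] k.hom_inv[of v] F.inv_closed[of v] by metis
  qed
  have rel: "k (frag_of u - frag_of v - frag_of w) = \<one>\<^bsub>D\<^esub>"
    if "u \<in> carrier A \<times> carrier B" "v \<in> carrier A \<times> carrier B" "w \<in> carrier A \<times> carrier B"
       "case_prod f u = case_prod f v \<otimes>\<^bsub>D\<^esub> case_prod f w" for u v w
  proof -
    have uv: "frag_of u - frag_of v \<in> carrier ?F"
      unfolding carrier_free_Abelian_group_iff
      by (rule order_trans[OF keys_diff]) (use that(1,2) in simp)
    have c: "case_prod f v \<in> carrier D" "case_prod f w \<in> carrier D" using f that by auto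
    have "k (frag_of u - frag_of v - frag_of w) = k (frag_of u - frag_of v) \<otimes>\<^bsub>D\<^esub> inv\<^bsub>D\<^esub> k (frag_of w)"
      using uv that by (intro diff) auto
    also have "\<dots> = (k (frag_of u) \<otimes>\<^bsub>D\<^esub> inv\<^bsub>D\<^esub> k (frag_of v)) \<otimes>\<^bsub>D\<^esub> inv\<^bsub>D\<^esub> k (frag_of w)"
      using that by (subst diff) auto
    also have "\<dots> = (case_prod f v \<otimes>\<^bsub>D\<^esub> case_prod f w \<otimes>\<^bsub>D\<^esub> inv\<^bsub>D\<^esub> case_prod f v) \<otimes>\<^bsub>D\<^esub> inv\<^bsub>D\<^esub> case_prod f w"
      using that k(2) by simp
    also have "\<dots> = \<one>\<^bsub>D\<^esub>" using c by (metis D.inv_closed D.inv_solve_right' D.l_one D.m_closed D.m_comm D.one_closed D.r_inv)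
    finally show ?thesis .
  qed
  have "k ` tensor_relations A B \<subseteq> {\<one>\<^bsub>D\<^esub>}"
    unfolding tensor_relations_def
  proof (rule hom_generate_subset[OF F.is_group D.is_group k(1) tensor_relations_gens[OF A B] D.triv_subgroup], safe)
    fix a a' b assume "a \<in> carrier A" "a' \<in> carrier A" "b \<in> carrier B"
    then show "k (frag_of (a \<otimes>\<^bsub>A\<^esub> a', b) - frag_of (a, b) - frag_of (a', b)) = \<one>\<^bsub>D\<^esub>"
      by (intro rel) (auto simp: fl)
  next
    fix a b b' assume "a \<in> carrier A" "b \<in> carrier B" "b' \<in> carrier B"
    then show "k (frag_of (a, b \<otimes>\<^bsub>B\<^esub> b') - frag_of (a, b) - frag_of (a, b')) = \<one>\<^bsub>D\<^esub>"
      by (intro rel) (auto simp: fr)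
  qed
  then have tr: "k x = \<one>\<^bsub>D\<^esub>" if "x \<in> tensor_relations A B" for x
    using that by blast
  obtain h where h: "h \<in> hom (?F Mod tensor_relations A B) D"
     "\<And>x. x \<in> carrier ?F \<Longrightarrow> h (tensor_relations A B #>\<^bsub>?F\<^esub> x) = k x"
    by (rule FactGroup_universal_comm[OF abelian_free_Abelian_group D k(1)
          tensor_relations_subgroup[OF A B] tr]) (assumption, rule that, assumption, simp)
  show thesis
  proof (rule that[of h])
    show "h \<in> hom (tensor A B) D" unfolding tensor_def by (rule h(1))
    show "h (pure_tensor A B a b) = f a b" if "a \<in> carrier A" "b \<in> carrier B" for a b
      unfolding pure_tensor_def using h(2)[of "frag_of (a, b)"] k(2)[of "(a, b)"] that by simp
  qed
qed

lemma tensor_map_properties: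
  fixes A' :: "('e, 'f) monoid_scheme" and A :: "('a, 'b) monoid_scheme" and B :: "('c, 'd) monoid_scheme"
  assumes A': "comm_group A'" and A: "comm_group A" and B: "comm_group B" and \<phi>: "\<phi> \<in> hom A' A"
  shows tensor_map_hom: "tensor_map A B \<phi> \<in> hom (tensor A' B) (tensor A B)"
    and tensor_map_pure: "\<And>a b. a \<in> carrier A' \<Longrightarrow> b \<in> carrier B \<Longrightarrow>
      tensor_map A B \<phi> (pure_tensor A' B a b) = pure_tensor A B (\<phi> a) b"
proof -
  let ?F = "free_Abelian_group (carrier A \<times> carrier B)"
  let ?F' = "free_Abelian_group (carrier A' \<times> carrier B)"
  let ?e = "frag_extend (\<lambda>(x, b). frag_of (\<phi> x, b)) :: ('e \<times> 'c \<Rightarrow>\<^sub>0 int) \<Rightarrow> ('a \<times> 'c \<Rightarrow>\<^sub>0 int)"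
  interpret A: comm_group A by fact
  interpret A': comm_group A' by fact
  interpret B: comm_group B by fact
  have \<phi>c: "\<phi> a \<in> carrier A" if "a \<in> carrier A'" for a using \<phi> that by (auto simp: hom_def)
  have e: "?e \<in> hom ?F' ?F"
  proof (rule homI)
    fix x assume x: "x \<in> carrier ?F'"
    show "?e x \<in> carrier ?F"
      unfolding carrier_free_Abelian_group_iff
    proof (rule order_trans[OF keys_frag_extend], rule UN_least)
      fix u assume "u \<in> Poly_Mapping.keys x"
      then have "u \<in> carrier A' \<times> carrier B" using x by auto
      then show "Poly_Mapping.keys ((\<lambda>(x, b). frag_of (\<phi> x, b)) u) \<subseteq> carrier A \<times> carrier B"
        using \<phi>c by auto
    qed
  qed (simp add: frag_extend_add)
  have er: "?e ` tensor_relations A' B \<subseteq> tensor_relations A B"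
    unfolding tensor_relations_def[of A' B]
  proof (rule hom_generate_subset[OF group_free_Abelian_group group_free_Abelian_group e
        tensor_relations_gens[OF A' B] tensor_relations_subgroup[OF A B]], safe)
    fix a a' b assume *: "a \<in> carrier A'" "a' \<in> carrier A'" "b \<in> carrier B"
    then show "?e (frag_of (a \<otimes>\<^bsub>A'\<^esub> a', b) - frag_of (a, b) - frag_of (a', b)) \<in> tensor_relations A B"
      unfolding tensor_relations_def frag_extend_diff frag_extend_of case_prod_conv hom_mult[OF \<phi> *(1,2)]
      using \<phi>c[OF *(1)] \<phi>c[OF *(2)] *(3)
      by - (rule generate.incl, rule UnI1, blast)
  next
    fix a b b' assume *: "a \<in> carrier A'" "b \<in> carrier B" "b' \<in> carrier B"
    then show "?e (frag_of (a, b \<otimes>\<^bsub>B\<^esub> b') - frag_of (a, b) - frag_of (a, b')) \<in> tensor_relations A B"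
      unfolding tensor_relations_def frag_extend_diff frag_extend_of case_prod_conv
      using \<phi>c[OF *(1)] *(2,3)
      by - (rule generate.incl, rule UnI2, blast)
  qed
  have q: "tensor_map A B \<phi> (tensor_relations A' B #>\<^bsub>?F'\<^esub> x) = tensor_relations A B #>\<^bsub>?F\<^esub> ?e x"
    if "x \<in> carrier ?F'" for x
    unfolding tensor_map_def
    by (rule quotient_map_rcoset[OF group_free_Abelian_group group_free_Abelian_group e
         tensor_relations_subgroup[OF A' B] tensor_relations_subgroup[OF A B] er that])
  show "tensor_map A B \<phi> (pure_tensor A' B a b) = pure_tensor A B (\<phi> a) b"
    if "a \<in> carrier A'" "b \<in> carrier B" for a b
    using q[of "frag_of (a,b)"] that by (simp add: pure_tensor_def)
  show "tensor_map A B \<phi> \<in> hom (tensor A' B) (tensor A B)"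
  proof (rule homI)
    fix s assume "s \<in> carrier (tensor A' B)"
    then obtain x where x: "x \<in> carrier ?F'" "s = tensor_relations A' B #>\<^bsub>?F'\<^esub> x"
      unfolding tensor_def carrier_FactGroup by auto
    have ex: "?e x \<in> carrier ?F" using hom_in_carrier[OF e x(1)] .
    show "tensor_map A B \<phi> s \<in> carrier (tensor A B)"
      unfolding x(2) q[OF x(1)] using ex unfolding tensor_def carrier_FactGroup by blast
    fix t assume "t \<in> carrier (tensor A' B)"
    then obtain y where y: "y \<in> carrier ?F'" "t = tensor_relations A' B #>\<^bsub>?F'\<^esub> y"
      unfolding tensor_def carrier_FactGroup by auto
    have ey: "?e y \<in> carrier ?F" using hom_in_carrier[OF e y(1)] .
    have xy: "x + y \<in> carrier ?F'" using x(1) y(1) keys_add[of x y] by auto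
    show "tensor_map A B \<phi> (s \<otimes>\<^bsub>tensor A' B\<^esub> t) = tensor_map A B \<phi> s \<otimes>\<^bsub>tensor A B\<^esub> tensor_map A B \<phi> t"
      unfolding x(2) y(2) rcoset_sum_tensor[OF A' B x(1) y(1)] q[OF x(1)] q[OF y(1)] q[OF xy]
        rcoset_sum_tensor[OF A B ex ey] frag_extend_add ..
  qed
qed

subsection \<open>The \<open>p\<close>-adic integers\<close>

lemma carrier_Zp: "z \<in> carrier (add_monoid (padic_integers p)) \<longleftrightarrow>
    (\<forall>n. z n \<in> {0..<int p ^ n} \<and> z (Suc n) mod int p ^ n = z n)"
  by (simp add: padic_integers_def)

lemma mult_Zp: "x \<otimes>\<^bsub>add_monoid (padic_integers p)\<^esub> y = (\<lambda>n. (x n + y n) mod int p ^ n)"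
  by (simp add: padic_integers_def)

lemma one_Zp: "\<one>\<^bsub>add_monoid (padic_integers p)\<^esub> = (\<lambda>n. 0)"
  by (simp add: padic_integers_def)

lemma Zp_mod_mod: "(x mod int p ^ Suc n) mod int p ^ n = x mod int p ^ n"
  by (rule mod_mod_cancel) simp

text \<open>Lets a p-adic integer be given by any integers that are compatible modulo the powers of
  p; the canonical residues demanded by \<open>padic_integers\<close> are taken only at the
  end.\<close>

lemma Zp_memI:
  assumes "p > 0" "\<And>n. x (Suc n) mod int p ^ n = x n mod int p ^ n"
  shows "(\<lambda>n. x n mod int p ^ n) \<in> carrier (add_monoid (padic_integers p))"
  unfolding carrier_Zp Zp_mod_mod using assms by simp

lemma Zp_mod:
  assumes "z \<in> carrier (add_monoid (padic_integers p))"
  shows "z (Suc n) mod int p ^ n = z n mod int p ^ n" "z n mod int p ^ n = z n"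
  using assms unfolding carrier_Zp by (auto simp: Ball_def)

lemma Zp_mod_le:
  assumes "z \<in> carrier (add_monoid (padic_integers p))" "n \<le> k"
  shows "z k mod int p ^ n = z n"
  using assms(2)
proof (induction k rule: dec_induct)
  case (step m)
  have "z (Suc m) mod int p ^ n = (z (Suc m) mod int p ^ m) mod int p ^ n"
    using step(1) by (simp add: mod_mod_cancel le_imp_power_dvd)
  then show ?case using assms(1) step unfolding carrier_Zp by simp
qed (use assms(1) Zp_mod in auto)

lemma comm_group_Zp:
  assumes "p > 0" shows "comm_group (add_monoid (padic_integers p))"
proof (rule comm_groupI)
  let ?Z = "add_monoid (padic_integers p)"
  fix x y z assume x: "x \<in> carrier ?Z" and y: "y \<in> carrier ?Z"
  show "x \<otimes>\<^bsub>?Z\<^esub> y \<in> carrier ?Z"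
    unfolding mult_Zp using Zp_mod(1)[OF x] Zp_mod(1)[OF y] assms by (intro Zp_memI) (auto intro: mod_add_cong)
  show "x \<otimes>\<^bsub>?Z\<^esub> y = y \<otimes>\<^bsub>?Z\<^esub> x" unfolding mult_Zp by (simp add: add.commute)
  assume z: "z \<in> carrier ?Z"
  show "x \<otimes>\<^bsub>?Z\<^esub> y \<otimes>\<^bsub>?Z\<^esub> z = x \<otimes>\<^bsub>?Z\<^esub> (y \<otimes>\<^bsub>?Z\<^esub> z)"
    unfolding mult_Zp by (simp add: mod_simps add.assoc)
next
  let ?Z = "add_monoid (padic_integers p)"
  show "\<one>\<^bsub>?Z\<^esub> \<in> carrier ?Z" unfolding one_Zp carrier_Zp using assms by simp
  fix x assume x: "x \<in> carrier ?Z"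
  show "\<one>\<^bsub>?Z\<^esub> \<otimes>\<^bsub>?Z\<^esub> x = x" unfolding one_Zp mult_Zp using Zp_mod[OF x] by simp
  have "(\<lambda>n. (- x n) mod int p ^ n) \<in> carrier ?Z"
    using assms Zp_mod(1)[OF x] by (intro Zp_memI mod_minus_cong) auto
  moreover have "(\<lambda>n. (- x n) mod int p ^ n) \<otimes>\<^bsub>?Z\<^esub> x = \<one>\<^bsub>?Z\<^esub>"
    unfolding one_Zp mult_Zp by (simp add: mod_simps)
  ultimately show "\<exists>y\<in>carrier ?Z. y \<otimes>\<^bsub>?Z\<^esub> x = \<one>\<^bsub>?Z\<^esub>" by blast
qed

lemma Zp_mult_closed:
  assumes "p > 0" "x \<in> carrier (add_monoid (padic_integers p))" "y \<in> carrier (add_monoid (padic_integers p))"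
  shows "x \<otimes>\<^bsub>padic_integers p\<^esub> y \<in> carrier (add_monoid (padic_integers p))"
proof -
  have "(\<lambda>n. (x n * y n) mod int p ^ n) \<in> carrier (add_monoid (padic_integers p))"
    by (rule Zp_memI[OF assms(1)], rule mod_mult_cong) (rule Zp_mod(1)[OF assms(2)], rule Zp_mod(1)[OF assms(3)])
  then show ?thesis by (simp add: padic_integers_def)
qed

lemma Zp_mult_distrib:
  "x \<otimes>\<^bsub>padic_integers p\<^esub> (y \<otimes>\<^bsub>add_monoid (padic_integers p)\<^esub> z) =
   (x \<otimes>\<^bsub>padic_integers p\<^esub> y) \<otimes>\<^bsub>add_monoid (padic_integers p)\<^esub> (x \<otimes>\<^bsub>padic_integers p\<^esub> z)"
  by (simp add: padic_integers_def mod_simps distrib_left)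

lemma Zp_one_closed:
  assumes "p > 0" shows "\<one>\<^bsub>padic_integers p\<^esub> \<in> carrier (add_monoid (padic_integers p))"
  using Zp_memI[of p "\<lambda>n. 1"] assms by (simp add: padic_integers_def)

lemma Zp_mult_one:
  assumes "x \<in> carrier (add_monoid (padic_integers p))"
  shows "x \<otimes>\<^bsub>padic_integers p\<^esub> \<one>\<^bsub>padic_integers p\<^esub> = x"
  using Zp_mod(2)[OF assms] by (simp add: padic_integers_def mod_simps)

text \<open>The power is taken in the additive group, so it is an m-fold sum.\<close>

lemma Zp_pow:
  "z [^]\<^bsub>add_monoid (padic_integers p)\<^esub> (m::nat) = (\<lambda>n. (int m * z n) mod int p ^ n)"
  by (induction m) (auto simp: nat_pow_def padic_integers_def mod_simps algebra_simps)

text \<open>m is inverted modulo each p^n separately. The inverses are compatible because an inverse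
  modulo p^n is unique modulo p^n.\<close>

lemma Zp_inverse_exists:
  assumes "p > 0" "coprime m p"
  obtains v where "v \<in> carrier (add_monoid (padic_integers p))" "\<And>n. (int m * v n) mod int p ^ n = 1 mod int p ^ n"
proof -
  have "\<exists>x. [int m * x = 1] (mod int p ^ n)" for n
    using assms by (intro cong_solve_coprime_int) auto
  then obtain f where f: "\<And>n. [int m * f n = 1] (mod int p ^ n)" by metis
  show thesis
  proof
    show "(\<lambda>n. f n mod int p ^ n) \<in> carrier (add_monoid (padic_integers p))"
    proof (rule Zp_memI)
      fix n
      have "[int m * f (Suc n) = 1] (mod int p ^ n)"
        using f[of "Suc n"] by (rule cong_dvd_modulus) simp
      then have "[int m * f (Suc n) = int m * f n] (mod int p ^ n)"
        using f[of n] cong_sym cong_trans by blast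
      moreover have "coprime (int m) (int p ^ n)" using assms by simp
      ultimately show "f (Suc n) mod int p ^ n = f n mod int p ^ n"
        using cong_mult_lcancel cong_def by metis
    qed fact
    show "int m * (f n mod int p ^ n) mod int p ^ n = 1 mod int p ^ n" for n
      using f[of n] by (simp add: cong_def mod_simps)
  qed
qed

text \<open>Z_p = Z + p^k Z_p, with the residue \<open>z k\<close> as the integer part. This
  separates the part of z that matters for a group killed by p^k from the part that acts as zero on
  it.\<close>

lemma Zp_shift_exists:
  assumes "p > 0" and z: "z \<in> carrier (add_monoid (padic_integers p))"
  obtains w where "w \<in> carrier (add_monoid (padic_integers p))"
    "\<And>n. z n = (z k + int p ^ k * w n) mod int p ^ n"
proof -
  \<comment> \<open>Division by p^k costs k levels of precision, so level n of the quotient is read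
    off level n + k of z.\<close>
  define w where "w n = (z (n + k) - z k) div int p ^ k" for n
  have w: "z (n + k) = z k + int p ^ k * w n" for n
  proof -
    have "z (n + k) mod int p ^ k = z k mod int p ^ k" using Zp_mod_le[OF z, of k "n+k"] Zp_mod(2)[OF z] by simp
    then have "int p ^ k dvd z (n + k) - z k" by (simp add: mod_eq_dvd_iff)
    then show ?thesis unfolding w_def by simp
  qed
  show thesis
  proof
    show "(\<lambda>n. w n mod int p ^ n) \<in> carrier (add_monoid (padic_integers p))"
    proof (rule Zp_memI)
      fix n
      have "z (Suc n + k) mod int p ^ (n + k) = z (n + k) mod int p ^ (n + k)"
        using Zp_mod(1)[OF z, of "n + k"] by simp
      then have "int p ^ (n + k) dvd z (Suc n + k) - z (n + k)" by (simp add: mod_eq_dvd_iff)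
      also have "z (Suc n + k) - z (n + k) = int p ^ k * (w (Suc n) - w n)" unfolding w by (simp add: algebra_simps)
      finally have "int p ^ k * int p ^ n dvd int p ^ k * (w (Suc n) - w n)" by (simp add: power_add mult.commute)
      then have "int p ^ n dvd w (Suc n) - w n" using assms(1) by simp
      then show "w (Suc n) mod int p ^ n = w n mod int p ^ n" by (simp add: mod_eq_dvd_iff)
    qed fact
    show "z n = (z k + int p ^ k * (w n mod int p ^ n)) mod int p ^ n" for n
    proof -
      have "z n = (z k + int p ^ k * w n) mod int p ^ n"
        using Zp_mod_le[OF z, of n "n + k"] unfolding w by simp
      also have "\<dots> = (z k + int p ^ k * (w n mod int p ^ n)) mod int p ^ n"
        by (intro mod_add_cong refl) (simp add: mod_mult_right_eq)
      finally show ?thesis .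
    qed
  qed
qed

lemma comm_group_tensor_Zp:
  assumes "comm_group A" "p > 0" shows "comm_group (tensor_Zp p A)"
  by (rule comm_group_tensor[OF assms(1) comm_group_Zp[OF assms(2)]])

lemma nat_pow_hom:
  assumes "comm_group A" shows "(\<lambda>x. x [^]\<^bsub>A\<^esub> (m::nat)) \<in> hom A A"
proof -
  interpret comm_group A by fact
  show ?thesis by (auto intro!: homI simp: nat_pow_distrib)
qed

text \<open>Supplies the Z_p-module structure of the tensor product, one scalar at a time: it yields
  division by m and the passage from a (x) 1 to a (x) z.\<close>

lemma tensor_Zp_mult:
  assumes A: "comm_group A" and p: "p > 0" and v: "v \<in> carrier (add_monoid (padic_integers p))"
  obtains h where "h \<in> hom (tensor_Zp p A) (tensor_Zp p A)"
    "\<And>a b. a \<in> carrier A \<Longrightarrow> b \<in> carrier (add_monoid (padic_integers p)) \<Longrightarrow>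
       h (pure_tensor A (add_monoid (padic_integers p)) a b) =
       pure_tensor A (add_monoid (padic_integers p)) a (v \<otimes>\<^bsub>padic_integers p\<^esub> b)"
proof (rule tensor_universal[OF A comm_group_Zp[OF p] comm_group_tensor_Zp[OF A p],
      of "\<lambda>a z. pure_tensor A (add_monoid (padic_integers p)) a (v \<otimes>\<^bsub>padic_integers p\<^esub> z)"])
  note Z = comm_group_Zp[OF p]
  note c = Zp_mult_closed[OF p v]
  show "pure_tensor A (add_monoid (padic_integers p)) a (v \<otimes>\<^bsub>padic_integers p\<^esub> b) \<in> carrier (tensor_Zp p A)"
    if "a \<in> carrier A" "b \<in> carrier (add_monoid (padic_integers p))" for a b
    by (rule pure_tensor_closed[OF that(1) c[OF that(2)]])
  show "pure_tensor A (add_monoid (padic_integers p)) (a \<otimes>\<^bsub>A\<^esub> a') (v \<otimes>\<^bsub>padic_integers p\<^esub> b) =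
     pure_tensor A (add_monoid (padic_integers p)) a (v \<otimes>\<^bsub>padic_integers p\<^esub> b) \<otimes>\<^bsub>tensor_Zp p A\<^esub>
     pure_tensor A (add_monoid (padic_integers p)) a' (v \<otimes>\<^bsub>padic_integers p\<^esub> b)"
    if "a \<in> carrier A" "a' \<in> carrier A" "b \<in> carrier (add_monoid (padic_integers p))" for a a' b
    by (rule pure_tensor_add_left[OF A Z that(1,2) c[OF that(3)]])
  show "pure_tensor A (add_monoid (padic_integers p)) a (v \<otimes>\<^bsub>padic_integers p\<^esub> (b \<otimes>\<^bsub>add_monoid (padic_integers p)\<^esub> b')) =
     pure_tensor A (add_monoid (padic_integers p)) a (v \<otimes>\<^bsub>padic_integers p\<^esub> b) \<otimes>\<^bsub>tensor_Zp p A\<^esub>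
     pure_tensor A (add_monoid (padic_integers p)) a (v \<otimes>\<^bsub>padic_integers p\<^esub> b')"
    if "a \<in> carrier A" "b \<in> carrier (add_monoid (padic_integers p))"
      "b' \<in> carrier (add_monoid (padic_integers p))" for a b b'
    unfolding Zp_mult_distrib by (rule pure_tensor_add_right[OF A Z that(1) c[OF that(2)] c[OF that(3)]])
qed (rule that)

text \<open>The inverse of multiplication by \<open>m\<close> is induced by multiplication by \<open>1/m \<in> \<int>\<^sub>p\<close>.\<close>

lemma tensor_Zp_pow_bij:
  assumes A: "comm_group A" and p: "p > 0" and m: "coprime m p"
  obtains h where "\<And>t. t \<in> carrier (tensor_Zp p A) \<Longrightarrow> h t \<in> carrier (tensor_Zp p A)"
    "\<And>t. t \<in> carrier (tensor_Zp p A) \<Longrightarrow> h t [^]\<^bsub>tensor_Zp p A\<^esub> m = t"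
    "\<And>t. t \<in> carrier (tensor_Zp p A) \<Longrightarrow> h (t [^]\<^bsub>tensor_Zp p A\<^esub> m) = t"
proof -
  let ?Z = "add_monoid (padic_integers p)" and ?T = "tensor_Zp p A"
  note Z = comm_group_Zp[OF p] and T = comm_group_tensor_Zp[OF A p]
  interpret T: comm_group ?T by (rule T)
  interpret Z: comm_group ?Z by (rule Z)
  obtain v where v: "v \<in> carrier ?Z" "\<And>n. (int m * v n) mod int p ^ n = 1 mod int p ^ n"
    by (rule Zp_inverse_exists[OF p m]) (rule that, assumption, simp)
  obtain h where h: "h \<in> hom ?T ?T" "\<And>a b. a \<in> carrier A \<Longrightarrow> b \<in> carrier ?Z \<Longrightarrow>
       h (pure_tensor A ?Z a b) = pure_tensor A ?Z a (v \<otimes>\<^bsub>padic_integers p\<^esub> b)"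
    by (rule tensor_Zp_mult[OF A p v(1)]) (rule that)
  interpret h: group_hom ?T ?T h using h(1) by unfold_locales
  have pow: "(\<lambda>t. h t [^]\<^bsub>?T\<^esub> m) \<in> hom ?T ?T"
    using hom_compose[OF h(1) nat_pow_hom[OF T, of m]] by (simp add: comp_def)
  have 1: "h t [^]\<^bsub>?T\<^esub> m = t" if "t \<in> carrier ?T" for t
  proof (rule tensor_hom_eqI[OF A Z T.is_group pow _ _ that])
    show "(\<lambda>x. x) \<in> hom ?T ?T" by (rule homI) auto
    fix a b assume ab: "a \<in> carrier A" "b \<in> carrier ?Z"
    interpret r: group_hom ?Z ?T "\<lambda>b. pure_tensor A ?Z a b"
      using pure_tensor_hom_right[OF A Z ab(1)] by unfold_locales
    have vb: "v \<otimes>\<^bsub>padic_integers p\<^esub> b \<in> carrier ?Z" by (rule Zp_mult_closed[OF p v(1) ab(2)])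
    have "(v \<otimes>\<^bsub>padic_integers p\<^esub> b) [^]\<^bsub>?Z\<^esub> m = b"
    proof
      fix n
      have "((v \<otimes>\<^bsub>padic_integers p\<^esub> b) [^]\<^bsub>?Z\<^esub> m) n = ((int m * v n) mod int p ^ n * b n) mod int p ^ n"
        unfolding Zp_pow by (simp add: padic_integers_def mod_simps algebra_simps)
      also have "\<dots> = b n" unfolding v(2) using Zp_mod(2)[OF ab(2), of n] by (simp add: mod_simps)
      finally show "((v \<otimes>\<^bsub>padic_integers p\<^esub> b) [^]\<^bsub>?Z\<^esub> m) n = b n" .
    qed
    then show "h (pure_tensor A ?Z a b) [^]\<^bsub>?T\<^esub> m = pure_tensor A ?Z a b"
      using h(2)[OF ab] r.hom_nat_pow[OF vb, of m] by simp
  qed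
  show thesis
  proof (rule that[of h])
    fix t assume t: "t \<in> carrier ?T"
    show "h t \<in> carrier ?T" by (rule h.hom_closed[OF t])
    show "h t [^]\<^bsub>?T\<^esub> m = t" by (rule 1[OF t])
    show "h (t [^]\<^bsub>?T\<^esub> m) = t" unfolding h.hom_nat_pow[OF t] by (rule 1[OF t])
  qed
qed

text \<open>a (x) z is z times a (x) 1, so vanishing at 1 forces vanishing on all of Z_p.\<close>

lemma to_tensor_Zp_trivial:
  assumes A: "comm_group A" and p: "p > 0" and a: "a \<in> carrier A"
    and z: "z \<in> carrier (add_monoid (padic_integers p))"
    and 1: "to_tensor_Zp p A a = \<one>\<^bsub>tensor_Zp p A\<^esub>"
  shows "pure_tensor A (add_monoid (padic_integers p)) a z = \<one>\<^bsub>tensor_Zp p A\<^esub>"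
proof -
  let ?Z = "add_monoid (padic_integers p)" and ?T = "tensor_Zp p A"
  note Z = comm_group_Zp[OF p] and T = comm_group_tensor_Zp[OF A p]
  interpret T: comm_group ?T by (rule T)
  obtain h where h: "h \<in> hom ?T ?T" "\<And>a b. a \<in> carrier A \<Longrightarrow> b \<in> carrier ?Z \<Longrightarrow>
       h (pure_tensor A ?Z a b) = pure_tensor A ?Z a (z \<otimes>\<^bsub>padic_integers p\<^esub> b)"
    by (rule tensor_Zp_mult[OF A p z]) (rule that)
  have "h (to_tensor_Zp p A a) = pure_tensor A ?Z a z"
    unfolding h(2)[OF a Zp_one_closed[OF p]] Zp_mult_one[OF z] ..
  then show ?thesis unfolding 1 using hom_one[OF h(1) T.is_group T.is_group] by simp
qed

text \<open>The inverse sends a (x) z to the power of a with exponent z mod p^k, well defined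
  because p^k kills A. Conversely, writing z = (z mod p^k) + p^k w, the summand a (x) p^k w vanishes
  once p^k is moved over to a.\<close>

lemma to_tensor_Zp_iso:
  assumes A: "comm_group A" and p: "p > 0" and e: "\<And>a. a \<in> carrier A \<Longrightarrow> a [^]\<^bsub>A\<^esub> (p ^ k) = \<one>\<^bsub>A\<^esub>"
  shows "to_tensor_Zp p A \<in> iso A (tensor_Zp p A)"
proof -
  let ?Z = "add_monoid (padic_integers p)" and ?T = "tensor_Zp p A"
  note Z = comm_group_Zp[OF p] and T = comm_group_tensor_Zp[OF A p]
  interpret T: comm_group ?T by (rule T)
  interpret Z: comm_group ?Z by (rule Z)
  interpret A: comm_group A by (rule A)
  note one = Zp_one_closed[OF p]
  have l: "to_tensor_Zp p A \<in> hom A ?T" by (rule pure_tensor_hom_left[OF A Z one])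
  have nat_ge: "z k \<ge> 0" if "z \<in> carrier ?Z" for z using that unfolding carrier_Zp by auto
  have mod_pow: "a [^]\<^bsub>A\<^esub> (n mod p ^ k) = a [^]\<^bsub>A\<^esub> n" if "a \<in> carrier A" for a and n :: nat
  proof -
    have "a [^]\<^bsub>A\<^esub> n = a [^]\<^bsub>A\<^esub> (p ^ k * (n div p ^ k) + n mod p ^ k)" by simp
    also have "\<dots> = (a [^]\<^bsub>A\<^esub> (p ^ k)) [^]\<^bsub>A\<^esub> (n div p ^ k) \<otimes>\<^bsub>A\<^esub> a [^]\<^bsub>A\<^esub> (n mod p ^ k)"
      using that by (simp only: A.nat_pow_mult[symmetric] A.nat_pow_pow)
    finally show ?thesis using e[OF that] that by simp
  qed
  obtain g where g: "g \<in> hom ?T A" "\<And>a z. a \<in> carrier A \<Longrightarrow> z \<in> carrier ?Z \<Longrightarrow>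
      g (pure_tensor A ?Z a z) = a [^]\<^bsub>A\<^esub> nat (z k)"
  proof (rule tensor_universal[OF A Z A, of "\<lambda>a z. a [^]\<^bsub>A\<^esub> nat (z k)"])
    fix a b b' assume *: "a \<in> carrier A" "b \<in> carrier ?Z" "b' \<in> carrier ?Z"
    have "nat ((b \<otimes>\<^bsub>?Z\<^esub> b') k) = (nat (b k) + nat (b' k)) mod p ^ k"
      unfolding mult_Zp using nat_ge *(2,3) by (simp add: nat_mod_distrib nat_add_distrib nat_power_eq)
    then show "a [^]\<^bsub>A\<^esub> nat ((b \<otimes>\<^bsub>?Z\<^esub> b') k) = a [^]\<^bsub>A\<^esub> nat (b k) \<otimes>\<^bsub>A\<^esub> a [^]\<^bsub>A\<^esub> nat (b' k)"
      using mod_pow * by (simp add: A.nat_pow_mult)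
  qed (auto simp: A.nat_pow_distrib intro: that)
  have gl: "g (to_tensor_Zp p A a) = a" if "a \<in> carrier A" for a
  proof -
    have "nat (\<one>\<^bsub>padic_integers p\<^esub> k) = 1 mod p ^ k"
      using p by (simp add: padic_integers_def nat_mod_distrib nat_power_eq)
    then show ?thesis using mod_pow[OF that, of 1] g(2)[OF that one] that by simp
  qed
  have lg: "to_tensor_Zp p A (g t) = t" if "t \<in> carrier ?T" for t
  proof (rule tensor_hom_eqI[OF A Z T.is_group _ _ _ that])
    show "(\<lambda>t. to_tensor_Zp p A (g t)) \<in> hom ?T ?T" using hom_compose[OF g(1) l] by (simp add: comp_def)
    show "(\<lambda>x. x) \<in> hom ?T ?T" by (rule homI) auto
    fix a z assume az: "a \<in> carrier A" "z \<in> carrier ?Z"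
    interpret r: group_hom ?Z ?T "\<lambda>b. pure_tensor A ?Z a b"
      using pure_tensor_hom_right[OF A Z az(1)] by unfold_locales
    interpret l: group_hom A ?T "to_tensor_Zp p A" using l by unfold_locales
    obtain w where w: "w \<in> carrier ?Z" "\<And>n. z n = (z k + int p ^ k * w n) mod int p ^ n"
      by (rule Zp_shift_exists[OF p az(2), of k]) (rule that)
    interpret lw: group_hom A ?T "\<lambda>a. pure_tensor A ?Z a w"
      using pure_tensor_hom_left[OF A Z w(1)] by unfold_locales
    have "z = \<one>\<^bsub>padic_integers p\<^esub> [^]\<^bsub>?Z\<^esub> nat (z k) \<otimes>\<^bsub>?Z\<^esub> w [^]\<^bsub>?Z\<^esub> (p ^ k)"
    proof
      fix n show "z n = (\<one>\<^bsub>padic_integers p\<^esub> [^]\<^bsub>?Z\<^esub> nat (z k) \<otimes>\<^bsub>?Z\<^esub> w [^]\<^bsub>?Z\<^esub> (p ^ k)) n"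
        unfolding Zp_pow mult_Zp using w(2)[of n] nat_ge[OF az(2)] by (simp add: padic_integers_def mod_simps)
    qed
    then have "pure_tensor A ?Z a z = pure_tensor A ?Z a (\<one>\<^bsub>padic_integers p\<^esub> [^]\<^bsub>?Z\<^esub> nat (z k) \<otimes>\<^bsub>?Z\<^esub> w [^]\<^bsub>?Z\<^esub> (p ^ k))"
      by (rule arg_cong)
    also have "\<dots> = pure_tensor A ?Z a (\<one>\<^bsub>padic_integers p\<^esub> [^]\<^bsub>?Z\<^esub> nat (z k)) \<otimes>\<^bsub>?T\<^esub> pure_tensor A ?Z a (w [^]\<^bsub>?Z\<^esub> (p ^ k))"
      by (intro r.hom_mult Z.nat_pow_closed one w)
    also have "pure_tensor A ?Z a (w [^]\<^bsub>?Z\<^esub> (p ^ k)) = pure_tensor A ?Z a w [^]\<^bsub>?T\<^esub> (p ^ k)"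
      by (rule r.hom_nat_pow[OF w(1)])
    also have "\<dots> = pure_tensor A ?Z (a [^]\<^bsub>A\<^esub> (p ^ k)) w" by (rule lw.hom_nat_pow[OF az(1), symmetric])
    also have "\<dots> = \<one>\<^bsub>?T\<^esub>" unfolding e[OF az(1)] by (rule lw.hom_one)
    also have "pure_tensor A ?Z a (\<one>\<^bsub>padic_integers p\<^esub> [^]\<^bsub>?Z\<^esub> nat (z k)) = to_tensor_Zp p A a [^]\<^bsub>?T\<^esub> nat (z k)"
      by (rule r.hom_nat_pow[OF one])
    also have "\<dots> = to_tensor_Zp p A (a [^]\<^bsub>A\<^esub> nat (z k))" by (rule l.hom_nat_pow[OF az(1), symmetric])
    finally show "to_tensor_Zp p A (g (pure_tensor A ?Z a z)) = pure_tensor A ?Z a z"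
      unfolding g(2)[OF az] using T.r_one[OF l.hom_closed[OF A.nat_pow_closed[OF az(1), of "nat (z k)"]]]
      by (rule trans[symmetric])
  qed
  show ?thesis
    by (rule isoI[OF l], rule bij_betw_byWitness[where f' = g]) (use gl lg l g(1) in \<open>auto simp: hom_def\<close>)
qed

subsection \<open>An abstract form of the theorem\<close>

lemma hom_finprod:
  assumes "comm_group A" "comm_group B" "h \<in> hom A B" "finite I" "g \<in> I \<rightarrow> carrier A"
  shows "h (finprod A g I) = finprod B (\<lambda>i. h (g i)) I"
  using assms(4,5)
proof (induction I rule: finite_induct)
  interpret A: comm_group A by fact
  interpret B: comm_group B by fact
  interpret group_hom A B h using assms(3) by unfold_locales
  case (insert i I)
  have "(\<lambda>i. h (g i)) \<in> I \<rightarrow> carrier B" using insert.prems by (simp add: Pi_iff)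
  then show ?case using insert by (simp add: Pi_iff)
qed (use assms(1-3) in \<open>simp add: comm_group_def comm_monoid.finprod_empty hom_one\<close>)

text \<open>Here \<open>h\<close> is division by m. Applied to \<open>h t\<close>, the formula
  \<open>eq\<close> shows that the sum of the maps \<open>ind S\<close> is onto; applied to a t with
  all restrictions trivial, it shows that the m-th power of t is trivial, hence t itself. So the
  product-sum map is an onto map followed by an injective one, and its image is a copy of A. The
  groups \<open>A\<close> and \<open>B S\<close> have independent types, because the lemma serves
  with tensored as well as with untensored targets.\<close>

lemma is_iso_image_group:
  fixes A :: "('a, 'b) monoid_scheme" and B :: "'i \<Rightarrow> ('c, 'd) monoid_scheme"
  assumes A: "comm_group A" and F: "finite F" and B: "\<And>S. S \<in> F \<Longrightarrow> comm_group (B S)"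
    and ind: "\<And>S. S \<in> F \<Longrightarrow> ind S \<in> hom (B S) A"
    and res: "\<And>S. S \<in> F \<Longrightarrow> res S \<in> hom A (B S)"
    and w: "\<And>S x. S \<in> F \<Longrightarrow> x \<in> carrier (B S) \<Longrightarrow> w S x \<in> carrier (B S)"
    and w1: "\<And>S. S \<in> F \<Longrightarrow> w S \<one>\<^bsub>B S\<^esub> = \<one>\<^bsub>B S\<^esub>"
    and f: "\<And>S T x. S \<in> F \<Longrightarrow> T \<in> F \<Longrightarrow> x \<in> carrier (B S) \<Longrightarrow> f S T x = res T (ind S x)"
    and h: "\<And>t. t \<in> carrier A \<Longrightarrow> h t \<in> carrier A" "\<And>t. t \<in> carrier A \<Longrightarrow> h t [^]\<^bsub>A\<^esub> (m::nat) = t"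
       "\<And>t. t \<in> carrier A \<Longrightarrow> h (t [^]\<^bsub>A\<^esub> m) = t"
    and eq: "\<And>t. t \<in> carrier A \<Longrightarrow> t [^]\<^bsub>A\<^esub> m = finprod A (\<lambda>S. ind S (w S (res S t))) F"
  shows "A \<cong> image_group (prod_sum_map F B f) (product_group F B) (product_group F B)"
    and "trivial_group A \<longleftrightarrow> (\<forall>S\<in>F. \<forall>T\<in>F. \<forall>x\<in>carrier (B S). f S T x = \<one>\<^bsub>B T\<^esub>)"
proof -
  interpret A: comm_group A by fact
  define Res' where "Res' t = (\<lambda>T\<in>F. res T t)" for t
  define I where "I x = finprod A (\<lambda>S. ind S (x S)) F" for x
  have indc: "ind S x \<in> carrier A" if "S \<in> F" "x \<in> carrier (B S)" for S x using ind[OF that(1)] that by (auto simp: hom_def)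
  have resc: "res S x \<in> carrier (B S)" if "S \<in> F" "x \<in> carrier A" for S x using res[OF that(1)] that by (auto simp: hom_def)
  have res1: "res S \<one>\<^bsub>A\<^esub> = \<one>\<^bsub>B S\<^esub>" "ind S \<one>\<^bsub>B S\<^esub> = \<one>\<^bsub>A\<^esub>" if "S \<in> F" for S
    using hom_one[OF res[OF that]] hom_one[OF ind[OF that]] B[OF that] by (simp_all add: comm_group_def)
  have psm: "prod_sum_map F B f x = Res' (I x)" if x: "x \<in> carrier (product_group F B)" for x
    unfolding prod_sum_map_def Res'_def
  proof (rule restrict_ext)
    fix T assume T: "T \<in> F"
    interpret BT: comm_group "B T" by (rule B[OF T])
    interpret r: group_hom A "B T" "res T" using res[OF T] by unfold_locales
    have c: "(\<lambda>S. ind S (x S)) \<in> F \<rightarrow> carrier A" using indc x by (auto simp: PiE_iff)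
    have "res T (I x) = finprod (B T) (\<lambda>S. res T (ind S (x S))) F"
      unfolding I_def by (rule hom_finprod[OF A B[OF T] res[OF T] F c])
    also have "\<dots> = finprod (B T) (\<lambda>S. f S T (x S)) F"
      by (rule BT.finprod_cong') (use f T x resc c in \<open>auto simp: PiE_iff Pi_iff\<close>)
    finally show "finprod (B T) (\<lambda>S. f S T (x S)) F = res T (I x)" ..
  qed
  have Ic: "I x \<in> carrier A" if "x \<in> carrier (product_group F B)" for x
    unfolding I_def using that indc by (intro A.finprod_closed) (auto simp: PiE_iff)
  have onto: "\<exists>x\<in>carrier (product_group F B). I x = t" if t: "t \<in> carrier A" for t
  proof (rule bexI)
    have "I (\<lambda>S\<in>F. w S (res S (h t))) = finprod A (\<lambda>S. ind S (w S (res S (h t)))) F"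
      unfolding I_def by (rule A.finprod_cong') (use indc w resc h(1)[OF t] in auto)
    then show "I (\<lambda>S\<in>F. w S (res S (h t))) = t" using eq[OF h(1)[OF t]] h(2)[OF t] by simp
    show "(\<lambda>S\<in>F. w S (res S (h t))) \<in> carrier (product_group F B)" using w resc h(1)[OF t] by auto
  qed
  have im: "prod_sum_map F B f ` carrier (product_group F B) = Res' ` carrier A"
    using psm Ic onto by (auto simp: image_iff) metis+
  have kernel: "t = \<one>\<^bsub>A\<^esub>" if t: "t \<in> carrier A" and 1: "\<And>T. T \<in> F \<Longrightarrow> res T t = \<one>\<^bsub>B T\<^esub>" for t
  proof -
    have "t [^]\<^bsub>A\<^esub> m = finprod A (\<lambda>S. \<one>\<^bsub>A\<^esub>) F"
      unfolding eq[OF t] by (rule A.finprod_cong') (use 1 w1 res1 in auto)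
    then have "t [^]\<^bsub>A\<^esub> m = \<one>\<^bsub>A\<^esub> [^]\<^bsub>A\<^esub> m" by simp
    then show ?thesis using h(3)[OF t] h(3)[OF A.one_closed] by metis
  qed
  have hom: "Res' \<in> hom A (product_group F B)"
  proof (rule homI)
    fix x y assume "x \<in> carrier A" "y \<in> carrier A"
    then show "Res' (x \<otimes>\<^bsub>A\<^esub> y) = Res' x \<otimes>\<^bsub>product_group F B\<^esub> Res' y"
      using hom_mult[OF res] by (auto simp: Res'_def)
  qed (use resc in \<open>auto simp: Res'_def\<close>)
  interpret P: group "product_group F B" by (rule product_group) (use B in \<open>simp add: comm_group_def\<close>)
  interpret R: group_hom A "product_group F B" Res' using hom by unfold_locales
  have "inj_on Res' (carrier A)"
    unfolding R.inj_on_one_iff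
  proof clarify
    fix t assume t: "t \<in> carrier A" "Res' t = \<one>\<^bsub>product_group F B\<^esub>"
    show "t = \<one>\<^bsub>A\<^esub>"
    proof (rule kernel[OF t(1)])
      show "res T t = \<one>\<^bsub>B T\<^esub>" if "T \<in> F" for T
        using fun_cong[OF t(2), of T] that by (simp add: Res'_def)
    qed
  qed
  then have "Res' \<in> iso A (image_group (prod_sum_map F B f) (product_group F B) (product_group F B))"
    unfolding iso_def image_group_def im using hom by (auto simp: hom_def bij_betw_def)
  then show "A \<cong> image_group (prod_sum_map F B f) (product_group F B) (product_group F B)"
    unfolding is_iso_def by blast
  show "trivial_group A \<longleftrightarrow> (\<forall>S\<in>F. \<forall>T\<in>F. \<forall>x\<in>carrier (B S). f S T x = \<one>\<^bsub>B T\<^esub>)" (is "_ \<longleftrightarrow> ?R")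
  proof
    assume "trivial_group A"
    then have "carrier A = {\<one>\<^bsub>A\<^esub>}" by (simp add: trivial_group_def)
    then show ?R using f indc res1 by auto
  next
    \<comment> \<open>If each restriction of each induced element is trivial, then so is each
      restriction of a value of \<open>I\<close>; as \<open>I\<close> is onto, the kernel argument
      covers all of A.\<close>
    assume r: ?R
    have "t = \<one>\<^bsub>A\<^esub>" if t: "t \<in> carrier A" for t
    proof (rule kernel[OF t])
      fix T assume T: "T \<in> F"
      interpret BT: comm_group "B T" by (rule B[OF T])
      obtain x where x: "x \<in> carrier (product_group F B)" "I x = t" using onto[OF t] by blast
      have "res T t = prod_sum_map F B f x T" using psm[OF x(1)] x(2) T by (simp add: Res'_def)
      also have "\<dots> = finprod (B T) (\<lambda>S. f S T (x S)) F" using T by (simp add: prod_sum_map_def)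
      also have "\<dots> = finprod (B T) (\<lambda>S. \<one>\<^bsub>B T\<^esub>) F"
        by (rule BT.finprod_cong') (use r x T in \<open>auto simp: PiE_iff\<close>)
      finally show "res T t = \<one>\<^bsub>B T\<^esub>" by simp
    qed
    then show "trivial_group A" unfolding trivial_group_def using A.is_group by auto
  qed
qed

lemma (in group) mult_inv_cancel:
  assumes "x \<in> carrier G" "z \<in> carrier G"
  shows "x \<otimes> (inv x \<otimes> z) = z" "inv x \<otimes> (x \<otimes> z) = z"
  using assms by (simp_all add: m_assoc[symmetric])

subsection \<open>Class functions\<close>

lemma mult_class_functions [simp]: "f \<otimes>\<^bsub>class_functions G\<^esub> f' = (\<lambda>g. f g + f' g)"
  by (simp add: class_functions_def)

lemma one_class_functions [simp]: "\<one>\<^bsub>class_functions G\<^esub> = (\<lambda>g. 0)"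
  by (simp add: class_functions_def)

lemma carrier_class_functions: "f \<in> carrier (class_functions G) \<longleftrightarrow>
   (\<forall>g. g \<notin> carrier G \<longrightarrow> f g = 0) \<and>
   (\<forall>g\<in>carrier G. \<forall>x\<in>carrier G. f (x \<otimes>\<^bsub>G\<^esub> g \<otimes>\<^bsub>G\<^esub> inv\<^bsub>G\<^esub> x) = f g)"
  by (simp add: class_functions_def)

lemma comm_group_class_functions: "comm_group (class_functions G)"
proof (rule comm_groupI)
  fix f assume f: "f \<in> carrier (class_functions G)"
  have "(\<lambda>g. - f g) \<in> carrier (class_functions G)" using f unfolding carrier_class_functions by simp
  then show "\<exists>y\<in>carrier (class_functions G). y \<otimes>\<^bsub>class_functions G\<^esub> f = \<one>\<^bsub>class_functions G\<^esub>"
    by (intro bexI[of _ "\<lambda>g. - f g"]) simp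
qed (auto simp: carrier_class_functions add_ac)

lemmas group_class_functions = comm_group.axioms(2)[OF comm_group_class_functions]

lemma inv_class_functions:
  assumes "f \<in> carrier (class_functions G)"
  shows "inv\<^bsub>class_functions G\<^esub> f = (\<lambda>g. - f g)"
  by (rule group.inv_equality[OF group_class_functions])
     (use assms in \<open>auto simp: carrier_class_functions\<close>)

lemma nat_pow_class_functions: "f [^]\<^bsub>class_functions G\<^esub> (n::nat) = (\<lambda>g. of_nat n * f g)"
  by (induction n) (auto simp: nat_pow_def class_functions_def algebra_simps)

lemma subgroup_class_functions_zero:
  "subgroup K (class_functions G) \<Longrightarrow> (\<lambda>g. 0) \<in> K"
  using subgroup.one_closed by fastforce

lemma subgroup_class_functions_add:
  "subgroup K (class_functions G) \<Longrightarrow> f \<in> K \<Longrightarrow> f' \<in> K \<Longrightarrow> (\<lambda>g. f g + f' g) \<in> K"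
  using subgroup.m_closed by fastforce

lemma subgroup_class_functions_minus:
  assumes "subgroup K (class_functions G)" "f \<in> K" shows "(\<lambda>g. - f g) \<in> K"
  using subgroup.m_inv_closed[OF assms] inv_class_functions[of f G] subgroup.mem_carrier[OF assms] by simp

lemma subgroup_class_functions_scale:
  assumes K: "subgroup K (class_functions G)" and f: "f \<in> K"
  shows "(\<lambda>g. of_int n * f g) \<in> K"
proof -
  have nat: "(\<lambda>g. of_nat n * f g) \<in> K" for n :: nat
  proof (induction n)
    case (Suc n)
    from subgroup_class_functions_add[OF K Suc f] show ?case by (simp add: algebra_simps)
  qed (use subgroup_class_functions_zero[OF K] in simp)
  show ?thesis
  proof (cases "n \<ge> 0")
    case True
    then show ?thesis using nat[of "nat n"] by simp
  next
    case False
    then show ?thesis using subgroup_class_functions_minus[OF K nat[of "nat (- n)"]] by simp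
  qed
qed

lemma subgroup_class_functions_sum:
  assumes K: "subgroup K (class_functions G)" and f: "\<And>i. i \<in> I \<Longrightarrow> f i \<in> K"
  shows "(\<lambda>g. \<Sum>i\<in>I. f i g) \<in> K"
  using f
proof (induction I rule: infinite_finite_induct)
  case (insert i I)
  from subgroup_class_functions_add[OF K insert.prems[of i] insert.IH] insert show ?case by simp
qed (use subgroup_class_functions_zero[OF K] in auto)

lemma class_function_conj:
  assumes "group G" "\<chi> \<in> carrier (class_functions G)" "g \<in> carrier G" "x \<in> carrier G"
  shows "\<chi> (inv\<^bsub>G\<^esub> x \<otimes>\<^bsub>G\<^esub> g \<otimes>\<^bsub>G\<^esub> x) = \<chi> g"
proof -
  interpret group G by fact
  have "\<chi> (inv\<^bsub>G\<^esub> x \<otimes>\<^bsub>G\<^esub> g \<otimes>\<^bsub>G\<^esub> inv\<^bsub>G\<^esub> (inv\<^bsub>G\<^esub> x)) = \<chi> g"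
    using assms unfolding carrier_class_functions by blast
  then show ?thesis using assms by simp
qed

lemma class_function_outside: "\<chi> \<in> carrier (class_functions G) \<Longrightarrow> g \<notin> carrier G \<Longrightarrow> \<chi> g = 0"
  by (simp add: carrier_class_functions)

lemma subgroup_conj_mem_iff:
  assumes "group G" "subgroup T G" "g \<in> carrier G" "t \<in> T"
  shows "inv\<^bsub>G\<^esub> t \<otimes>\<^bsub>G\<^esub> g \<otimes>\<^bsub>G\<^esub> t \<in> T \<longleftrightarrow> g \<in> T"
proof -
  interpret group G by fact
  interpret T: subgroup T G by fact
  have "g = t \<otimes>\<^bsub>G\<^esub> (inv\<^bsub>G\<^esub> t \<otimes>\<^bsub>G\<^esub> g \<otimes>\<^bsub>G\<^esub> t) \<otimes>\<^bsub>G\<^esub> inv\<^bsub>G\<^esub> t"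
    using assms T.mem_carrier by (simp add: m_assoc mult_inv_cancel)
  then show ?thesis using assms(4) T.m_closed T.m_inv_closed by metis
qed

subsection \<open>Restriction and induction\<close>

lemma Res_hom:
  assumes "group G" "subgroup T G"
  shows "Res T \<in> hom (class_functions G) (class_functions (G\<lparr>carrier := T\<rparr>))"
proof (rule homI)
  interpret group G by fact
  interpret T: subgroup T G by fact
  fix f assume f: "f \<in> carrier (class_functions G)"
  show "Res T f \<in> carrier (class_functions (G\<lparr>carrier := T\<rparr>))"
    unfolding carrier_class_functions
  proof (intro conjI allI impI ballI)
    fix g x assume "g \<in> carrier (G\<lparr>carrier := T\<rparr>)" "x \<in> carrier (G\<lparr>carrier := T\<rparr>)"
    then have gx: "g \<in> T" "x \<in> T" by auto
    have "x \<otimes>\<^bsub>G\<^esub> g \<otimes>\<^bsub>G\<^esub> inv\<^bsub>G\<^esub> x \<in> T" using gx by auto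
    moreover have "f (x \<otimes>\<^bsub>G\<^esub> g \<otimes>\<^bsub>G\<^esub> inv\<^bsub>G\<^esub> x) = f g"
      using f gx T.mem_carrier unfolding carrier_class_functions by blast
    ultimately show "Res T f (x \<otimes>\<^bsub>G\<lparr>carrier := T\<rparr>\<^esub> g \<otimes>\<^bsub>G\<lparr>carrier := T\<rparr>\<^esub> inv\<^bsub>G\<lparr>carrier := T\<rparr>\<^esub> x) = Res T f g"
      using gx m_inv_consistent[OF assms(2)] by (simp add: Res_def)
  qed (simp add: Res_def)
qed (auto simp: Res_def fun_eq_iff)

lemma bij_betw_mult_left:
  assumes "group G" "y \<in> carrier G" shows "bij_betw (\<lambda>x. y \<otimes>\<^bsub>G\<^esub> x) (carrier G) (carrier G)"
proof -
  interpret group G by fact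
  show ?thesis
    by (rule bij_betw_byWitness[where f' = "\<lambda>x. inv\<^bsub>G\<^esub> y \<otimes>\<^bsub>G\<^esub> x"])
       (use assms in \<open>auto simp: m_assoc[symmetric]\<close>)
qed

lemma bij_betw_mult_right:
  assumes "group G" "y \<in> carrier G" shows "bij_betw (\<lambda>x. x \<otimes>\<^bsub>G\<^esub> y) (carrier G) (carrier G)"
proof -
  interpret group G by fact
  show ?thesis
    by (rule bij_betw_byWitness[where f' = "\<lambda>x. x \<otimes>\<^bsub>G\<^esub> inv\<^bsub>G\<^esub> y"])
       (use assms in \<open>auto simp: m_assoc\<close>)
qed

lemma Ind_class_function:
  assumes "group G"
  shows "Ind G S \<chi> \<in> carrier (class_functions G)"
  unfolding carrier_class_functions
proof (intro conjI allI impI ballI)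
  interpret group G by fact
  fix g y assume gy: "g \<in> carrier G" "y \<in> carrier G"
  have "(\<Sum>x\<in>carrier G. \<chi> (inv\<^bsub>G\<^esub> x \<otimes>\<^bsub>G\<^esub> (y \<otimes>\<^bsub>G\<^esub> g \<otimes>\<^bsub>G\<^esub> inv\<^bsub>G\<^esub> y) \<otimes>\<^bsub>G\<^esub> x)) =
        (\<Sum>x\<in>carrier G. \<chi> (inv\<^bsub>G\<^esub> (y \<otimes>\<^bsub>G\<^esub> x) \<otimes>\<^bsub>G\<^esub> (y \<otimes>\<^bsub>G\<^esub> g \<otimes>\<^bsub>G\<^esub> inv\<^bsub>G\<^esub> y) \<otimes>\<^bsub>G\<^esub> (y \<otimes>\<^bsub>G\<^esub> x)))"
    by (rule sum.reindex_bij_betw[symmetric]) (rule bij_betw_mult_left[OF assms gy(2)])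
  also have "\<dots> = (\<Sum>x\<in>carrier G. \<chi> (inv\<^bsub>G\<^esub> x \<otimes>\<^bsub>G\<^esub> g \<otimes>\<^bsub>G\<^esub> x))"
  proof (intro sum.cong refl arg_cong[of _ _ \<chi>])
    fix x assume x: "x \<in> carrier G"
    have "inv\<^bsub>G\<^esub> y \<otimes>\<^bsub>G\<^esub> (y \<otimes>\<^bsub>G\<^esub> z) = z" if "z \<in> carrier G" for z using gy that by (simp add: m_assoc[symmetric])
    then show "inv\<^bsub>G\<^esub> (y \<otimes>\<^bsub>G\<^esub> x) \<otimes>\<^bsub>G\<^esub> (y \<otimes>\<^bsub>G\<^esub> g \<otimes>\<^bsub>G\<^esub> inv\<^bsub>G\<^esub> y) \<otimes>\<^bsub>G\<^esub> (y \<otimes>\<^bsub>G\<^esub> x) = inv\<^bsub>G\<^esub> x \<otimes>\<^bsub>G\<^esub> g \<otimes>\<^bsub>G\<^esub> x"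
      using x gy by (simp add: inv_mult_group m_assoc)
  qed
  finally show "Ind G S \<chi> (y \<otimes>\<^bsub>G\<^esub> g \<otimes>\<^bsub>G\<^esub> inv\<^bsub>G\<^esub> y) = Ind G S \<chi> g"
    using gy by (simp add: Ind_def)
qed (simp add: Ind_def)

lemma Ind_add: "Ind G S (\<lambda>g. \<chi> g + \<chi>' g) = (\<lambda>g. Ind G S \<chi> g + Ind G S \<chi>' g)"
  by (auto simp: Ind_def fun_eq_iff sum.distrib add_divide_distrib)

lemma Ind_zero: "Ind G S (\<lambda>g. 0) = (\<lambda>g. 0)"
  by (simp add: Ind_def fun_eq_iff)

lemma Ind_scale: "Ind G S (\<lambda>g. c * \<chi> g) = (\<lambda>g. c * Ind G S \<chi> g)"
  by (auto simp: Ind_def fun_eq_iff sum_distrib_left)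

lemma Ind_hom:
  assumes "group G" "monoid.mult A = (\<lambda>f f' g. f g + f' g)"
  shows "Ind G S \<in> hom A (class_functions G)"
  by (rule homI) (use assms in \<open>auto simp: Ind_class_function Ind_add\<close>)

text \<open>Substituting x t for x shows that every t in T contributes the same sum over G, so the
  |T| equal terms cancel the division by |T|.\<close>

lemma Ind_trans:
  assumes "group G" "finite (carrier G)" and T: "subgroup T G" and S: "S \<subseteq> T"
    and \<chi>: "\<And>g. g \<notin> S \<Longrightarrow> \<chi> g = 0"
  shows "Ind G T (Ind (G\<lparr>carrier := T\<rparr>) S \<chi>) = Ind G S \<chi>"
proof
  interpret group G by fact
  interpret T: subgroup T G by fact
  fix g
  show "Ind G T (Ind (G\<lparr>carrier := T\<rparr>) S \<chi>) g = Ind G S \<chi> g"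
  proof (cases "g \<in> carrier G")
    case g: True
    have cT: "card T \<noteq> 0" using T.finite_imp_card_positive[OF assms(2)] by simp
    \<comment> \<open>The summation formula holds also for z outside T: conjugation by t in T keeps
      z outside T, hence outside S, where \<chi> vanishes.\<close>
    have 1: "Ind (G\<lparr>carrier := T\<rparr>) S \<chi> z = (\<Sum>t\<in>T. \<chi> (inv\<^bsub>G\<^esub> t \<otimes>\<^bsub>G\<^esub> z \<otimes>\<^bsub>G\<^esub> t)) / of_nat (card S)"
      if "z \<in> carrier G" for z
    proof (cases "z \<in> T")
      case True then show ?thesis
        by (auto simp: Ind_def m_inv_consistent[OF T] intro!: sum.cong arg_cong2[where f = "(/)"])
    next
      case False
      then have "\<chi> (inv\<^bsub>G\<^esub> t \<otimes>\<^bsub>G\<^esub> z \<otimes>\<^bsub>G\<^esub> t) = 0" if "t \<in> T" for t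
        using subgroup_conj_mem_iff[OF assms(1) T \<open>z \<in> carrier G\<close> that] S \<chi> by blast
      then show ?thesis using False by (simp add: Ind_def)
    qed
    have "(\<Sum>x\<in>carrier G. Ind (G\<lparr>carrier := T\<rparr>) S \<chi> (inv\<^bsub>G\<^esub> x \<otimes>\<^bsub>G\<^esub> g \<otimes>\<^bsub>G\<^esub> x)) =
       (\<Sum>x\<in>carrier G. (\<Sum>t\<in>T. \<chi> (inv\<^bsub>G\<^esub> t \<otimes>\<^bsub>G\<^esub> (inv\<^bsub>G\<^esub> x \<otimes>\<^bsub>G\<^esub> g \<otimes>\<^bsub>G\<^esub> x) \<otimes>\<^bsub>G\<^esub> t)) / of_nat (card S))"
      using g by (intro sum.cong refl 1) auto
    also have "\<dots> = (\<Sum>t\<in>T. \<Sum>x\<in>carrier G. \<chi> (inv\<^bsub>G\<^esub> t \<otimes>\<^bsub>G\<^esub> (inv\<^bsub>G\<^esub> x \<otimes>\<^bsub>G\<^esub> g \<otimes>\<^bsub>G\<^esub> x) \<otimes>\<^bsub>G\<^esub> t)) / of_nat (card S)"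
      by (simp add: sum_divide_distrib[symmetric] sum.swap[of _ T])
    also have "(\<Sum>t\<in>T. \<Sum>x\<in>carrier G. \<chi> (inv\<^bsub>G\<^esub> t \<otimes>\<^bsub>G\<^esub> (inv\<^bsub>G\<^esub> x \<otimes>\<^bsub>G\<^esub> g \<otimes>\<^bsub>G\<^esub> x) \<otimes>\<^bsub>G\<^esub> t)) =
       (\<Sum>t\<in>T. \<Sum>x\<in>carrier G. \<chi> (inv\<^bsub>G\<^esub> x \<otimes>\<^bsub>G\<^esub> g \<otimes>\<^bsub>G\<^esub> x))"
    proof (rule sum.cong[OF refl])
      fix t assume t: "t \<in> T"
      have "(\<Sum>x\<in>carrier G. \<chi> (inv\<^bsub>G\<^esub> t \<otimes>\<^bsub>G\<^esub> (inv\<^bsub>G\<^esub> x \<otimes>\<^bsub>G\<^esub> g \<otimes>\<^bsub>G\<^esub> x) \<otimes>\<^bsub>G\<^esub> t)) =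
         (\<Sum>x\<in>carrier G. \<chi> (inv\<^bsub>G\<^esub> (x \<otimes>\<^bsub>G\<^esub> t) \<otimes>\<^bsub>G\<^esub> g \<otimes>\<^bsub>G\<^esub> (x \<otimes>\<^bsub>G\<^esub> t)))"
        using g t by (intro sum.cong refl arg_cong[of _ _ \<chi>]) (simp add: inv_mult_group m_assoc)
      also have "\<dots> = (\<Sum>x\<in>carrier G. \<chi> (inv\<^bsub>G\<^esub> x \<otimes>\<^bsub>G\<^esub> g \<otimes>\<^bsub>G\<^esub> x))"
        using t by (intro sum.reindex_bij_betw bij_betw_mult_right[OF assms(1)]) auto
      finally show "(\<Sum>x\<in>carrier G. \<chi> (inv\<^bsub>G\<^esub> t \<otimes>\<^bsub>G\<^esub> (inv\<^bsub>G\<^esub> x \<otimes>\<^bsub>G\<^esub> g \<otimes>\<^bsub>G\<^esub> x) \<otimes>\<^bsub>G\<^esub> t)) =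
         (\<Sum>x\<in>carrier G. \<chi> (inv\<^bsub>G\<^esub> x \<otimes>\<^bsub>G\<^esub> g \<otimes>\<^bsub>G\<^esub> x))" .
    qed
    finally show ?thesis using g cT unfolding Ind_def[of G] by simp
  qed (simp add: Ind_def)
qed

text \<open>The class function \<chi> is constant on the conjugates of g over which
  \<open>Ind\<close> sums, and \<psi> vanishes wherever restriction changes \<chi>; so the value at
  g factors out.\<close>

lemma Ind_projection:
  assumes "group G" and \<chi>: "\<chi> \<in> carrier (class_functions G)" and \<psi>: "\<And>g. g \<notin> S \<Longrightarrow> \<psi> g = 0"
  shows "Ind G S (\<lambda>g. \<psi> g * Res S \<chi> g) = (\<lambda>g. Ind G S \<psi> g * \<chi> g)"
proof
  interpret group G by fact
  fix g
  have "\<psi> (inv\<^bsub>G\<^esub> x \<otimes>\<^bsub>G\<^esub> g \<otimes>\<^bsub>G\<^esub> x) * Res S \<chi> (inv\<^bsub>G\<^esub> x \<otimes>\<^bsub>G\<^esub> g \<otimes>\<^bsub>G\<^esub> x) = \<psi> (inv\<^bsub>G\<^esub> x \<otimes>\<^bsub>G\<^esub> g \<otimes>\<^bsub>G\<^esub> x) * \<chi> g"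
    if "x \<in> carrier G" "g \<in> carrier G" for x
    using class_function_conj[OF assms(1) \<chi> that(2,1)] \<psi> by (simp add: Res_def)
  then show "Ind G S (\<lambda>g. \<psi> g * Res S \<chi> g) g = Ind G S \<psi> g * \<chi> g"
    unfolding Ind_def by (auto simp: sum_distrib_right intro!: arg_cong2[where f = "(/)"] sum.cong)
qed

text \<open>Needed because the family \<open>F\<close> covers a quasi-elementary subgroup only up to
  conjugacy. Right translation by y identifies the two sums.\<close>

lemma Ind_one_conj:
  assumes "group G" "subgroup H G" "y \<in> carrier G" "H' = (\<lambda>h. y \<otimes>\<^bsub>G\<^esub> h \<otimes>\<^bsub>G\<^esub> inv\<^bsub>G\<^esub> y) ` H"
  shows "Ind G H' (Res H' (\<lambda>_. 1)) = Ind G H (Res H (\<lambda>_. 1))"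
proof
  interpret group G by fact
  interpret H: subgroup H G by fact
  fix g
  have inj: "inj_on (\<lambda>h. y \<otimes>\<^bsub>G\<^esub> h \<otimes>\<^bsub>G\<^esub> inv\<^bsub>G\<^esub> y) H"
    using assms(3) by (intro inj_onI) (auto dest: H.mem_carrier)
  have mem: "z \<in> H' \<longleftrightarrow> inv\<^bsub>G\<^esub> y \<otimes>\<^bsub>G\<^esub> z \<otimes>\<^bsub>G\<^esub> y \<in> H" if "z \<in> carrier G" for z
  proof
    assume "z \<in> H'"
    then obtain h where h: "h \<in> H" "z = y \<otimes>\<^bsub>G\<^esub> h \<otimes>\<^bsub>G\<^esub> inv\<^bsub>G\<^esub> y" using assms(4) by blast
    then have "inv\<^bsub>G\<^esub> y \<otimes>\<^bsub>G\<^esub> z \<otimes>\<^bsub>G\<^esub> y = h"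
      using assms(3) H.mem_carrier by (simp add: m_assoc mult_inv_cancel)
    then show "inv\<^bsub>G\<^esub> y \<otimes>\<^bsub>G\<^esub> z \<otimes>\<^bsub>G\<^esub> y \<in> H" using h by simp
  next
    assume *: "inv\<^bsub>G\<^esub> y \<otimes>\<^bsub>G\<^esub> z \<otimes>\<^bsub>G\<^esub> y \<in> H"
    have "z = y \<otimes>\<^bsub>G\<^esub> (inv\<^bsub>G\<^esub> y \<otimes>\<^bsub>G\<^esub> z \<otimes>\<^bsub>G\<^esub> y) \<otimes>\<^bsub>G\<^esub> inv\<^bsub>G\<^esub> y"
      using assms(3) that by (simp add: m_assoc mult_inv_cancel)
    then show "z \<in> H'" using * assms(4) by blast
  qed
  show "Ind G H' (Res H' (\<lambda>_. 1)) g = Ind G H (Res H (\<lambda>_. 1)) g"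
  proof (cases "g \<in> carrier G")
    case g: True
    have "(\<Sum>x\<in>carrier G. Res H' (\<lambda>_. 1) (inv\<^bsub>G\<^esub> x \<otimes>\<^bsub>G\<^esub> g \<otimes>\<^bsub>G\<^esub> x)) =
       (\<Sum>x\<in>carrier G. Res H (\<lambda>_. 1) (inv\<^bsub>G\<^esub> (x \<otimes>\<^bsub>G\<^esub> y) \<otimes>\<^bsub>G\<^esub> g \<otimes>\<^bsub>G\<^esub> (x \<otimes>\<^bsub>G\<^esub> y)))"
      using g assms(3) mem by (intro sum.cong refl) (simp add: Res_def inv_mult_group m_assoc)
    also have "\<dots> = (\<Sum>x\<in>carrier G. Res H (\<lambda>_. 1) (inv\<^bsub>G\<^esub> x \<otimes>\<^bsub>G\<^esub> g \<otimes>\<^bsub>G\<^esub> x))"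
      by (intro sum.reindex_bij_betw bij_betw_mult_right[OF assms(1,3)])
    finally show ?thesis using g card_image[OF inj] assms(4) by (simp add: Ind_def)
  qed (simp add: Ind_def)
qed

subsection \<open>Permutation characters\<close>

text \<open>The sum defining the induced character counts the k with k^-1 g k in the stabilizer H,
  that is, with k x fixed by g. Sorted by the point k x they form left cosets of H, so |H| cancels.
  The lemma serves for G/H itself and for orbits in arbitrary finite G-sets.\<close>

lemma orbit_fixed_points:
  fixes G :: "('a, 'b) monoid_scheme" (structure) and X :: "'x set"
  assumes "group G" and fin: "finite (carrier G)"
    and one: "\<And>x. x \<in> X \<Longrightarrow> \<phi> \<one> x = x"
    and mult: "\<And>g h x. g \<in> carrier G \<Longrightarrow> h \<in> carrier G \<Longrightarrow> x \<in> X \<Longrightarrow> \<phi> (g \<otimes> h) x = \<phi> g (\<phi> h x)"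
    and x: "x \<in> X"
  defines "H \<equiv> {h \<in> carrier G. \<phi> h x = x}"
  shows "subgroup H G"
    and "g \<in> carrier G \<Longrightarrow> of_nat (card {y \<in> (\<lambda>h. \<phi> h x) ` carrier G. \<phi> g y = y}) = Ind G H (Res H (\<lambda>_. 1)) g"
proof -
  interpret group G by fact
  have inv: "\<phi> (inv h) (\<phi> h x) = x" if "h \<in> carrier G" for h
    using mult[of "inv h" h x] that x one by simp
  show H: "subgroup H G"
    unfolding H_def
  proof (rule subgroupI)
    show "{h \<in> carrier G. \<phi> h x = x} \<noteq> {}" using one x by auto
    show "inv a \<in> {h \<in> carrier G. \<phi> h x = x}" if "a \<in> {h \<in> carrier G. \<phi> h x = x}" for a
      using that inv[of a] by auto
  qed (use mult x in auto)
  interpret H: subgroup H G by (rule H)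
  assume g: "g \<in> carrier G"
  let ?O = "(\<lambda>h. \<phi> h x) ` carrier G"
  have fiber: "card {k \<in> carrier G. \<phi> k x = \<phi> h x} = card H" if h: "h \<in> carrier G" for h
  proof -
    have "bij_betw (\<lambda>s. h \<otimes> s) H {k \<in> carrier G. \<phi> k x = \<phi> h x}"
    proof (rule bij_betw_byWitness[where f' = "\<lambda>k. inv h \<otimes> k"])
      show "\<forall>a\<in>H. inv h \<otimes> (h \<otimes> a) = a" using h H.mem_carrier by (simp add: mult_inv_cancel)
      show "\<forall>a'\<in>{k \<in> carrier G. \<phi> k x = \<phi> h x}. h \<otimes> (inv h \<otimes> a') = a'" using h by (simp add: mult_inv_cancel)
      show "(\<lambda>k. inv h \<otimes> k) ` {k \<in> carrier G. \<phi> k x = \<phi> h x} \<subseteq> H"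
      proof clarify
        fix k assume k: "k \<in> carrier G" "\<phi> k x = \<phi> h x"
        have "\<phi> (inv h \<otimes> k) x = \<phi> (inv h) (\<phi> k x)" using h k(1) x by (intro mult) auto
        then have "\<phi> (inv h \<otimes> k) x = x" unfolding k(2) inv[OF h] .
        then show "inv h \<otimes> k \<in> H" unfolding H_def using h k(1) by simp
      qed
      show "(\<otimes>) h ` H \<subseteq> {k \<in> carrier G. \<phi> k x = \<phi> h x}"
      proof clarify
        fix k assume k: "k \<in> H"
        then have "\<phi> (h \<otimes> k) x = \<phi> h (\<phi> k x)" using h x by (intro mult) auto
        then show "h \<otimes> k \<in> carrier G \<and> \<phi> (h \<otimes> k) x = \<phi> h x" using k h unfolding H_def by simp
      qed
    qed
    then show ?thesis by (rule bij_betw_same_card[symmetric])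
  qed
  have conj: "inv k \<otimes> g \<otimes> k \<in> H \<longleftrightarrow> \<phi> g (\<phi> k x) = \<phi> k x" if k: "k \<in> carrier G" for k
  proof -
    have "\<phi> k (\<phi> (inv k \<otimes> g \<otimes> k) x) = \<phi> (k \<otimes> (inv k \<otimes> g \<otimes> k)) x"
      using k g x by (intro mult[symmetric]) auto
    also have "k \<otimes> (inv k \<otimes> g \<otimes> k) = g \<otimes> k" using k g by (simp add: m_assoc[symmetric])
    finally have 1: "\<phi> k (\<phi> (inv k \<otimes> g \<otimes> k) x) = \<phi> g (\<phi> k x)" using mult g k x by simp
    have "\<phi> (inv k \<otimes> g \<otimes> k) x = \<phi> (inv k) (\<phi> (g \<otimes> k) x)"
      using mult[of "inv k" "g \<otimes> k" x] k g x by (simp add: m_assoc)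
    then have 2: "\<phi> (inv k \<otimes> g \<otimes> k) x = \<phi> (inv k) (\<phi> g (\<phi> k x))" using mult g k x by simp
    show ?thesis using 1 2 inv[OF k] k g unfolding H_def by auto
  qed
  have "card {k \<in> carrier G. inv k \<otimes> g \<otimes> k \<in> H} =
        card (\<Union>y\<in>{y \<in> ?O. \<phi> g y = y}. {k \<in> carrier G. \<phi> k x = y})"
    using conj by (intro arg_cong[of _ _ card]) auto
  also have "\<dots> = (\<Sum>y\<in>{y \<in> ?O. \<phi> g y = y}. card {k \<in> carrier G. \<phi> k x = y})"
    by (rule card_UN_disjoint) (use fin in auto)
  also have "\<dots> = (\<Sum>y\<in>{y \<in> ?O. \<phi> g y = y}. card H)"
    using fiber by (intro sum.cong refl) auto
  finally have c: "card {k \<in> carrier G. inv k \<otimes> g \<otimes> k \<in> H} = card {y \<in> ?O. \<phi> g y = y} * card H" by simp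
  have cH: "card H \<noteq> 0" using H.finite_imp_card_positive[OF fin] by simp
  have "(\<Sum>k\<in>carrier G. Res H (\<lambda>_. 1) (inv k \<otimes> g \<otimes> k)) = (\<Sum>k\<in>{k \<in> carrier G. inv k \<otimes> g \<otimes> k \<in> H}. 1 :: complex)"
    unfolding Res_def using fin by (simp add: sum.inter_filter[symmetric])
  then show "of_nat (card {y \<in> ?O. \<phi> g y = y}) = Ind G H (Res H (\<lambda>_. 1)) g"
    using c cH g by (simp add: Ind_def field_simps)
qed

lemma lcosets_action:
  assumes "group G" "subgroup H G"
  shows "\<And>X. X \<in> lcosets\<^bsub>G\<^esub> H \<Longrightarrow> \<one>\<^bsub>G\<^esub> <#\<^bsub>G\<^esub> X = X"
    and "\<And>g h X. g \<in> carrier G \<Longrightarrow> h \<in> carrier G \<Longrightarrow> X \<in> lcosets\<^bsub>G\<^esub> H \<Longrightarrow> (g \<otimes>\<^bsub>G\<^esub> h) <#\<^bsub>G\<^esub> X = g <#\<^bsub>G\<^esub> (h <#\<^bsub>G\<^esub> X)"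
    and "\<And>g X. g \<in> carrier G \<Longrightarrow> X \<in> lcosets\<^bsub>G\<^esub> H \<Longrightarrow> g <#\<^bsub>G\<^esub> X \<in> lcosets\<^bsub>G\<^esub> H"
    and "(\<lambda>h. h <#\<^bsub>G\<^esub> H) ` carrier G = lcosets\<^bsub>G\<^esub> H"
    and "H \<in> lcosets\<^bsub>G\<^esub> H"
    and "{h \<in> carrier G. h <#\<^bsub>G\<^esub> H = H} = H"
proof -
  interpret group G by fact
  interpret H: subgroup H G by fact
  have sub: "X \<subseteq> carrier G" if "X \<in> lcosets\<^bsub>G\<^esub> H" for X using H.lcosets_carrier assms(1) that by blast
  show "\<one>\<^bsub>G\<^esub> <#\<^bsub>G\<^esub> X = X" if "X \<in> lcosets\<^bsub>G\<^esub> H" for X using lcos_mult_one[OF sub[OF that]] .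
  show m: "(g \<otimes>\<^bsub>G\<^esub> h) <#\<^bsub>G\<^esub> X = g <#\<^bsub>G\<^esub> (h <#\<^bsub>G\<^esub> X)"
    if "g \<in> carrier G" "h \<in> carrier G" "X \<in> lcosets\<^bsub>G\<^esub> H" for g h X
    using lcos_m_assoc[OF sub[OF that(3)] that(1,2)] by simp
  show im: "(\<lambda>h. h <#\<^bsub>G\<^esub> H) ` carrier G = lcosets\<^bsub>G\<^esub> H" by (auto simp: LCOSETS_def)
  show "g <#\<^bsub>G\<^esub> X \<in> lcosets\<^bsub>G\<^esub> H" if gX: "g \<in> carrier G" "X \<in> lcosets\<^bsub>G\<^esub> H" for g X
  proof -
    obtain a where "a \<in> carrier G" "X = a <#\<^bsub>G\<^esub> H" using gX(2) by (auto simp: LCOSETS_def)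
    then have "g <#\<^bsub>G\<^esub> X = (g \<otimes>\<^bsub>G\<^esub> a) <#\<^bsub>G\<^esub> H" using lcos_m_assoc[OF H.subset gX(1)] by simp
    then show ?thesis using gX(1) \<open>a \<in> carrier G\<close> im by blast
  qed
  have o: "\<one>\<^bsub>G\<^esub> <#\<^bsub>G\<^esub> H = H" using lcos_mult_one[OF H.subset] .
  then show "H \<in> lcosets\<^bsub>G\<^esub> H" using im one_closed by (metis imageI)
  show "{h \<in> carrier G. h <#\<^bsub>G\<^esub> H = H} = H"
  proof (intro equalityI subsetI)
    fix h assume "h \<in> {h \<in> carrier G. h <#\<^bsub>G\<^esub> H = H}"
    then show "h \<in> H" using lcos_self[OF _ assms(2), of h] by auto
  next
    fix h assume h: "h \<in> H"
    have "h <#\<^bsub>G\<^esub> H = H"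
    proof (intro equalityI subsetI)
      fix k assume k: "k \<in> H"
      have "k = h \<otimes>\<^bsub>G\<^esub> (inv\<^bsub>G\<^esub> h \<otimes>\<^bsub>G\<^esub> k)" using h k by (simp add: m_assoc[symmetric])
      then show "k \<in> h <#\<^bsub>G\<^esub> H" unfolding l_coset_def using h k by blast
    qed (use h in \<open>auto simp: l_coset_def\<close>)
    then show "h \<in> {h \<in> carrier G. h <#\<^bsub>G\<^esub> H = H}" using h by auto
  qed
qed

lemma finite_lcosets:
  assumes "group G" "finite (carrier G)" "subgroup H G" shows "finite (lcosets\<^bsub>G\<^esub> H)"
  using group.lcosets_subset_PowG[OF assms(1,3)] assms(2) finite_subset by blast

lemma perm_character_eq_card:
  assumes "group G" "finite (carrier G)" "subgroup H G" "g \<in> carrier G"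
  shows "perm_character G H g = of_nat (card {X \<in> lcosets\<^bsub>G\<^esub> H. g <#\<^bsub>G\<^esub> X = X})"
proof -
  have "(\<Sum>X\<in>lcosets\<^bsub>G\<^esub> H. of_bool (X = g <#\<^bsub>G\<^esub> X)) = (\<Sum>X\<in>{X \<in> lcosets\<^bsub>G\<^esub> H. g <#\<^bsub>G\<^esub> X = X}. 1 :: complex)"
    unfolding sum.inter_filter[OF finite_lcosets[OF assms(1-3)]] by (intro sum.cong refl) auto
  then show ?thesis using assms(4) by (simp add: perm_character_def)
qed

lemma perm_character_eq_Ind:
  assumes "group G" "finite (carrier G)" "subgroup H G"
  shows "perm_character G H = Ind G H (Res H (\<lambda>_. 1))"
proof
  fix g
  show "perm_character G H g = Ind G H (Res H (\<lambda>_. 1)) g"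
  proof (cases "g \<in> carrier G")
    case True
    note a = lcosets_action[OF assms(1,3)]
    show ?thesis
      unfolding perm_character_eq_card[OF assms True]
      using orbit_fixed_points(2)[OF assms(1,2), of "lcosets\<^bsub>G\<^esub> H" "\<lambda>g X. g <#\<^bsub>G\<^esub> X" H g, OF a(1,2,5) True]
      unfolding a(4,6) by simp
  qed (simp add: perm_character_def Ind_def)
qed

lemma Perm_subgroup:
  assumes "group G" "finite (carrier G)" shows "subgroup (Perm G) (class_functions G)"
  unfolding Perm_def
proof (rule group.generate_is_subgroup[OF group_class_functions], clarify)
  fix H assume "subgroup H G"
  then show "perm_character G H \<in> carrier (class_functions G)"
    using perm_character_eq_Ind[OF assms] Ind_class_function[OF assms(1)] by metis
qed

lemma perm_character_in_Perm:
  "subgroup H G \<Longrightarrow> perm_character G H \<in> Perm G"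
  unfolding Perm_def by (rule generate.incl) blast

lemma Perm_gens_subset:
  assumes "group G" "finite (carrier G)"
  shows "{perm_character G H |H. subgroup H G} \<subseteq> carrier (class_functions G)"
  using perm_character_in_Perm subgroup.subset[OF Perm_subgroup[OF assms]] by blast

text \<open>Induction splits off one orbit at a time, whose fixed points are counted by the
  \<open>perm_character\<close> of a stabilizer. Applied to a subgroup T acting on G/H it gives the
  restriction of permutation characters, with the T-orbits in the role of double cosets.\<close>

lemma fixed_points_in_Perm:
  fixes G :: "('a, 'b) monoid_scheme" (structure) and X :: "'x set"
  assumes "group G" and fin: "finite (carrier G)" and "finite X"
    and "\<And>x. x \<in> X \<Longrightarrow> \<phi> \<one> x = x"
    and "\<And>g h x. g \<in> carrier G \<Longrightarrow> h \<in> carrier G \<Longrightarrow> x \<in> X \<Longrightarrow> \<phi> (g \<otimes> h) x = \<phi> g (\<phi> h x)"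
    and "\<And>g x. g \<in> carrier G \<Longrightarrow> x \<in> X \<Longrightarrow> \<phi> g x \<in> X"
  shows "(\<lambda>g. if g \<in> carrier G then of_nat (card {x \<in> X. \<phi> g x = x}) else 0) \<in> Perm G"
  using assms(3-6)
proof (induction "card X" arbitrary: X rule: less_induct)
  case less
  note P = Perm_subgroup[OF assms(1,2)]
  interpret group G by fact
  show ?case
  proof (cases "X = {}")
    case True
    then have "(\<lambda>g. if g \<in> carrier G then of_nat (card {x \<in> X. \<phi> g x = x}) else 0) = (\<lambda>g. 0 :: complex)" by auto
    then show ?thesis using subgroup_class_functions_zero[OF P] by simp
  next
    case False
    then obtain x where x: "x \<in> X" by blast
    let ?O = "(\<lambda>h. \<phi> h x) ` carrier G"
    let ?H = "{h \<in> carrier G. \<phi> h x = x}"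
    have O: "?O \<subseteq> X" using less.prems(4) x by blast
    have xO: "x \<in> ?O" using less.prems(2)[OF x] one_closed by (metis imageI)
    have closed: "\<phi> g y \<in> X - ?O" if "g \<in> carrier G" "y \<in> X - ?O" for g y
    proof -
      have y: "y = \<phi> (inv g) (\<phi> g y)" using less.prems(3)[of "inv g" g y] less.prems(2)[of y] that by simp
      have "y \<in> ?O" if gy: "\<phi> g y \<in> ?O"
      proof -
        obtain h where h: "h \<in> carrier G" "\<phi> g y = \<phi> h x" using gy by (elim imageE) (rule that)
        have "y = \<phi> (inv g) (\<phi> h x)" using y unfolding h(2) .
        also have "\<dots> = \<phi> (inv g \<otimes> h) x"
          using h(1) x \<open>g \<in> carrier G\<close> by (intro less.prems(3)[symmetric]) auto
        finally have "y = \<phi> (inv g \<otimes> h) x" .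
        then show ?thesis using h(1) \<open>g \<in> carrier G\<close> by (intro image_eqI[of _ _ "inv g \<otimes> h"]) auto
      qed
      then show ?thesis using that less.prems(4)[of g y] by auto
    qed
    have "card (X - ?O) < card X" using x xO less.prems(1) by (intro psubset_card_mono) auto
    then have 1: "(\<lambda>g. if g \<in> carrier G then of_nat (card {x \<in> X - ?O. \<phi> g x = x}) else 0) \<in> Perm G"
      using less.prems closed by (intro less.hyps) auto
    have H: "subgroup ?H G"
      by (rule orbit_fixed_points(1)[OF assms(1,2)]) (use less.prems x in auto)
    have o: "of_nat (card {y \<in> ?O. \<phi> g y = y}) = perm_character G ?H g" if "g \<in> carrier G" for g
      unfolding perm_character_eq_Ind[OF assms(1,2) H]
      by (rule orbit_fixed_points(2)[OF assms(1,2), where X = X]) (use less.prems x that in auto)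
    have "(\<lambda>g. if g \<in> carrier G then of_nat (card {x \<in> X. \<phi> g x = x}) else 0) =
      (\<lambda>g. perm_character G ?H g + (if g \<in> carrier G then of_nat (card {x \<in> X - ?O. \<phi> g x = x}) else 0))"
    proof
      fix g
      have "{x \<in> X. \<phi> g x = x} = {x \<in> ?O. \<phi> g x = x} \<union> {x \<in> X - ?O. \<phi> g x = x}" using O by blast
      moreover have "card ({x \<in> ?O. \<phi> g x = x} \<union> {x \<in> X - ?O. \<phi> g x = x}) =
          card {x \<in> ?O. \<phi> g x = x} + card {x \<in> X - ?O. \<phi> g x = x}"
        using fin less.prems(1) by (intro card_Un_disjoint) auto
      ultimately show "(if g \<in> carrier G then of_nat (card {x \<in> X. \<phi> g x = x}) else 0) =
          perm_character G ?H g + (if g \<in> carrier G then of_nat (card {x \<in> X - ?O. \<phi> g x = x}) else 0)"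
        using o[of g] by (simp add: perm_character_def)
    qed
    then show ?thesis using subgroup_class_functions_add[OF P perm_character_in_Perm[OF H] 1] by simp
  qed
qed

lemma Perm_Res:
  assumes G: "group G" "finite (carrier G)" and T: "subgroup T G" and \<chi>: "\<chi> \<in> Perm G"
  shows "Res T \<chi> \<in> Perm (G\<lparr>carrier := T\<rparr>)"
proof -
  interpret group G by fact
  interpret T: subgroup T G by fact
  have GT: "group (G\<lparr>carrier := T\<rparr>)" "finite (carrier (G\<lparr>carrier := T\<rparr>))"
    using subgroup_imp_group[OF T] finite_subset[OF T.subset G(2)] by auto
  have "Res T ` Perm G \<subseteq> Perm (G\<lparr>carrier := T\<rparr>)"
    unfolding Perm_def[of G]
  proof (rule hom_generate_subset[OF group_class_functions group_class_functions Res_hom[OF G(1) T]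
        Perm_gens_subset[OF G] Perm_subgroup[OF GT]], safe)
    fix H assume H: "subgroup H G"
    note a = lcosets_action[OF G(1) H]
    have "Res T (perm_character G H) =
       (\<lambda>g. if g \<in> carrier (G\<lparr>carrier := T\<rparr>) then of_nat (card {X \<in> lcosets\<^bsub>G\<^esub> H. g <#\<^bsub>G\<^esub> X = X}) else 0)"
      using perm_character_eq_card[OF G H] T.mem_carrier by (auto simp: Res_def fun_eq_iff)
    also have "\<dots> \<in> Perm (G\<lparr>carrier := T\<rparr>)"
      by (rule fixed_points_in_Perm[OF GT finite_lcosets[OF G H]]) (use a T.mem_carrier in auto)
    finally show "Res T (perm_character G H) \<in> Perm (G\<lparr>carrier := T\<rparr>)" .
  qed
  then show ?thesis using \<chi> by blast
qed

lemma Ind_perm_character: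
  assumes G: "group G" "finite (carrier G)" and S: "subgroup S G" and H: "subgroup H (G\<lparr>carrier := S\<rparr>)"
  shows "Ind G S (perm_character (G\<lparr>carrier := S\<rparr>) H) = perm_character G H"
proof -
  interpret group G by fact
  interpret S: subgroup S G by fact
  have GS: "group (G\<lparr>carrier := S\<rparr>)" "finite (carrier (G\<lparr>carrier := S\<rparr>))"
    using subgroup_imp_group[OF S] finite_subset[OF S.subset G(2)] by auto
  have HG: "subgroup H G" by (rule incl_subgroup[OF S H])
  have "H \<subseteq> S" using subgroup.subset[OF H] by simp
  then show ?thesis
    unfolding perm_character_eq_Ind[OF GS H] perm_character_eq_Ind[OF G HG]
    by (intro Ind_trans[OF G S]) (auto simp: Res_def)
qed

lemma Perm_Ind:
  assumes G: "group G" "finite (carrier G)" and S: "subgroup S G" and \<chi>: "\<chi> \<in> Perm (G\<lparr>carrier := S\<rparr>)"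
  shows "Ind G S \<chi> \<in> Perm G"
proof -
  interpret group G by fact
  interpret S: subgroup S G by fact
  have GS: "group (G\<lparr>carrier := S\<rparr>)" "finite (carrier (G\<lparr>carrier := S\<rparr>))"
    using subgroup_imp_group[OF S] finite_subset[OF S.subset G(2)] by auto
  have "Ind G S ` Perm (G\<lparr>carrier := S\<rparr>) \<subseteq> Perm G"
    unfolding Perm_def[of "G\<lparr>carrier := S\<rparr>"]
  proof (rule hom_generate_subset[OF group_class_functions group_class_functions Ind_hom[OF G(1)]
        Perm_gens_subset[OF GS] Perm_subgroup[OF G]])
    show "monoid.mult (class_functions (G\<lparr>carrier := S\<rparr>)) = (\<lambda>f f' g. f g + f' g)"
      by (simp add: class_functions_def)
    show "Ind G S ` {perm_character (G\<lparr>carrier := S\<rparr>) H |H. subgroup H (G\<lparr>carrier := S\<rparr>)} \<subseteq> Perm G"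
    proof safe
      fix H assume "subgroup H (G\<lparr>carrier := S\<rparr>)"
      then show "Ind G S (perm_character (G\<lparr>carrier := S\<rparr>) H) \<in> Perm G"
        using Ind_perm_character[OF G S] perm_character_in_Perm[OF incl_subgroup[OF S]] by simp
    qed
  qed
  then show ?thesis using \<chi> by blast
qed

section \<open>Families of character groups stable under restriction and induction\<close>

text \<open>Holds of \<open>Perm\<close>, \<open>virtual_characters\<close>, \<open>Char_Q\<close>
  and \<open>R_Q\<close>, so that the argument can be run for a variable R. The family is indexed by
  all group structures on the type because subgroups are formed by changing the carrier.\<close>

definition mackey_closed :: "('a monoid \<Rightarrow> ('a \<Rightarrow> complex) set) \<Rightarrow> bool" where
  "mackey_closed R \<longleftrightarrow> (\<forall>G. group G \<and> finite (carrier G) \<longrightarrow>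
     subgroup (R G) (class_functions G) \<and>
     (\<forall>T. subgroup T G \<longrightarrow> (\<forall>\<chi>\<in>R G. Res T \<chi> \<in> R (G\<lparr>carrier := T\<rparr>)) \<and>
        (\<forall>\<chi>\<in>R (G\<lparr>carrier := T\<rparr>). Ind G T \<chi> \<in> R G)))"

lemma mackey_closedD:
  assumes "mackey_closed R" "group G" "finite (carrier G)"
  shows "subgroup (R G) (class_functions G)"
    and "\<And>T \<chi>. subgroup T G \<Longrightarrow> \<chi> \<in> R G \<Longrightarrow> Res T \<chi> \<in> R (G\<lparr>carrier := T\<rparr>)"
    and "\<And>T \<chi>. subgroup T G \<Longrightarrow> \<chi> \<in> R (G\<lparr>carrier := T\<rparr>) \<Longrightarrow> Ind G T \<chi> \<in> R G"
  using assms unfolding mackey_closed_def by auto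

lemma mackey_closed_Perm: "mackey_closed Perm"
  unfolding mackey_closed_def using Perm_subgroup Perm_Res Perm_Ind by blast

text \<open>By the projection formula, the character of Q[G/H] times \<chi> is Ind Res \<chi>. So
  closure under \<open>Res\<close> and \<open>Ind\<close> already makes R(G) a module over
  Perm(G).\<close>

lemma mackey_closed_Perm_mult:
  assumes R: "mackey_closed R" and G: "group G" "finite (carrier G)" and \<chi>: "\<chi> \<in> R G" and \<psi>: "\<psi> \<in> Perm G"
  shows "(\<lambda>g. \<psi> g * \<chi> g) \<in> R G"
proof -
  note RG = mackey_closedD[OF R G]
  have c: "\<chi> \<in> carrier (class_functions G)" using RG(1) \<chi> subgroup.mem_carrier by metis
  have "(\<lambda>\<psi> g. \<psi> g * \<chi> g) ` Perm G \<subseteq> R G"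
    unfolding Perm_def
  proof (rule hom_generate_subset[OF group_class_functions group_class_functions _ Perm_gens_subset[OF G] RG(1)])
    show "(\<lambda>\<psi> g. \<psi> g * \<chi> g) \<in> hom (class_functions G) (class_functions G)"
      by (rule homI) (use c in \<open>auto simp: carrier_class_functions algebra_simps\<close>)
    show "(\<lambda>\<psi> g. \<psi> g * \<chi> g) ` {perm_character G H |H. subgroup H G} \<subseteq> R G"
    proof safe
      fix H assume H: "subgroup H G"
      have "(\<lambda>g. perm_character G H g * \<chi> g) = Ind G H (\<lambda>g. Res H (\<lambda>_. 1) g * Res H \<chi> g)"
        unfolding perm_character_eq_Ind[OF G H]
        by (rule Ind_projection[OF G(1) c, symmetric]) (simp add: Res_def)
      also have "(\<lambda>g. Res H (\<lambda>_. 1) g * Res H \<chi> g) = Res H \<chi>" by (auto simp: Res_def)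
      finally show "(\<lambda>g. perm_character G H g * \<chi> g) \<in> R G"
        using RG(2,3)[OF H] \<chi> by simp
    qed
  qed
  then show ?thesis using \<psi> by blast
qed

subsection \<open>Characters of matrix representations\<close>

lemma trace_mult_commute:
  fixes A B :: "'k :: comm_semiring_0 mat"
  assumes "A \<in> carrier_mat n n" "B \<in> carrier_mat n n"
  shows "(\<Sum>i<n. (A * B) $$ (i, i)) = (\<Sum>i<n. (B * A) $$ (i, i))"
proof -
  have "(\<Sum>i<n. (A * B) $$ (i, i)) = (\<Sum>i<n. \<Sum>j<n. A $$ (i, j) * B $$ (j, i))"
    using assms by (auto simp: scalar_prod_def atLeast0LessThan intro!: sum.cong)
  also have "\<dots> = (\<Sum>j<n. \<Sum>i<n. A $$ (i, j) * B $$ (j, i))" by (rule sum.swap)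
  also have "\<dots> = (\<Sum>i<n. (B * A) $$ (i, i))"
    using assms by (auto simp: scalar_prod_def atLeast0LessThan mult.commute intro!: sum.cong)
  finally show ?thesis .
qed

text \<open>Invertibility of the matrices follows from the other conditions, with the matrix of g^-1
  as inverse; this gives a purely equational working form.\<close>

lemma matrix_reps_iff:
  fixes \<rho> :: "'a \<Rightarrow> 'k :: field mat"
  assumes "group G"
  shows "\<rho> \<in> matrix_reps G n \<longleftrightarrow> (\<forall>g\<in>carrier G. \<rho> g \<in> carrier_mat n n) \<and> \<rho> \<one>\<^bsub>G\<^esub> = 1\<^sub>m n \<and>
    (\<forall>g\<in>carrier G. \<forall>h\<in>carrier G. \<rho> (g \<otimes>\<^bsub>G\<^esub> h) = \<rho> g * \<rho> h)"
proof -
  let ?M = "ring_mat TYPE('k) n ()"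
  interpret group G by fact
  interpret M: ring ?M by (rule ring_mat)
  have M: "carrier ?M = carrier_mat n n" "x \<otimes>\<^bsub>?M\<^esub> y = x * y" "\<one>\<^bsub>?M\<^esub> = 1\<^sub>m n" for x y
    by (simp_all add: ring_mat_def)
  have U: "x \<otimes>\<^bsub>units_of ?M\<^esub> y = x * y" "\<one>\<^bsub>units_of ?M\<^esub> = 1\<^sub>m n" "carrier (units_of ?M) = Units ?M" for x y
    by (simp_all add: units_of_def M)
  show ?thesis
  proof
    assume r: "\<rho> \<in> matrix_reps G n"
    then interpret group_hom G "units_of ?M" \<rho>
      unfolding matrix_reps_def using M.units_group assms by (simp add: group_hom_def group_hom_axioms_def)
    have "\<rho> g \<in> carrier_mat n n" if "g \<in> carrier G" for g
      using hom_closed[OF that] M.Units_closed unfolding U M(1) by blast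
    then show "(\<forall>g\<in>carrier G. \<rho> g \<in> carrier_mat n n) \<and> \<rho> \<one>\<^bsub>G\<^esub> = 1\<^sub>m n \<and>
      (\<forall>g\<in>carrier G. \<forall>h\<in>carrier G. \<rho> (g \<otimes>\<^bsub>G\<^esub> h) = \<rho> g * \<rho> h)"
      using hom_one hom_mult unfolding U by simp
  next
    assume r: "(\<forall>g\<in>carrier G. \<rho> g \<in> carrier_mat n n) \<and> \<rho> \<one>\<^bsub>G\<^esub> = 1\<^sub>m n \<and>
      (\<forall>g\<in>carrier G. \<forall>h\<in>carrier G. \<rho> (g \<otimes>\<^bsub>G\<^esub> h) = \<rho> g * \<rho> h)"
    show "\<rho> \<in> matrix_reps G n"
      unfolding matrix_reps_def
    proof (rule homI)
      fix g assume g: "g \<in> carrier G"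
      have "\<rho> g * \<rho> (inv\<^bsub>G\<^esub> g) = 1\<^sub>m n" "\<rho> (inv\<^bsub>G\<^esub> g) * \<rho> g = 1\<^sub>m n"
        using r g inv_closed[OF g] r_inv[OF g] l_inv[OF g] by metis+
      then show "\<rho> g \<in> carrier (units_of ?M)"
        unfolding U Units_def M using r g by (intro CollectI conjI bexI[of _ "\<rho> (inv\<^bsub>G\<^esub> g)"]) auto
    qed (use r U in auto)
  qed
qed

lemma rep_character_class_function:
  assumes "group G" and \<rho>: "\<rho> \<in> matrix_reps G n"
  shows "\<And>g. g \<notin> carrier G \<Longrightarrow> rep_character G n \<rho> g = 0"
    and "\<And>g x. g \<in> carrier G \<Longrightarrow> x \<in> carrier G \<Longrightarrow>
       rep_character G n \<rho> (x \<otimes>\<^bsub>G\<^esub> g \<otimes>\<^bsub>G\<^esub> inv\<^bsub>G\<^esub> x) = rep_character G n \<rho> g"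
proof -
  interpret group G by fact
  note r = \<rho>[unfolded matrix_reps_iff[OF assms(1)]]
  show "rep_character G n \<rho> g = 0" if "g \<notin> carrier G" for g using that by (simp add: rep_character_def)
  fix g x assume gx: "g \<in> carrier G" "x \<in> carrier G"
  have "(\<Sum>i<n. \<rho> (x \<otimes>\<^bsub>G\<^esub> (g \<otimes>\<^bsub>G\<^esub> inv\<^bsub>G\<^esub> x)) $$ (i, i)) = (\<Sum>i<n. (\<rho> x * \<rho> (g \<otimes>\<^bsub>G\<^esub> inv\<^bsub>G\<^esub> x)) $$ (i, i))"
    using r gx by simp
  also have "\<dots> = (\<Sum>i<n. (\<rho> (g \<otimes>\<^bsub>G\<^esub> inv\<^bsub>G\<^esub> x) * \<rho> x) $$ (i, i))"
    by (rule trace_mult_commute) (use r gx in blast, use r gx in \<open>blast intro: m_closed inv_closed\<close>)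
  also have "\<rho> (g \<otimes>\<^bsub>G\<^esub> inv\<^bsub>G\<^esub> x) * \<rho> x = \<rho> ((g \<otimes>\<^bsub>G\<^esub> inv\<^bsub>G\<^esub> x) \<otimes>\<^bsub>G\<^esub> x)" using r gx by simp
  also have "(g \<otimes>\<^bsub>G\<^esub> inv\<^bsub>G\<^esub> x) \<otimes>\<^bsub>G\<^esub> x = g" using gx by (simp add: m_assoc)
  finally show "rep_character G n \<rho> (x \<otimes>\<^bsub>G\<^esub> g \<otimes>\<^bsub>G\<^esub> inv\<^bsub>G\<^esub> x) = rep_character G n \<rho> g"
    using gx by (simp add: rep_character_def m_assoc)
qed

lemma rep_character_conj:
  assumes "group G" and \<rho>: "\<rho> \<in> matrix_reps G n" and "g \<in> carrier G" "x \<in> carrier G"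
  shows "rep_character G n \<rho> (inv\<^bsub>G\<^esub> x \<otimes>\<^bsub>G\<^esub> g \<otimes>\<^bsub>G\<^esub> x) = rep_character G n \<rho> g"
proof -
  interpret group G by fact
  show ?thesis using rep_character_class_function(2)[OF assms(1,2,3), of "inv\<^bsub>G\<^esub> x"] assms by simp
qed

lemma matrix_reps_restrict:
  assumes "subgroup T G" and "\<rho> \<in> matrix_reps G n"
  shows "\<rho> \<in> matrix_reps (G\<lparr>carrier := T\<rparr>) n"
  using assms subgroup.subset[OF assms(1)] unfolding matrix_reps_def hom_def by (auto simp: Pi_iff)

section \<open>Induced representations\<close>

text \<open>The coset representatives are numbered by naturals because they will index the blocks of
  a matrix.\<close>

lemma left_transversal:
  fixes G (structure)
  assumes "group G" "finite (carrier G)" "subgroup S G"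
  obtains k and r :: "nat \<Rightarrow> 'a" where "\<And>i. i < k \<Longrightarrow> r i \<in> carrier G"
    "bij_betw (\<lambda>(i, s). r i \<otimes> s) ({..<k} \<times> S) (carrier G)"
proof -
  interpret group G by fact
  interpret S: subgroup S G by fact
  define k where "k = card (lcosets S)"
  obtain h where h: "bij_betw h {..<k} (lcosets S)"
    using ex_bij_betw_nat_finite[OF finite_lcosets[OF assms]] unfolding k_def atLeast0LessThan by blast
  have "\<exists>x\<in>carrier G. h i = x <# S" if "i < k" for i
    using bij_betwE[OF h] that unfolding LCOSETS_def by auto
  then obtain r where r: "\<And>i. i < k \<Longrightarrow> r i \<in> carrier G" "\<And>i. i < k \<Longrightarrow> h i = r i <# S" by metis
  show thesis
  proof
    show "r i \<in> carrier G" if "i < k" for i by (rule r(1)[OF that])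
    show "bij_betw (\<lambda>(i, s). r i \<otimes> s) ({..<k} \<times> S) (carrier G)"
      unfolding bij_betw_def
    proof
      show "inj_on (\<lambda>(i, s). r i \<otimes> s) ({..<k} \<times> S)"
      proof (rule inj_onI, clarify)
        fix i s j t assume *: "i < k" "s \<in> S" "j < k" "t \<in> S" "r i \<otimes> s = r j \<otimes> t"
        have "r i \<otimes> s \<in> h i" unfolding r(2)[OF *(1)] l_coset_def using *(2) by blast
        moreover have "r j \<otimes> t \<in> h j" unfolding r(2)[OF *(3)] l_coset_def using *(4) by blast
        ultimately have "h i \<inter> h j \<noteq> {}" using *(5) by auto
        moreover have "h i \<in> lcosets S" "h j \<in> lcosets S" using bij_betwE[OF h] * by auto
        ultimately have "h i = h j" using lcos_disjoint[OF assms(3)] by blast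
        then have ij: "i = j" using bij_betw_imp_inj_on[OF h] * by (auto dest: inj_onD)
        then show "i = j \<and> s = t" using *(1,2,4,5) r(1) S.mem_carrier by simp
      qed
      show "(\<lambda>(i, s). r i \<otimes> s) ` ({..<k} \<times> S) = carrier G"
      proof (intro equalityI subsetI)
        fix x assume "x \<in> (\<lambda>(i, s). r i \<otimes> s) ` ({..<k} \<times> S)"
        then show "x \<in> carrier G" using r(1) S.mem_carrier by auto
      next
        fix x assume x: "x \<in> carrier G"
        then have "x <# S \<in> lcosets S" unfolding LCOSETS_def by blast
        then obtain i where i: "i < k" "h i = x <# S" using bij_betw_imp_surj_on[OF h] by (metis imageE lessThan_iff)
        have "x \<in> r i <# S" using lcos_self[OF x assms(3)] i r(2) by simp
        then show "x \<in> (\<lambda>(i, s). r i \<otimes> s) ` ({..<k} \<times> S)" using i(1) unfolding l_coset_def by force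
      qed
    qed
  qed
qed

lemma sum_lessThan_mult:
  "(\<Sum>c<k * n. f c) = (\<Sum>i<k. \<Sum>j<n. f (i * n + j))" for f :: "nat \<Rightarrow> 'b :: comm_monoid_add"
proof -
  have "(\<Sum>c<k * n. f c) = (\<Sum>i<k. sum f {i * n..<i * n + n})" by (rule sum.nat_group[symmetric])
  also have "\<dots> = (\<Sum>i<k. \<Sum>j<n. f (i * n + j))"
    using sum.shift_bounds_nat_ivl[of f 0 "_ * n" n] by (simp add: atLeast0LessThan add.commute)
  finally show ?thesis .
qed

text \<open>The classical block matrix: block (i, j) at g is the matrix of r_i^-1 g r_j, or zero if
  that element is not in S. The trace identity is multiplied through by |S|, so that it makes sense
  over a field of any characteristic.\<close>

lemma induced_representation:
  fixes G :: "('a, 'b) monoid_scheme" (structure) and \<rho> :: "'a \<Rightarrow> 'k :: field mat"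
  assumes G: "group G" "finite (carrier G)" and S: "subgroup S G" and \<rho>: "\<rho> \<in> matrix_reps (G\<lparr>carrier := S\<rparr>) n"
  obtains m and \<sigma> :: "'a \<Rightarrow> 'k mat" where "\<sigma> \<in> matrix_reps G m"
    "\<And>g. g \<in> carrier G \<Longrightarrow> of_nat (card S) * rep_character G m \<sigma> g =
       (\<Sum>x\<in>carrier G. rep_character (G\<lparr>carrier := S\<rparr>) n \<rho> (inv x \<otimes> g \<otimes> x))"
proof -
  interpret group G by fact
  interpret S: subgroup S G by fact
  have GS: "group (G\<lparr>carrier := S\<rparr>)" by (rule subgroup_imp_group[OF S])
  note r\<rho> = \<rho>[unfolded matrix_reps_iff[OF GS], simplified]
  obtain k and r :: "nat \<Rightarrow> 'a" where r: "\<And>i. i < k \<Longrightarrow> r i \<in> carrier G"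
    and bij: "bij_betw (\<lambda>(i, s). r i \<otimes> s) ({..<k} \<times> S) (carrier G)"
    by (rule left_transversal[OF G S]) (rule that)
  have unique: "i = j" if "i < k" "j < k" "g \<in> carrier G" "inv (r i) \<otimes> g \<in> S" "inv (r j) \<otimes> g \<in> S" for i j g
  proof -
    have "(\<lambda>(i, s). r i \<otimes> s) (i, inv (r i) \<otimes> g) = (\<lambda>(i, s). r i \<otimes> s) (j, inv (r j) \<otimes> g)"
      using that r by (simp add: mult_inv_cancel)
    then have "(i, inv (r i) \<otimes> g) = (j, inv (r j) \<otimes> g)"
      using inj_onD[OF bij_betw_imp_inj_on[OF bij]] that by blast
    then show ?thesis by simp
  qed
  have exists: "\<exists>i<k. inv (r i) \<otimes> g \<in> S" if "g \<in> carrier G" for g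
  proof -
    have "g \<in> (\<lambda>(i, s). r i \<otimes> s) ` ({..<k} \<times> S)" using bij_betw_imp_surj_on[OF bij] that by simp
    then obtain y where y: "y \<in> {..<k} \<times> S" "g = (\<lambda>(i, s). r i \<otimes> s) y" by blast
    obtain i s where "y = (i, s)" by (cases y)
    then have "i < k" "s \<in> S" "g = r i \<otimes> s" using y by auto
    then show ?thesis using r by (intro exI[of _ i]) (simp add: mult_inv_cancel)
  qed
  define \<rho>0 where "\<rho>0 g = (if g \<in> S then \<rho> g else 0\<^sub>m n n)" for g
  have c0: "\<rho>0 g \<in> carrier_mat n n" for g using r\<rho> by (simp add: \<rho>0_def)
  \<comment> \<open>Extension by zero remains multiplicative when the right factor lies in S, as it
    does in the one block product that survives below.\<close>
  have m0: "\<rho>0 (a \<otimes> b) = \<rho>0 a * \<rho>0 b" if "a \<in> carrier G" "b \<in> S" for a b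
  proof (cases "a \<in> S")
    case False
    have "a \<otimes> b \<notin> S"
    proof
      assume "a \<otimes> b \<in> S"
      then have "(a \<otimes> b) \<otimes> inv b \<in> S" using that by auto
      then show False using False that S.mem_carrier by (simp add: m_assoc)
    qed
    then show ?thesis using False c0[of b] by (simp add: \<rho>0_def)
  qed (use that r\<rho> in \<open>simp add: \<rho>0_def\<close>)
  define \<sigma> where "\<sigma> g = mat (k * n) (k * n) (\<lambda>(a, b). \<rho>0 (inv (r (a div n)) \<otimes> g \<otimes> r (b div n)) $$ (a mod n, b mod n))" for g
  have lt: "a div n < k" "a mod n < n" if "a < k * n" for a
    using that by (simp_all add: less_mult_imp_div_less) (metis mod_less_divisor mult_0_right not_less_zero zero_less_iff_neq_zero)
  have "\<sigma> \<in> matrix_reps G (k * n)"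
    unfolding matrix_reps_iff[OF G(1)]
  proof (intro conjI ballI)
    show "\<sigma> g \<in> carrier_mat (k * n) (k * n)" for g by (simp add: \<sigma>_def)
    show "\<sigma> \<one> = 1\<^sub>m (k * n)"
    proof (rule eq_matI)
      fix a b assume ab: "a < dim_row (1\<^sub>m (k * n) :: 'k mat)" "b < dim_col (1\<^sub>m (k * n) :: 'k mat)"
      then have ab: "a < k * n" "b < k * n" by auto
      let ?z = "inv (r (a div n)) \<otimes> \<one> \<otimes> r (b div n)"
      have rr: "r (a div n) \<in> carrier G" "r (b div n) \<in> carrier G" using r lt ab by auto
      have z: "?z = inv (r (a div n)) \<otimes> r (b div n)" using rr by simp
      have "?z \<in> S \<longleftrightarrow> a div n = b div n"
        unfolding z using unique[of "a div n" "b div n" "r (b div n)"] rr lt ab by auto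
      moreover have "?z = \<one>" if "a div n = b div n" unfolding z using that rr by simp
      moreover have "a = b \<longleftrightarrow> a div n = b div n \<and> a mod n = b mod n" by (metis div_mult_mod_eq)
      ultimately show "\<sigma> \<one> $$ (a, b) = 1\<^sub>m (k * n) $$ (a, b)"
        using ab lt[OF ab(1)] lt[OF ab(2)] r\<rho> by (auto simp: \<sigma>_def \<rho>0_def)
    qed (auto simp: \<sigma>_def)
    fix g h assume gh: "g \<in> carrier G" "h \<in> carrier G"
    show "\<sigma> (g \<otimes> h) = \<sigma> g * \<sigma> h"
    proof (rule eq_matI)
      fix a b assume "a < dim_row (\<sigma> g * \<sigma> h)" "b < dim_col (\<sigma> g * \<sigma> h)"
      then have ab: "a < k * n" "b < k * n" by (auto simp: \<sigma>_def)
      have rr: "r (a div n) \<in> carrier G" "r (b div n) \<in> carrier G" using r lt ab by auto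
      let ?A = "\<lambda>i. inv (r (a div n)) \<otimes> g \<otimes> r i" and ?B = "\<lambda>i. inv (r i) \<otimes> h \<otimes> r (b div n)"
      have kn: "i * n + j < k * n" if "i < k" "j < n" for i j
      proof -
        have "i * n + j < Suc i * n" using that by simp
        also have "\<dots> \<le> k * n" using that by (intro mult_le_mono1) simp
        finally show ?thesis .
      qed
      have "(\<sigma> g * \<sigma> h) $$ (a, b) = (\<Sum>c<k * n. \<sigma> g $$ (a, c) * \<sigma> h $$ (c, b))"
        using ab by (simp add: \<sigma>_def scalar_prod_def atLeast0LessThan)
      also have "\<dots> = (\<Sum>i<k. \<Sum>j<n. \<sigma> g $$ (a, i * n + j) * \<sigma> h $$ (i * n + j, b))"
        by (rule sum_lessThan_mult)
      also have "\<dots> = (\<Sum>i<k. \<Sum>j<n. \<rho>0 (?A i) $$ (a mod n, j) * \<rho>0 (?B i) $$ (j, b mod n))"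
        using ab kn by (intro sum.cong refl) (auto simp: \<sigma>_def)
      also have "\<dots> = (\<Sum>i<k. (\<rho>0 (?A i) * \<rho>0 (?B i)) $$ (a mod n, b mod n))"
      proof (rule sum.cong[OF refl])
        fix i
        show "(\<Sum>j<n. \<rho>0 (?A i) $$ (a mod n, j) * \<rho>0 (?B i) $$ (j, b mod n)) = (\<rho>0 (?A i) * \<rho>0 (?B i)) $$ (a mod n, b mod n)"
          using c0[of "?A i"] c0[of "?B i"] lt(2)[OF ab(1)] lt(2)[OF ab(2)]
          by (simp add: scalar_prod_def atLeast0LessThan)
      qed
      also have "\<dots> = \<rho>0 (inv (r (a div n)) \<otimes> (g \<otimes> h) \<otimes> r (b div n)) $$ (a mod n, b mod n)"
      proof -
        have hb: "h \<otimes> r (b div n) \<in> carrier G" using gh rr by simp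
        \<comment> \<open>The element h r_j, with j the column block, lies in exactly one coset r_i
          S, so a single term of the sum over i survives.\<close>
        obtain i0 where i0: "i0 < k" "inv (r i0) \<otimes> (h \<otimes> r (b div n)) \<in> S" using exists[OF hb] by blast
        have B: "?B i = inv (r i) \<otimes> (h \<otimes> r (b div n))" if "i < k" for i using r[OF that] gh rr by (simp add: m_assoc)
        have zero: "(\<rho>0 (?A i) * \<rho>0 (?B i)) $$ (a mod n, b mod n) = 0" if "i \<in> {..<k} - {i0}" for i
        proof -
          have "?B i \<notin> S" using unique[OF _ i0(1) hb _ i0(2), of i] that B by auto
          then have "\<rho>0 (?B i) = 0\<^sub>m n n" by (simp add: \<rho>0_def)
          then show ?thesis using c0[of "?A i"] lt(2)[OF ab(1)] lt(2)[OF ab(2)] by simp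
        qed
        have "(\<Sum>i<k. (\<rho>0 (?A i) * \<rho>0 (?B i)) $$ (a mod n, b mod n)) = (\<rho>0 (?A i0) * \<rho>0 (?B i0)) $$ (a mod n, b mod n)"
          using sum.mono_neutral_right[of "{..<k}" "{i0}" "\<lambda>i. (\<rho>0 (?A i) * \<rho>0 (?B i)) $$ (a mod n, b mod n)"] i0(1) zero by auto
        also have "\<rho>0 (?A i0) * \<rho>0 (?B i0) = \<rho>0 (?A i0 \<otimes> ?B i0)"
          using i0 B[OF i0(1)] gh rr r[OF i0(1)] by (intro m0[symmetric]) auto
        also have "?A i0 \<otimes> ?B i0 = inv (r (a div n)) \<otimes> (g \<otimes> h) \<otimes> r (b div n)"
          using gh rr r[OF i0(1)] by (simp add: m_assoc mult_inv_cancel)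
        finally show ?thesis .
      qed
      finally show "\<sigma> (g \<otimes> h) $$ (a, b) = (\<sigma> g * \<sigma> h) $$ (a, b)" using ab by (simp add: \<sigma>_def)
    qed (auto simp: \<sigma>_def)
  qed
  moreover have "of_nat (card S) * rep_character G (k * n) \<sigma> g =
       (\<Sum>x\<in>carrier G. rep_character (G\<lparr>carrier := S\<rparr>) n \<rho> (inv x \<otimes> g \<otimes> x))" if g: "g \<in> carrier G" for g
  proof -
    let ?\<theta> = "rep_character (G\<lparr>carrier := S\<rparr>) n \<rho>"
    have kn: "i * n + j < k * n" if "i < k" "j < n" for i j
    proof -
      have "i * n + j < Suc i * n" using that by simp
      also have "\<dots> \<le> k * n" using that by (intro mult_le_mono1) simp
      finally show ?thesis .
    qed
    have conj: "?\<theta> (inv s \<otimes> z \<otimes> s) = ?\<theta> z" if "s \<in> S" "z \<in> carrier G" for s z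
    proof (cases "z \<in> S")
      case True
      then show ?thesis using rep_character_conj[OF GS \<rho>, of z s] that m_inv_consistent[OF S] by simp
    next
      case False
      then have "inv s \<otimes> z \<otimes> s \<notin> S" using subgroup_conj_mem_iff[OF G(1) S that(2,1)] by simp
      then show ?thesis using False by (simp add: rep_character_def)
    qed
    have tr: "?\<theta> z = (\<Sum>j<n. \<rho>0 z $$ (j, j))" for z by (simp add: rep_character_def \<rho>0_def)
    have "rep_character G (k * n) \<sigma> g = (\<Sum>i<k. \<Sum>j<n. \<sigma> g $$ (i * n + j, i * n + j))"
      using g by (simp add: rep_character_def sum_lessThan_mult)
    also have "\<dots> = (\<Sum>i<k. ?\<theta> (inv (r i) \<otimes> g \<otimes> r i))"
      unfolding tr using kn by (intro sum.cong refl) (auto simp: \<sigma>_def)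
    finally have 1: "rep_character G (k * n) \<sigma> g = (\<Sum>i<k. ?\<theta> (inv (r i) \<otimes> g \<otimes> r i))" .
    \<comment> \<open>In x = r_i s the factor s drops out, since the trace is invariant under
      conjugation by S; each coset is thus counted |S| times.\<close>
    have "(\<Sum>x\<in>carrier G. ?\<theta> (inv x \<otimes> g \<otimes> x)) =
        (\<Sum>y\<in>{..<k} \<times> S. ?\<theta> (inv (case y of (i, s) \<Rightarrow> r i \<otimes> s) \<otimes> g \<otimes> (case y of (i, s) \<Rightarrow> r i \<otimes> s)))"
      by (rule sum.reindex_bij_betw[OF bij, symmetric])
    also have "\<dots> = (\<Sum>y\<in>{..<k} \<times> S. ?\<theta> (inv (r (fst y)) \<otimes> g \<otimes> r (fst y)))"
    proof (rule sum.cong[OF refl], clarsimp)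
      fix i s assume iS: "i < k" "s \<in> S"
      have "inv (r i \<otimes> s) \<otimes> g \<otimes> (r i \<otimes> s) = inv s \<otimes> (inv (r i) \<otimes> g \<otimes> r i) \<otimes> s"
        using iS r g by (simp add: inv_mult_group m_assoc)
      then show "?\<theta> (inv (r i \<otimes> s) \<otimes> g \<otimes> (r i \<otimes> s)) = ?\<theta> (inv (r i) \<otimes> g \<otimes> r i)"
        using conj[OF iS(2)] r[OF iS(1)] g by simp
    qed
    also have "\<dots> = (\<Sum>i<k. \<Sum>s\<in>S. ?\<theta> (inv (r i) \<otimes> g \<otimes> r i))"
      unfolding sum.cartesian_product by (rule sum.cong) auto
    finally show ?thesis unfolding 1 by (simp add: sum_distrib_left)
  qed
  ultimately show thesis by (rule that)
qed

text \<open>The three equations make \<open>f\<close> a ring homomorphism; it will be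
  \<open>of_rat\<close> or the identity. It carries the trace identity from the field of the matrix
  entries to the complex-valued functions on which \<open>Ind\<close> acts.\<close>

lemma Ind_rep_character:
  fixes \<rho> :: "'a \<Rightarrow> 'k :: field_char_0 mat" and f :: "'k \<Rightarrow> complex"
  assumes G: "group G" "finite (carrier G)" and S: "subgroup S G" and \<rho>: "\<rho> \<in> matrix_reps (G\<lparr>carrier := S\<rparr>) n"
    and f: "\<And>x y. f (x + y) = f x + f y" "\<And>x y. f (x * y) = f x * f y" "f 1 = 1"
  obtains m and \<sigma> :: "'a \<Rightarrow> 'k mat" where "\<sigma> \<in> matrix_reps G m"
    "Ind G S (\<lambda>g. f (rep_character (G\<lparr>carrier := S\<rparr>) n \<rho> g)) = (\<lambda>g. f (rep_character G m \<sigma> g))"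
proof -
  interpret G: group G by fact
  interpret S: subgroup S G by fact
  obtain m and \<sigma> :: "'a \<Rightarrow> 'k mat" where s: "\<sigma> \<in> matrix_reps G m"
    "\<And>g. g \<in> carrier G \<Longrightarrow> of_nat (card S) * rep_character G m \<sigma> g =
       (\<Sum>x\<in>carrier G. rep_character (G\<lparr>carrier := S\<rparr>) n \<rho> (inv\<^bsub>G\<^esub> x \<otimes>\<^bsub>G\<^esub> g \<otimes>\<^bsub>G\<^esub> x))"
    by (rule induced_representation[OF G S \<rho>]) (rule that)
  have f0: "f 0 = 0" using f(1)[of 0 0] by simp
  have fsum: "f (\<Sum>x\<in>A. h x) = (\<Sum>x\<in>A. f (h x))" for A :: "'a set" and h
    by (induction A rule: infinite_finite_induct) (auto simp: f f0)
  have fn: "f (of_nat k) = of_nat k" for k by (induction k) (auto simp: f f0)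
  have cS: "card S \<noteq> 0" using S.finite_imp_card_positive[OF G(2)] by simp
  have "Ind G S (\<lambda>g. f (rep_character (G\<lparr>carrier := S\<rparr>) n \<rho> g)) g = f (rep_character G m \<sigma> g)" for g
  proof (cases "g \<in> carrier G")
    case True
    have "of_nat (card S) * f (rep_character G m \<sigma> g) =
        (\<Sum>x\<in>carrier G. f (rep_character (G\<lparr>carrier := S\<rparr>) n \<rho> (inv\<^bsub>G\<^esub> x \<otimes>\<^bsub>G\<^esub> g \<otimes>\<^bsub>G\<^esub> x)))"
      using arg_cong[OF s(2)[OF True], of f] unfolding f(2) fn fsum .
    then show ?thesis using True cS by (simp add: Ind_def field_simps)
  qed (simp add: Ind_def rep_character_def f0)
  then show thesis by (intro that[OF s(1)]) auto
qed

text \<open>One proof for \<open>R_Q\<close>, with rational matrices and \<open>of_rat\<close>, and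
  for \<open>virtual_characters\<close>, with complex matrices and the identity.\<close>

lemma mackey_closed_generate:
  fixes f :: "'k :: field_char_0 \<Rightarrow> complex"
  assumes f: "\<And>x y. f (x + y) = f x + f y" "\<And>x y. f (x * y) = f x * f y" "f 1 = 1"
  shows "mackey_closed (\<lambda>G. generate (class_functions G)
     {(\<lambda>g. f (rep_character G n \<rho> g)) | n (\<rho> :: 'a \<Rightarrow> 'k mat). \<rho> \<in> matrix_reps G n})"
proof -
  define K :: "'a monoid \<Rightarrow> ('a \<Rightarrow> complex) set"
    where "K G = {(\<lambda>g. f (rep_character G n \<rho> g)) | n (\<rho> :: 'a \<Rightarrow> 'k mat). \<rho> \<in> matrix_reps G n}" for G
  have f0: "f 0 = 0" using f(1)[of 0 0] by simp
  have K: "K G \<subseteq> carrier (class_functions G)" if "group G" for G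
  proof
    fix \<chi> assume "\<chi> \<in> K G"
    then obtain n and \<rho> :: "'a \<Rightarrow> 'k mat" where \<rho>: "\<chi> = (\<lambda>g. f (rep_character G n \<rho> g))" "\<rho> \<in> matrix_reps G n"
      unfolding K_def by blast
    show "\<chi> \<in> carrier (class_functions G)"
      unfolding carrier_class_functions \<rho>(1) using rep_character_class_function[OF that \<rho>(2)] f0 by simp
  qed
  have sub: "subgroup (generate (class_functions G) (K G)) (class_functions G)" if "group G" for G
    by (rule group.generate_is_subgroup[OF group_class_functions K[OF that]])
  show ?thesis
    unfolding mackey_closed_def K_def[symmetric]
  proof (intro allI impI conjI ballI)
    fix G :: "'a monoid" assume "group G \<and> finite (carrier G)"
    then have G: "group G" "finite (carrier G)" by auto
    show "subgroup (generate (class_functions G) (K G)) (class_functions G)" by (rule sub[OF G(1)])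
    fix T assume T: "subgroup T G"
    have GT: "group (G\<lparr>carrier := T\<rparr>)" by (rule subgroup.subgroup_is_group[OF T G(1)])
    have "Res T ` generate (class_functions G) (K G) \<subseteq> generate (class_functions (G\<lparr>carrier := T\<rparr>)) (K (G\<lparr>carrier := T\<rparr>))"
    proof (rule hom_generate_subset[OF group_class_functions group_class_functions Res_hom[OF G(1) T] K[OF G(1)] sub[OF GT]], clarify)
      fix \<chi> assume "\<chi> \<in> K G"
      then obtain n and \<rho> :: "'a \<Rightarrow> 'k mat" where \<rho>: "\<chi> = (\<lambda>g. f (rep_character G n \<rho> g))" "\<rho> \<in> matrix_reps G n"
        unfolding K_def by blast
      have "Res T \<chi> = (\<lambda>g. f (rep_character (G\<lparr>carrier := T\<rparr>) n \<rho> g))"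
        unfolding \<rho>(1) using subgroup.mem_carrier[OF T] f0 by (auto simp: Res_def rep_character_def fun_eq_iff)
      then have "Res T \<chi> \<in> K (G\<lparr>carrier := T\<rparr>)"
        unfolding K_def using matrix_reps_restrict[OF T \<rho>(2)] by blast
      then show "Res T \<chi> \<in> generate (class_functions (G\<lparr>carrier := T\<rparr>)) (K (G\<lparr>carrier := T\<rparr>))"
        by (rule generate.incl)
    qed
    then show "Res T \<chi> \<in> generate (class_functions (G\<lparr>carrier := T\<rparr>)) (K (G\<lparr>carrier := T\<rparr>))"
      if "\<chi> \<in> generate (class_functions G) (K G)" for \<chi> using that by blast
    have "Ind G T ` generate (class_functions (G\<lparr>carrier := T\<rparr>)) (K (G\<lparr>carrier := T\<rparr>)) \<subseteq> generate (class_functions G) (K G)"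
    proof (rule hom_generate_subset[OF group_class_functions group_class_functions Ind_hom[OF G(1)] K[OF GT] sub[OF G(1)]])
      show "monoid.mult (class_functions (G\<lparr>carrier := T\<rparr>)) = (\<lambda>f f' g. f g + f' g)"
        by (simp add: class_functions_def)
      show "Ind G T ` K (G\<lparr>carrier := T\<rparr>) \<subseteq> generate (class_functions G) (K G)"
      proof clarify
        fix \<chi> assume "\<chi> \<in> K (G\<lparr>carrier := T\<rparr>)"
        then obtain n and \<rho> :: "'a \<Rightarrow> 'k mat" where \<rho>: "\<chi> = (\<lambda>g. f (rep_character (G\<lparr>carrier := T\<rparr>) n \<rho> g))"
          "\<rho> \<in> matrix_reps (G\<lparr>carrier := T\<rparr>) n"
          unfolding K_def by blast
        obtain m and \<sigma> :: "'a \<Rightarrow> 'k mat" where "\<sigma> \<in> matrix_reps G m" "Ind G T \<chi> = (\<lambda>g. f (rep_character G m \<sigma> g))"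
          by (rule Ind_rep_character[OF G T \<rho>(2) f, folded \<rho>(1)]) (rule that)
        then have "Ind G T \<chi> \<in> K G" unfolding K_def by blast
        then show "Ind G T \<chi> \<in> generate (class_functions G) (K G)" by (rule generate.incl)
      qed
    qed
    then show "Ind G T \<chi> \<in> generate (class_functions G) (K G)"
      if "\<chi> \<in> generate (class_functions (G\<lparr>carrier := T\<rparr>)) (K (G\<lparr>carrier := T\<rparr>))" for \<chi> using that by blast
  qed
qed

lemma mackey_closed_R_Q: "mackey_closed R_Q"
  unfolding R_Q_def[abs_def] by (rule mackey_closed_generate) (auto simp: of_rat_add of_rat_mult)

lemma mackey_closed_virtual_characters: "mackey_closed virtual_characters"
  unfolding virtual_characters_def[abs_def] by (rule mackey_closed_generate[where f = "\<lambda>x. x"]) auto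

lemma rational_valued_subgroup:
  "subgroup {\<chi> \<in> carrier (class_functions G). \<forall>g\<in>carrier G. \<chi> g \<in> \<rat>} (class_functions G)"
proof (rule group.subgroupI[OF group_class_functions])
  interpret group "class_functions G" by (rule group_class_functions)
  let ?K = "{\<chi> \<in> carrier (class_functions G). \<forall>g\<in>carrier G. \<chi> g \<in> \<rat>}"
  show "?K \<noteq> {}" using one_closed by auto
  fix a assume a: "a \<in> ?K"
  then show "inv\<^bsub>class_functions G\<^esub> a \<in> ?K" using inv_closed[of a] inv_class_functions[of a G] by auto
  fix b assume b: "b \<in> ?K"
  show "a \<otimes>\<^bsub>class_functions G\<^esub> b \<in> ?K" using a b m_closed[of a b] by auto
qed auto

lemma mackey_closed_Char_Q: "mackey_closed Char_Q"
  unfolding mackey_closed_def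
proof (intro allI impI conjI ballI)
  fix G :: "'a monoid" assume "group G \<and> finite (carrier G)"
  then have G: "group G" "finite (carrier G)" by auto
  note V = mackey_closedD[OF mackey_closed_virtual_characters G]
  have "Char_Q G = virtual_characters G \<inter> {\<chi> \<in> carrier (class_functions G). \<forall>g\<in>carrier G. \<chi> g \<in> \<rat>}"
    using subgroup.subset[OF V(1)] unfolding Char_Q_def by blast
  then show "subgroup (Char_Q G) (class_functions G)"
    using group.subgroups_Inter_pair[OF group_class_functions V(1) rational_valued_subgroup] by simp
  fix T assume T: "subgroup T G"
  interpret T: subgroup T G by (rule T)
  interpret G: group G by (rule G)
  show "Res T \<chi> \<in> Char_Q (G\<lparr>carrier := T\<rparr>)" if "\<chi> \<in> Char_Q G" for \<chi>
    using that V(2)[OF T] T.mem_carrier by (auto simp: Char_Q_def Res_def)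
  show "Ind G T \<chi> \<in> Char_Q G" if \<chi>: "\<chi> \<in> Char_Q (G\<lparr>carrier := T\<rparr>)" for \<chi>
  proof -
    have GT: "group (G\<lparr>carrier := T\<rparr>)" "finite (carrier (G\<lparr>carrier := T\<rparr>))"
      using T.subgroup_is_group[OF G(1)] finite_subset[OF T.subset G(2)] by auto
    \<comment> \<open>\<open>Ind\<close> also evaluates \<chi> at conjugates outside T, where its
      value is 0; hence rationality at every argument.\<close>
    have "\<chi> g \<in> \<rat>" for g
    proof (cases "g \<in> T")
      case False
      have "\<chi> \<in> carrier (class_functions (G\<lparr>carrier := T\<rparr>))"
        using \<chi> subgroup.mem_carrier[OF mackey_closedD(1)[OF mackey_closed_virtual_characters GT]] by (auto simp: Char_Q_def)
      then show ?thesis using False class_function_outside by fastforce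
    qed (use \<chi> in \<open>auto simp: Char_Q_def\<close>)
    then have "Ind G T \<chi> g \<in> \<rat>" for g by (auto simp: Ind_def intro!: Rats_divide Rats_sum)
    then show ?thesis using V(3)[OF T] \<chi> by (auto simp: Char_Q_def)
  qed
qed

lemma trivial_character_in_R_Q:
  assumes "group G" shows "Res (carrier G) (\<lambda>_. 1) \<in> R_Q G"
proof -
  have "(\<lambda>g. 1\<^sub>m 1 :: rat mat) \<in> matrix_reps G 1" unfolding matrix_reps_iff[OF assms] by simp
  moreover have "Res (carrier G) (\<lambda>_. 1) = (\<lambda>g. of_rat (rep_character G 1 (\<lambda>g. 1\<^sub>m 1 :: rat mat) g))"
    by (auto simp: Res_def rep_character_def fun_eq_iff)
  ultimately show ?thesis unfolding R_Q_def by (intro generate.incl) blast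
qed

lemma Perm_subset_R_Q:
  fixes G :: "'a monoid"
  assumes G: "group G" "finite (carrier G)" shows "Perm G \<subseteq> R_Q G"
  unfolding Perm_def
proof (rule group.generate_subgroup_incl[OF group_class_functions _ mackey_closedD(1)[OF mackey_closed_R_Q G]], clarify)
  fix H assume H: "subgroup H G"
  have "Res H (\<lambda>_. 1) \<in> R_Q (G\<lparr>carrier := H\<rparr>)"
    using trivial_character_in_R_Q[OF subgroup.subgroup_is_group[OF H G(1)]] by simp
  then show "perm_character G H \<in> R_Q G"
    unfolding perm_character_eq_Ind[OF G H] using mackey_closedD(3)[OF mackey_closed_R_Q G H] by simp
qed

lemma R_Q_subset_Char_Q:
  fixes G :: "'a monoid"
  assumes G: "group G" "finite (carrier G)" shows "R_Q G \<subseteq> Char_Q G"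
  unfolding R_Q_def
proof (rule group.generate_subgroup_incl[OF group_class_functions _ mackey_closedD(1)[OF mackey_closed_Char_Q G]], clarify)
  fix n and \<rho> :: "'a \<Rightarrow> rat mat" assume \<rho>: "\<rho> \<in> matrix_reps G n"
  note r = \<rho>[unfolded matrix_reps_iff[OF G(1)]]
  have "(\<lambda>g. map_mat (of_rat :: rat \<Rightarrow> complex) (\<rho> g)) \<in> matrix_reps G n"
    unfolding matrix_reps_iff[OF G(1)]
  proof (intro conjI ballI)
    fix g h assume "g \<in> carrier G" "h \<in> carrier G"
    then show "map_mat of_rat (\<rho> (g \<otimes>\<^bsub>G\<^esub> h)) = (map_mat of_rat (\<rho> g) :: complex mat) * map_mat of_rat (\<rho> h)"
      using r of_rat_hom.mat_hom_mult by metis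
  qed (use r of_rat_hom.mat_hom_one in auto)
  moreover have "(\<lambda>g. of_rat (rep_character G n \<rho> g)) = rep_character G n (\<lambda>g. map_mat (of_rat :: rat \<Rightarrow> complex) (\<rho> g))"
  proof
    fix g
    show "of_rat (rep_character G n \<rho> g) = rep_character G n (\<lambda>g. map_mat (of_rat :: rat \<Rightarrow> complex) (\<rho> g)) g"
      using r by (auto simp: rep_character_def of_rat_sum intro!: sum.cong)
  qed
  ultimately have "(\<lambda>g. of_rat (rep_character G n \<rho> g)) \<in> virtual_characters G"
    unfolding virtual_characters_def by (intro generate.incl) auto
  then show "(\<lambda>g. of_rat (rep_character G n \<rho> g)) \<in> Char_Q G" by (simp add: Char_Q_def)
qed

subsection \<open>Solomon's induction theorem\<close>

text \<open>Since p is prime, the orbit of a moved point has exactly p elements; removing it lowers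
  |X| by p and leaves the fixed points alone.\<close>

lemma card_fixed_points_cong_prime:
  assumes p: "prime p" and "finite X" "f ` X \<subseteq> X" "\<And>x. x \<in> X \<Longrightarrow> (f ^^ p) x = x"
  shows "[card {x \<in> X. f x = x} = card X] (mod p)"
  using assms(2-4)
proof (induction "card X" arbitrary: X rule: less_induct)
  case less
  show ?case
  proof (cases "\<forall>x\<in>X. f x = x")
    case True
    then have "{x \<in> X. f x = x} = X" by blast
    then show ?thesis by simp
  next
    case False
    then obtain x where x: "x \<in> X" "f x \<noteq> x" by blast
    define orb where "orb = (\<lambda>i. (f ^^ i) x) ` {..<p}"
    have p1: "p > 1" using prime_gt_1_nat[OF p] .
    have fp: "(f ^^ p) x = x" using less.prems(3) x by blast
    have fX: "(f ^^ i) x \<in> X" for i using less.prems(2) x by (induction i) auto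
    have mod: "(f ^^ i) x = (f ^^ (i mod p)) x" for i by (rule funpow_mod_eq[OF fp, symmetric])
    \<comment> \<open>A period a with 0 < a < p has an inverse s modulo p, and then x = f^(a s) x =
      f x, although x is moved.\<close>
    have no: "(f ^^ a) x \<noteq> x" if "0 < a" "a < p" for a
    proof
      assume a: "(f ^^ a) x = x"
      have "coprime a p" using p that by (metis coprime_commute nat_dvd_not_less prime_imp_coprime_nat)
      then obtain s where s: "[a * s = 1] (mod p)" using cong_solve_coprime_nat by auto
      have "(f ^^ (a * s)) x = x"
        using funpow_mod_eq[OF a, of "a * s"] by simp
      moreover have "(f ^^ (a * s)) x = (f ^^ 1) x"
        using mod[of "a * s"] mod[of 1] s by (simp add: cong_def)
      ultimately show False using x by simp
    qed
    have inj: "inj_on (\<lambda>i. (f ^^ i) x) {..<p}"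
    proof (rule linorder_inj_onI)
      fix i j assume ij: "i < j" "i \<in> {..<p}" "j \<in> {..<p}"
      show "(f ^^ i) x \<noteq> (f ^^ j) x"
      proof
        assume eq: "(f ^^ i) x = (f ^^ j) x"
        \<comment> \<open>The inverse of f^i on the cycle is p - i further steps.\<close>
        have "x = (f ^^ (p - i + i)) x" using ij fp by simp
        also have "\<dots> = (f ^^ (p - i)) ((f ^^ j) x)" unfolding funpow_add o_apply eq ..
        also have "\<dots> = (f ^^ (p - i + j)) x" by (simp add: funpow_add)
        also have "\<dots> = (f ^^ ((p - i + j) mod p)) x" by (rule mod)
        also have "(p - i + j) mod p = j - i"
        proof -
          have "p - i + j = p + (j - i)" using ij by simp
          then have "(p - i + j) mod p = (p + (j - i)) mod p" by (rule arg_cong)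
          then show ?thesis unfolding mod_add_self1 using ij by simp
        qed
        finally have "x = (f ^^ (j - i)) x" .
        moreover have "0 < j - i" "j - i < p" using ij by auto
        ultimately show False using no[of "j - i"] by metis
      qed
    qed auto
    have orb: "(f ^^ i) x \<in> orb" for i unfolding orb_def mod[of i] using p1 by auto
    have cO: "card orb = p" unfolding orb_def using card_image[OF inj] by simp
    have sub: "orb \<subseteq> X" unfolding orb_def using fX by blast
    have closed: "f y \<in> X - orb" if y: "y \<in> X - orb" for y
    proof -
      have "y \<in> orb" if fy: "f y \<in> orb"
      proof -
        obtain i where i: "f y = (f ^^ i) x" using fy unfolding orb_def by auto
        have "y = (f ^^ Suc (p - 1)) y" using less.prems(3)[of y] y p1 by simp
        also have "\<dots> = (f ^^ (p - 1)) (f y)" by (simp only: funpow_Suc_right o_apply)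
        also have "\<dots> = (f ^^ (p - 1 + i)) x" unfolding i funpow_add o_apply ..
        finally show ?thesis using orb by metis
      qed
      then show ?thesis using y less.prems(2) by blast
    qed
    have nofix: "f y \<noteq> y" if y: "y \<in> orb" for y
    proof
      assume fy: "f y = y"
      obtain i where i: "i < p" "y = (f ^^ i) x" using y unfolding orb_def by auto
      have "x = (f ^^ (p - i + i)) x" using i fp by simp
      also have "\<dots> = (f ^^ (p - i)) y" unfolding funpow_add o_apply i(2)[symmetric] ..
      finally have xy: "x = (f ^^ (p - i)) y" .
      have "f x = (f ^^ (p - i)) (f y)" unfolding xy by (rule funpow_swap1)
      then show False using x(2) fy xy by simp
    qed
    have "card (X - orb) < card X"
      using x sub orb[of 0] less.prems(1) by (intro psubset_card_mono) auto
    then have "[card {x \<in> X - orb. f x = x} = card (X - orb)] (mod p)"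
      using less.prems closed by (intro less.hyps) auto
    moreover have "{x \<in> X - orb. f x = x} = {x \<in> X. f x = x}" using nofix by blast
    moreover have "card X = card (X - orb) + p"
      using cO sub less.prems(1) card_mono[OF less.prems(1) sub] by (simp add: card_Diff_subset finite_subset)
    ultimately show ?thesis by (simp add: cong_def)
  qed
qed

text \<open>Two stages: f^(p^a) has p-th power 1 on X, and f has p^a-th power 1 on the fixed points
  of f^(p^a), among which are all fixed points of f.\<close>

lemma card_fixed_points_cong:
  assumes p: "prime p" and "finite X" "f ` X \<subseteq> X" "\<And>x. x \<in> X \<Longrightarrow> (f ^^ (p ^ a)) x = x"
  shows "[card {x \<in> X. f x = x} = card X] (mod p)"
  using assms(2-4)
proof (induction a arbitrary: X)
  case 0
  then have "{x \<in> X. f x = x} = X" by auto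
  then show ?case by simp
next
  case (Suc a)
  let ?g = "f ^^ (p ^ a)"
  let ?Y = "{x \<in> X. ?g x = x}"
  have fX: "(f ^^ i) x \<in> X" if "x \<in> X" for i x using Suc.prems(2) that by (induction i) auto
  have "?g ` X \<subseteq> X" using fX by blast
  moreover have "(?g ^^ p) x = x" if "x \<in> X" for x
    using Suc.prems(3)[OF that] by (simp add: funpow_mult mult.commute)
  ultimately have 1: "[card ?Y = card X] (mod p)"
    using card_fixed_points_cong_prime[OF p Suc.prems(1)] by blast
  have "f ` ?Y \<subseteq> ?Y" using Suc.prems(2) by (auto simp: funpow_swap1[symmetric])
  then have 2: "[card {x \<in> ?Y. f x = x} = card ?Y] (mod p)"
    using Suc.prems(1) by (intro Suc.IH) auto
  have "{x \<in> ?Y. f x = x} = {x \<in> X. f x = x}"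
  proof -
    have "(f ^^ i) x = x" if "f x = x" for x i using that by (induction i) auto
    then show ?thesis by blast
  qed
  then show ?case using cong_trans[OF 2 1] by simp
qed

text \<open>As u normalizes C, the factors u can be moved to the right past elements of C.\<close>

lemma (in group) pow_in_normal_factor:
  assumes C: "subgroup C G" and c: "c \<in> C" and u: "u \<in> carrier G" and n: "\<And>c. c \<in> C \<Longrightarrow> u \<otimes> c \<otimes> inv u \<in> C"
  shows "\<exists>d\<in>C. (c \<otimes> u) [^] (k::nat) = d \<otimes> u [^] k"
proof (induction k)
  case 0
  show ?case using subgroup.one_closed[OF C] by (intro bexI[of _ \<one>]) auto
next
  case (Suc k)
  then obtain d where d: "d \<in> C" "(c \<otimes> u) [^] k = d \<otimes> u [^] k" by blast
  interpret C: subgroup C G by (rule C)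
  have "(c \<otimes> u) [^] Suc k = (c \<otimes> u) \<otimes> (d \<otimes> u [^] k)"
    using c u d by (subst nat_pow_Suc2) auto
  also have "\<dots> = (c \<otimes> (u \<otimes> d \<otimes> inv u)) \<otimes> (u \<otimes> u [^] k)"
    using c u d by (simp add: m_assoc mult_inv_cancel)
  also have "u \<otimes> u [^] k = u [^] Suc k" using u by (simp only: nat_pow_Suc2)
  finally show ?case using c n[OF d(1)] by blast
qed

lemma (in group) pow_card_subgroup:
  assumes "subgroup S G" "x \<in> S" shows "x [^] card S = \<one>"
  using group.pow_order_eq_1[OF subgroup_imp_group[OF assms(1)], of x] assms(2) nat_pow_consistent[of x "card S" S]
  by (simp add: Coset.order_def)

text \<open>The power of h with exponent |P| has trivial P-part, so it lies in C; and h is a power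
  of it, because |P| is invertible modulo the order of h.\<close>

lemma (in group) coprime_order_in_normal_factor:
  assumes C: "subgroup C G" and P: "subgroup P G" "finite P" and n: "\<And>u c. u \<in> P \<Longrightarrow> c \<in> C \<Longrightarrow> u \<otimes> c \<otimes> inv u \<in> C"
    and h: "h \<in> C <#> P" "h [^] (m::nat) = \<one>" "coprime m (card P)"
  shows "h \<in> C"
proof -
  interpret C: subgroup C G by (rule C)
  interpret P: subgroup P G by (rule P)
  obtain c u where cu: "c \<in> C" "u \<in> P" "h = c \<otimes> u" using h(1) unfolding set_mult_def by blast
  have hG: "h \<in> carrier G" using cu by auto
  obtain d where d: "d \<in> C" "h [^] card P = d \<otimes> u [^] card P"
    using pow_in_normal_factor[OF C cu(1) P.mem_carrier[OF cu(2)] n[OF cu(2)]] cu(3) by blast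
  have "u [^] card P = \<one>" by (rule pow_card_subgroup[OF P(1) cu(2)])
  then have hP: "h [^] card P \<in> C" using d by auto
  obtain s where s: "[card P * s = 1] (mod m)" using cong_solve_coprime_nat[of "card P" m] h(3) by (auto simp: coprime_commute)
  have "h [^] (card P * s) = h [^] (1::nat)"
  proof -
    have "ord h dvd m" using h(2) hG pow_eq_id by blast
    then have "[card P * s = 1] (mod ord h)" using s cong_dvd_modulus_nat by blast
    then have "[int (card P * s) = int 1] (mod int (ord h))" by (simp only: cong_int_iff)
    then have "int (ord h) dvd int 1 - int (card P * s)" using cong_iff_dvd_diff cong_sym by blast
    then show ?thesis using int_pow_eq[OF hG, of "int (card P * s)" "int 1"] unfolding int_pow_int by simp
  qed
  moreover have "h [^] (card P * s) = (h [^] card P) [^] s" using hG by (simp add: nat_pow_pow)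
  moreover have "(h [^] card P) [^] s \<in> C" using hP by (induction s) auto
  ultimately show ?thesis using hG by simp
qed

lemma (in group) cyclic_group_subgroup_iff:
  assumes "subgroup C G"
  shows "cyclic_group (G\<lparr>carrier := C\<rparr>) \<longleftrightarrow> (\<exists>x\<in>C. C = range (\<lambda>n::int. x [^] n))"
  using group.cyclic_group[OF subgroup_imp_group[OF assms]] int_pow_consistent[OF assms] by (auto cong: image_cong_simp)

lemma prime_power_factorization:
  fixes n p :: nat
  assumes "n \<noteq> 0" "prime p"
  obtains a m where "n = p ^ a * m" "\<not> p dvd m"
proof (rule multiplicity_decompose'[of n p])
  show "\<not> is_unit p" using assms(2) by auto
qed (use assms that in auto)

text \<open>The subgroup \<open>H = C P\<close>, where \<open>C\<close> is generated by the \<open>p\<close>-regular part of \<open>x\<close> and \<open>P\<close> is a Sylow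
  subgroup of the normalizer \<open>N\<close> of \<open>C\<close>. Fixed points of \<open>x\<close> on \<open>G/H\<close> lie in \<open>N/H\<close>, on which \<open>x\<close> acts
  through a \<open>p\<close>-group; so their number is \<open>[N : H]\<close> modulo \<open>p\<close>.\<close>

lemma quasi_elementary_subgroup_exists:
  fixes G :: "('a, 'b) monoid_scheme" (structure)
  assumes G: "group G" "finite (carrier G)" and p: "prime p" and x: "x \<in> carrier G"
  obtains H where "subgroup H G" "p_quasi_elementary p (G\<lparr>carrier := H\<rparr>)"
    "\<not> p dvd card {X \<in> lcosets H. x <# X = X}"
proof -
  interpret group G by fact
  have p0: "p > 0" "p \<noteq> 1" "p \<noteq> 0" using prime_gt_0_nat[OF p] p by auto
  have ordx: "ord x \<noteq> 0" using ord_ge_1[OF G(2) x] by simp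
  obtain a m where am: "ord x = p ^ a * m" "\<not> p dvd m"
    by (rule prime_power_factorization[OF ordx p])
  \<comment> \<open>This power generates the same subgroup as the p-regular part of x, and its order
    is the p-free part m of the order of x.\<close>
  define c where "c = x [^] (p ^ a)"
  have c: "c \<in> carrier G" using x by (simp add: c_def)
  have ordc: "ord c = m" unfolding c_def using ord_pow[OF x, of "p ^ a"] am p0 by simp
  define C where "C = generate G {c}"
  have C: "subgroup C G" unfolding C_def using c by (intro generate_is_subgroup) simp
  interpret C: subgroup C G by (rule C)
  have cC: "c \<in> C" unfolding C_def by (rule generate.incl) simp
  have cardC: "card C = m" unfolding C_def using generate_pow_card[OF c] ordc by simp
  have finC: "finite C" by (rule finite_subset[OF C.subset G(2)])
  have coprime_m: "coprime m p" using am(2) p by (metis coprime_commute prime_imp_coprime_nat)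
  have Crange: "C = range (\<lambda>n::int. c [^] n)" unfolding C_def using generate_pow[OF c] by auto
  have powm: "z [^] m = \<one>" if zC: "z \<in> C" for z
  proof -
    obtain n :: int where n: "z = c [^] n" using zC unfolding Crange by blast
    have "z [^] int m = c [^] (n * int m)" unfolding n by (rule int_pow_pow[OF c])
    also have "\<dots> = \<one>" using int_pow_eq_id[OF c, of "n * int m"] ordc by simp
    finally show ?thesis by (simp only: int_pow_int)
  qed
  \<comment> \<open>One inclusion defines the normalizer: C is finite, so an injective map of C into
    itself is onto.\<close>
  define N where "N = {y \<in> carrier G. \<forall>c\<in>C. y \<otimes> c \<otimes> inv y \<in> C}"
  have Ninv: "inv y \<otimes> d \<otimes> y \<in> C" if y: "y \<in> N" and d: "d \<in> C" for y d
  proof -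
    have yG: "y \<in> carrier G" using y by (simp add: N_def)
    have "inj_on (\<lambda>c. y \<otimes> c \<otimes> inv y) C" using yG by (intro inj_onI) (auto dest: C.mem_carrier)
    moreover have "(\<lambda>c. y \<otimes> c \<otimes> inv y) ` C \<subseteq> C" using y by (auto simp: N_def)
    ultimately have "(\<lambda>c. y \<otimes> c \<otimes> inv y) ` C = C" using endo_inj_surj[OF finC] by blast
    then obtain e where e: "e \<in> C" "d = y \<otimes> e \<otimes> inv y" using d by blast
    have "inv y \<otimes> d \<otimes> y = e" unfolding e(2) using yG C.mem_carrier[OF e(1)] by (simp add: m_assoc mult_inv_cancel)
    then show ?thesis using e by simp
  qed
  have N: "subgroup N G"
  proof (rule subgroupI)
    show "N \<noteq> {}" unfolding N_def using C.mem_carrier by (auto intro!: exI[of _ \<one>])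
    show "inv y \<in> N" if "y \<in> N" for y
      using Ninv[OF that] that unfolding N_def by simp
    show "y \<otimes> z \<in> N" if "y \<in> N" "z \<in> N" for y z
    proof -
      have yz: "y \<in> carrier G" "z \<in> carrier G" using that by (auto simp: N_def)
      have "(y \<otimes> z) \<otimes> d \<otimes> inv (y \<otimes> z) \<in> C" if d: "d \<in> C" for d
      proof -
        have "(y \<otimes> z) \<otimes> d \<otimes> inv (y \<otimes> z) = y \<otimes> (z \<otimes> d \<otimes> inv z) \<otimes> inv y"
          using yz C.mem_carrier[OF d] by (simp add: inv_mult_group m_assoc)
        moreover have "z \<otimes> d \<otimes> inv z \<in> C" using \<open>z \<in> N\<close> d by (simp add: N_def)
        ultimately show ?thesis using \<open>y \<in> N\<close> by (simp add: N_def)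
      qed
      then show ?thesis using yz by (simp add: N_def)
    qed
  qed (auto simp: N_def)
  interpret N: subgroup N G by (rule N)
  \<comment> \<open>Conjugation by y is a homomorphism, so it is enough that it sends the generator
    c into C.\<close>
  have NI: "y \<in> N" if y: "y \<in> carrier G" and yc: "y \<otimes> c \<otimes> inv y \<in> C" for y
  proof -
    have "y \<otimes> c [^] n \<otimes> inv y = (y \<otimes> c \<otimes> inv y) [^] n" for n :: int
    proof -
      have hom: "(\<lambda>z. y \<otimes> z \<otimes> inv y) \<in> hom G G"
        using y by (intro homI) (auto simp: m_assoc mult_inv_cancel)
      interpret h: group_hom G G "\<lambda>z. y \<otimes> z \<otimes> inv y" using hom by unfold_locales
      show ?thesis by (rule h.hom_int_pow[OF c])
    qed
    then show ?thesis using y subgroup_int_pow_closed[OF C yc] unfolding N_def Crange by auto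
  qed
  have CN: "C \<subseteq> N" unfolding N_def using C.mem_carrier by auto
  have GN: "group (G\<lparr>carrier := N\<rparr>)" by (rule subgroup_imp_group[OF N])
  have finN: "finite N" by (rule finite_subset[OF N.subset G(2)])
  have cardN0: "card N \<noteq> 0" using N.finite_imp_card_positive[OF G(2)] by simp
  obtain b l where bl: "card N = p ^ b * l" "\<not> p dvd l"
    by (rule prime_power_factorization[OF cardN0 p])
  obtain P where P: "subgroup P (G\<lparr>carrier := N\<rparr>)" "card P = p ^ b"
    using sylow_thm[OF p GN, of b l] bl(1) finN by (auto simp: Coset.order_def)
  have PG: "subgroup P G" by (rule incl_subgroup[OF N P(1)])
  interpret P: subgroup P G by (rule PG)
  have PN: "P \<subseteq> N" using subgroup.subset[OF P(1)] by simp
  have finP: "finite P" by (rule finite_subset[OF P.subset G(2)])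
  have conjP: "u \<otimes> d \<otimes> inv u \<in> C" if "u \<in> P" "d \<in> C" for u d
    using subsetD[OF PN that(1)] that(2) unfolding N_def by blast
  define H where "H = C <#> P"
  have HI: "d \<otimes> u \<in> H" if "d \<in> C" "u \<in> P" for d u using that unfolding H_def set_mult_def by blast
  have HE: "\<exists>d\<in>C. \<exists>u\<in>P. h = d \<otimes> u" if "h \<in> H" for h using that unfolding H_def set_mult_def by blast
  have H: "subgroup H G"
  proof (rule subgroupI)
    show "H \<subseteq> carrier G" unfolding H_def by (rule set_mult_closed[OF C.subset P.subset])
    show "H \<noteq> {}" using HI[OF C.one_closed P.one_closed] by blast
    fix h assume "h \<in> H"
    then obtain d u where du: "d \<in> C" "u \<in> P" "h = d \<otimes> u" using HE by blast
    have "inv h = (inv u \<otimes> inv d \<otimes> inv (inv u)) \<otimes> inv u"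
      using du by (simp add: inv_mult_group m_assoc)
    then show "inv h \<in> H" using conjP[of "inv u" "inv d"] du HI by simp
    fix k assume "k \<in> H"
    then obtain e v where ev: "e \<in> C" "v \<in> P" "k = e \<otimes> v" using HE by blast
    have "h \<otimes> k = (d \<otimes> (u \<otimes> e \<otimes> inv u)) \<otimes> (u \<otimes> v)"
      using du ev by (simp add: m_assoc mult_inv_cancel)
    then show "h \<otimes> k \<in> H" using HI conjP[OF du(2) ev(1)] du ev by simp
  qed
  interpret H: subgroup H G by (rule H)
  have CH: "C \<subseteq> H"
  proof
    fix d assume d: "d \<in> C"
    then show "d \<in> H" using HI[OF d P.one_closed] by simp
  qed
  have PH: "P \<subseteq> H"
  proof
    fix u assume u: "u \<in> P"
    then show "u \<in> H" using HI[OF C.one_closed u] by simp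
  qed
  have HN: "H \<subseteq> N"
  proof
    fix h assume "h \<in> H"
    then obtain d u where "d \<in> C" "u \<in> P" "h = d \<otimes> u" using HE by blast
    then show "h \<in> N" using subsetD[OF CN] subsetD[OF PN] N.m_closed by simp
  qed
  have finH: "finite H" by (rule finite_subset[OF H.subset G(2)])
  have GH: "group (G\<lparr>carrier := H\<rparr>)" by (rule subgroup_imp_group[OF H])
  have cop: "coprime m (card P)" unfolding P(2) using coprime_m by simp
  \<comment> \<open>C contains every element of H of order dividing m. This is what forces a coset
    fixed by x to be represented in N.\<close>
  have inC: "h \<in> C" if "h \<in> H" "h [^] m = \<one>" for h
    by (rule coprime_order_in_normal_factor[OF C PG finP conjP _ that(2) cop]) (use that(1) in \<open>auto simp: H_def\<close>)
  have "p_quasi_elementary p (G\<lparr>carrier := H\<rparr>)"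
    unfolding p_quasi_elementary_def
  proof (intro conjI exI)
    show "group (G\<lparr>carrier := H\<rparr>)" "finite (carrier (G\<lparr>carrier := H\<rparr>))" using GH finH by auto
    show "C \<lhd> G\<lparr>carrier := H\<rparr>"
      unfolding group.normal_inv_iff[OF GH]
    proof (intro conjI ballI)
      show "subgroup C (G\<lparr>carrier := H\<rparr>)" by (rule subgroup_incl[OF C H CH])
      fix h d assume "h \<in> carrier (G\<lparr>carrier := H\<rparr>)" "d \<in> C"
      then have hd: "h \<in> H" "d \<in> C" by simp_all
      then have "h \<otimes> d \<otimes> inv h \<in> C" using subsetD[OF HN hd(1)] unfolding N_def by blast
      then show "h \<otimes>\<^bsub>G\<lparr>carrier := H\<rparr>\<^esub> d \<otimes>\<^bsub>G\<lparr>carrier := H\<rparr>\<^esub> inv\<^bsub>G\<lparr>carrier := H\<rparr>\<^esub> h \<in> C"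
        using m_inv_consistent[OF H hd(1)] by simp
    qed
    show "cyclic_group (G\<lparr>carrier := H, carrier := C\<rparr>)"
      using cyclic_group_subgroup_iff[OF C] cC Crange by (simp, blast)
    show "coprime (card C) p" unfolding cardC by (rule coprime_m)
    show "subgroup P (G\<lparr>carrier := H\<rparr>)" by (rule subgroup_incl[OF PG H PH])
    show "card P = p ^ b" by (rule P(2))
    show "C \<inter> P = {\<one>\<^bsub>G\<lparr>carrier := H\<rparr>\<^esub>}"
    proof -
      have "z = \<one>" if z: "z \<in> C" "z \<in> P" for z
      proof -
        have "z [^] card P = \<one>" by (rule pow_card_subgroup[OF PG z(2)])
        then have "ord z dvd card P" "ord z dvd m" using powm[OF z(1)] pow_eq_id C.mem_carrier[OF z(1)] by auto
        then have "ord z = 1" using cop by (metis coprime_common_divisor_nat)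
        then show ?thesis using ord_eq_1 C.mem_carrier[OF z(1)] by blast
      qed
      then show ?thesis using C.one_closed P.one_closed by auto
    qed
    show "C <#>\<^bsub>G\<lparr>carrier := H\<rparr>\<^esub> P = carrier (G\<lparr>carrier := H\<rparr>)" by (simp add: H_def set_mult_def)
  qed
  moreover have "\<not> p dvd card {X \<in> lcosets H. x <# X = X}"
  proof -
    let ?Y = "lcosets\<^bsub>G\<lparr>carrier := N\<rparr>\<^esub> H"
    have xN: "x \<in> N"
    proof (rule NI[OF x])
      have "x \<otimes> c = c \<otimes> x" unfolding c_def using x by (metis nat_pow_Suc nat_pow_Suc2)
      then have "x \<otimes> c \<otimes> inv x = c" using x c by (simp add: m_assoc)
      then show "x \<otimes> c \<otimes> inv x \<in> C" using cC by simp
    qed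
    have Y: "?Y = (\<lambda>y. y <# H) ` N" unfolding LCOSETS_def l_coset_def by auto
    have HNsub: "subgroup H (G\<lparr>carrier := N\<rparr>)" by (rule subgroup_incl[OF H N HN])
    have fixed_N: "{X \<in> lcosets H. x <# X = X} = {X \<in> ?Y. x <# X = X}"
    proof (intro equalityI subsetI)
      fix X assume "X \<in> {X \<in> ?Y. x <# X = X}"
      then show "X \<in> {X \<in> lcosets H. x <# X = X}" unfolding Y using N.mem_carrier by (auto simp: LCOSETS_def)
    next
      fix X assume "X \<in> {X \<in> lcosets H. x <# X = X}"
      then obtain y where y: "y \<in> carrier G" "X = y <# H" and fx: "x <# X = X" by (auto simp: LCOSETS_def)
      have yX: "y \<in> X" unfolding y(2) by (rule lcos_self[OF y(1) H])
      then have "x \<otimes> y \<in> X" using fx unfolding l_coset_def by blast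
      then have conjH: "inv y \<otimes> (x \<otimes> y) \<in> H" using H.lcos_module_imp[OF G(1) y(1)] y(2) by simp
      let ?z = "inv y \<otimes> x \<otimes> y"
      have zH: "?z \<in> H" using conjH x y by (simp add: m_assoc)
      have hom: "(\<lambda>z. inv y \<otimes> z \<otimes> y) \<in> hom G G"
        using y by (intro homI) (auto simp: m_assoc mult_inv_cancel)
      interpret h: group_hom G G "\<lambda>z. inv y \<otimes> z \<otimes> y" using hom by unfold_locales
      \<comment> \<open>y^-1 c y is a power of y^-1 x y, hence in H, and its order divides m. So it
        lies in C, and y normalizes C.\<close>
      have 1: "inv y \<otimes> c \<otimes> y = ?z [^] (p ^ a)" unfolding c_def by (rule h.hom_nat_pow[OF x])
      have "?z [^] (p ^ a) \<in> H" using subgroup_int_pow_closed[OF H zH, of "int (p ^ a)"] unfolding int_pow_int .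
      moreover have "(inv y \<otimes> c \<otimes> y) [^] m = \<one>"
        using h.hom_nat_pow[OF c, of m] powm[OF cC] y by simp
      ultimately have "inv y \<otimes> c \<otimes> y \<in> C" using inC 1 by metis
      then have "inv y \<in> N" using NI[of "inv y"] y by simp
      then have "y \<in> N" using N.m_inv_closed[of "inv y"] y by simp
      then show "X \<in> {X \<in> ?Y. x <# X = X}" unfolding Y using fx y(2) by blast
    qed
    have finY: "finite ?Y" unfolding Y using finN by simp
    have "[card {X \<in> ?Y. x <# X = X} = card ?Y] (mod p)"
    proof (rule card_fixed_points_cong[OF p finY])
      note act = lcosets_action(3)[OF GN HNsub]
      show "(\<lambda>X. x <# X) ` ?Y \<subseteq> ?Y" using act[of x] xN by (auto simp: l_coset_def)
      fix X assume X: "X \<in> ?Y"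
      then obtain y where y: "y \<in> N" "X = y <# H" unfolding Y by blast
      have yG: "y \<in> carrier G" using y N.mem_carrier by blast
      have "((\<lambda>X. x <# X) ^^ k) X = x [^] k <# X" for k
      proof (induction k)
        case 0
        show ?case using lcos_mult_one[of X] l_coset_subset_G[OF H.subset yG] y(2) by simp
      next
        case (Suc k)
        have "((\<lambda>X. x <# X) ^^ Suc k) X = x <# (x [^] k <# X)" using Suc by simp
        also have "\<dots> = (x \<otimes> x [^] k) <# X"
          using l_coset_subset_G[OF H.subset yG] y(2) x by (intro lcos_m_assoc) auto
        finally show ?case using x by (simp only: nat_pow_Suc2)
      qed
      \<comment> \<open>The p^a-th iterate is translation by c, which fixes yH because y^-1 c y lies
        in C and so in H.\<close>
      then have "((\<lambda>X. x <# X) ^^ (p ^ a)) X = c <# (y <# H)" unfolding c_def y(2) .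
      also have "\<dots> = (c \<otimes> y) <# H" by (rule lcos_m_assoc[OF H.subset c yG])
      also have "c \<otimes> y = y \<otimes> (inv y \<otimes> c \<otimes> y)" using c yG by (simp add: m_assoc mult_inv_cancel)
      also have "(y \<otimes> (inv y \<otimes> c \<otimes> y)) <# H = y <# ((inv y \<otimes> c \<otimes> y) <# H)"
        using c yG by (intro lcos_m_assoc[symmetric] H.subset) auto
      also have "(inv y \<otimes> c \<otimes> y) <# H = H"
      proof -
        have "inv y \<otimes> c \<otimes> y \<in> H" using Ninv[OF y(1) cC] CH by blast
        then show ?thesis using lcosets_action(6)[OF G(1) H] by blast
      qed
      finally show "((\<lambda>X. x <# X) ^^ (p ^ a)) X = X" unfolding y(2) .
    qed
    moreover have "\<not> p dvd card ?Y"
    proof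
      assume "p dvd card ?Y"
      \<comment> \<open>H contains the Sylow subgroup P of order p^b, so a factor p in [N : H] would
        make |N| divisible by p^(b+1).\<close>
      have l1: "card ?Y * card H = card N"
        using group.l_lagrange[OF GN _ HNsub] finN by (simp add: Coset.order_def)
      have "card P dvd card H"
        using group.l_lagrange[OF GH _ subgroup_incl[OF PG H PH]] finH by (simp add: Coset.order_def) (metis dvd_triv_right)
      then have "p * p ^ b dvd card N"
        unfolding l1[symmetric] P(2) using \<open>p dvd card ?Y\<close> by (intro mult_dvd_mono)
      then have "p ^ b * p dvd p ^ b * l" unfolding bl(1) by (simp add: mult.commute)
      then have "p dvd l" using p0 by simp
      then show False using bl(2) by simp
    qed
    ultimately show ?thesis unfolding fixed_N using cong_dvd_iff by blast
  qed
  ultimately show thesis using that H by blast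
qed

text \<open>The functions \<open>\<Sum>\<^sub>S Ind\<^sub>S \<psi>\<^sub>S\<close> form an ideal of \<open>Perm G\<close>. If \<open>v\<close> and \<open>f\<close> belong to it and take the values
  \<open>m\<close> on \<open>X\<close> and \<open>k\<close> at \<open>x\<close>, then \<open>k v + m f - v f\<close> takes the value \<open>k m\<close> on \<open>X \<union> {x}\<close>.\<close>

lemma solomon_induction:
  fixes G :: "'a monoid"
  assumes G: "group G" "finite (carrier G)" and p: "prime p"
    and F: "\<And>Q. Q \<in> F \<Longrightarrow> subgroup Q G"
    and qe: "\<And>H. subgroup H G \<Longrightarrow> p_quasi_elementary p (G\<lparr>carrier := H\<rparr>) \<Longrightarrow>
           \<exists>Q\<in>F. \<exists>g\<in>carrier G. (\<lambda>h. g \<otimes>\<^bsub>G\<^esub> h \<otimes>\<^bsub>G\<^esub> inv\<^bsub>G\<^esub> g) ` H \<subseteq> Q"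
  obtains m :: nat and \<psi> where "coprime m p" "\<And>S. S \<in> F \<Longrightarrow> \<psi> S \<in> Perm (G\<lparr>carrier := S\<rparr>)"
    "\<And>g. g \<in> carrier G \<Longrightarrow> (\<Sum>S\<in>F. Ind G S (\<psi> S) g) = of_nat m"
proof -
  interpret group G by fact
  have finF: "finite F"
    using F subgroup.subset by (intro finite_subset[of F "Pow (carrier G)"]) (auto simp: G(2))
  have GS: "group (G\<lparr>carrier := S\<rparr>)" "finite (carrier (G\<lparr>carrier := S\<rparr>))" if "S \<in> F" for S
    using subgroup_imp_group[OF F[OF that]] finite_subset[OF subgroup.subset[OF F[OF that]] G(2)] by auto
  note PS = Perm_subgroup[OF GS]
  note PG = Perm_subgroup[OF G]
  \<comment> \<open>The witnesses \<open>\<psi>\<close> are part of the predicate because the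
    conclusion has to deliver them, not merely an element of the ideal.\<close>
  define V where "V f \<longleftrightarrow> (\<exists>\<psi>. (\<forall>S\<in>F. \<psi> S \<in> Perm (G\<lparr>carrier := S\<rparr>)) \<and> f = (\<lambda>g. \<Sum>S\<in>F. Ind G S (\<psi> S) g))" for f
  have V_add: "V (\<lambda>g. f g + f' g)" if "V f" "V f'" for f f'
  proof -
    obtain \<psi> \<psi>' where "\<forall>S\<in>F. \<psi> S \<in> Perm (G\<lparr>carrier := S\<rparr>)" "f = (\<lambda>g. \<Sum>S\<in>F. Ind G S (\<psi> S) g)"
      "\<forall>S\<in>F. \<psi>' S \<in> Perm (G\<lparr>carrier := S\<rparr>)" "f' = (\<lambda>g. \<Sum>S\<in>F. Ind G S (\<psi>' S) g)"
      using \<open>V f\<close> \<open>V f'\<close> unfolding V_def by blast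
    then show ?thesis
      unfolding V_def using subgroup_class_functions_add[OF PS]
      by (intro exI[of _ "\<lambda>S g. \<psi> S g + \<psi>' S g"]) (auto simp: Ind_add sum.distrib)
  qed
  have V_mult: "V (\<lambda>g. f g * v g)" if "V f" and v: "v \<in> Perm G" for f v
  proof -
    obtain \<psi> where \<psi>: "\<And>S. S \<in> F \<Longrightarrow> \<psi> S \<in> Perm (G\<lparr>carrier := S\<rparr>)" "f = (\<lambda>g. \<Sum>S\<in>F. Ind G S (\<psi> S) g)"
      using \<open>V f\<close> unfolding V_def by blast
    have vc: "v \<in> carrier (class_functions G)" using v subgroup.mem_carrier[OF PG] by blast
    have "(\<lambda>g. \<psi> S g * Res S v g) \<in> Perm (G\<lparr>carrier := S\<rparr>)" if "S \<in> F" for S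
      by (rule mackey_closed_Perm_mult[OF mackey_closed_Perm GS[OF that] Perm_Res[OF G F[OF that] v] \<psi>(1)[OF that]])
    moreover have "Ind G S (\<lambda>g. \<psi> S g * Res S v g) = (\<lambda>g. Ind G S (\<psi> S) g * v g)" if "S \<in> F" for S
    proof (rule Ind_projection[OF G(1) vc])
      show "\<psi> S g = 0" if "g \<notin> S" for g
        using subgroup.mem_carrier[OF PS \<psi>(1)] class_function_outside \<open>S \<in> F\<close> that by fastforce
    qed
    ultimately show ?thesis
      unfolding V_def \<psi>(2) by (intro exI[of _ "\<lambda>S g. \<psi> S g * Res S v g"]) (auto simp: sum_distrib_right)
  qed
  have V_scale: "V (\<lambda>g. of_int n * f g)" if "V f" for n f
  proof -
    obtain \<psi> where "\<forall>S\<in>F. \<psi> S \<in> Perm (G\<lparr>carrier := S\<rparr>)" "f = (\<lambda>g. \<Sum>S\<in>F. Ind G S (\<psi> S) g)"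
      using \<open>V f\<close> unfolding V_def by blast
    then show ?thesis
      unfolding V_def using subgroup_class_functions_scale[OF PS]
      by (intro exI[of _ "\<lambda>S g. of_int n * \<psi> S g"]) (auto simp: Ind_scale sum_distrib_left)
  qed
  have V_Perm: "f \<in> Perm G" if "V f" for f
    using that Perm_Ind[OF G F] unfolding V_def by (auto intro!: subgroup_class_functions_sum[OF PG])
  have V_x: "\<exists>f k. V f \<and> f x = of_nat k \<and> coprime k p" if x: "x \<in> carrier G" for x
  proof -
    obtain H where H: "subgroup H G" "p_quasi_elementary p (G\<lparr>carrier := H\<rparr>)"
      "\<not> p dvd card {X \<in> lcosets\<^bsub>G\<^esub> H. x <#\<^bsub>G\<^esub> X = X}"
      by (rule quasi_elementary_subgroup_exists[OF G p x])
    obtain Q y where Q: "Q \<in> F" "y \<in> carrier G" "(\<lambda>h. y \<otimes>\<^bsub>G\<^esub> h \<otimes>\<^bsub>G\<^esub> inv\<^bsub>G\<^esub> y) ` H \<subseteq> Q" using qe[OF H(1,2)] by blast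
    define H' where "H' = (\<lambda>h. y \<otimes>\<^bsub>G\<^esub> h \<otimes>\<^bsub>G\<^esub> inv\<^bsub>G\<^esub> y) ` H"
    have hom: "(\<lambda>z. y \<otimes>\<^bsub>G\<^esub> z \<otimes>\<^bsub>G\<^esub> inv\<^bsub>G\<^esub> y) \<in> hom G G"
      using Q(2) by (intro homI) (auto simp: m_assoc mult_inv_cancel)
    then interpret h: group_hom G G "\<lambda>z. y \<otimes>\<^bsub>G\<^esub> z \<otimes>\<^bsub>G\<^esub> inv\<^bsub>G\<^esub> y" by unfold_locales
    have H': "subgroup H' G" unfolding H'_def by (rule h.subgroup_img_is_subgroup[OF H(1)])
    have H'Q: "subgroup H' (G\<lparr>carrier := Q\<rparr>)" by (rule subgroup_incl[OF H' F[OF Q(1)]]) (use Q(3) H'_def in simp)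
    have "perm_character G H = perm_character G H'"
      unfolding perm_character_eq_Ind[OF G H(1)] perm_character_eq_Ind[OF G H']
      by (rule Ind_one_conj[OF G(1) H(1) Q(2) H'_def, symmetric])
    also have "\<dots> = Ind G Q (perm_character (G\<lparr>carrier := Q\<rparr>) H')"
      by (rule Ind_perm_character[OF G F[OF Q(1)] H'Q, symmetric])
    \<comment> \<open>A single induced character is written as a family over \<open>F\<close> that
      is zero away from Q.\<close>
    also have "\<dots> = (\<lambda>g. \<Sum>S\<in>F. Ind G S (if S = Q then perm_character (G\<lparr>carrier := Q\<rparr>) H' else (\<lambda>_. 0)) g)"
    proof
      fix g
      have "(\<Sum>S\<in>F. Ind G S (if S = Q then perm_character (G\<lparr>carrier := Q\<rparr>) H' else (\<lambda>_. 0)) g) =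
        (\<Sum>S\<in>F. if S = Q then Ind G Q (perm_character (G\<lparr>carrier := Q\<rparr>) H') g else 0)"
        by (intro sum.cong refl) (simp add: Ind_zero)
      then show "Ind G Q (perm_character (G\<lparr>carrier := Q\<rparr>) H') g =
        (\<Sum>S\<in>F. Ind G S (if S = Q then perm_character (G\<lparr>carrier := Q\<rparr>) H' else (\<lambda>_. 0)) g)"
        using finF Q(1) by simp
    qed
    finally have "V (perm_character G H)"
      unfolding V_def using perm_character_in_Perm[OF H'Q] subgroup_class_functions_zero[OF PS]
      by (intro exI[of _ "\<lambda>S. if S = Q then perm_character (G\<lparr>carrier := Q\<rparr>) H' else (\<lambda>_. 0)"]) simp
    moreover have "coprime (card {X \<in> lcosets\<^bsub>G\<^esub> H. x <#\<^bsub>G\<^esub> X = X}) p"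
      using H(3) p by (metis coprime_commute prime_imp_coprime_nat)
    ultimately show ?thesis using perm_character_eq_card[OF G H(1) x] by blast
  qed
  have "\<exists>f m. V f \<and> coprime m p \<and> (\<forall>x\<in>X. f x = of_nat m)" if "finite X" "X \<subseteq> carrier G" for X
    using that
  proof (induction X rule: finite_induct)
    case empty
    have "V (\<lambda>_. 0)"
      unfolding V_def using subgroup_class_functions_zero[OF PS] by (intro exI[of _ "\<lambda>S g. 0"]) (auto simp: Ind_zero)
    then show ?case by (intro exI[of _ "\<lambda>_. 0"] exI[of _ 1]) auto
  next
    case (insert x X)
    then obtain v m where v: "V v" "coprime m p" "\<forall>x\<in>X. v x = of_nat m" by auto
    obtain f k where f: "V f" "f x = of_nat k" "coprime k p" using V_x insert.prems by blast
    let ?w = "\<lambda>g. (of_int (int k) * v g + of_int (int m) * f g) + of_int (- 1) * (v g * f g)"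
    have "V ?w" by (intro V_add V_scale V_mult v f V_Perm)
    moreover have "coprime (k * m) p" using v f by simp
    moreover have "\<forall>z\<in>insert x X. ?w z = of_nat (k * m)" using v f by (auto simp: algebra_simps)
    ultimately show ?case by blast
  qed
  then obtain f m where "V f" "coprime m p" "\<forall>x\<in>carrier G. f x = of_nat m" using G(2) by blast
  then show thesis using that unfolding V_def by blast
qed

subsection \<open>Integer combinations of roots of unity\<close>

text \<open>x is an eigenvalue of an integer matrix, hence a root of its monic integral
  characteristic polynomial; the entry at k keeps the eigenvector from being zero.\<close>

lemma algebraic_int_eigenvalue:
  fixes x :: complex and v :: "nat \<Rightarrow> complex" and A :: "nat \<Rightarrow> nat \<Rightarrow> int"
  assumes eig: "\<And>i. i < n \<Longrightarrow> x * v i = (\<Sum>j<n. of_int (A i j) * v j)" and v: "k < n" "v k \<noteq> 0"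
  shows "algebraic_int x"
proof -
  define M where "M = mat n n (\<lambda>(i, j). A i j)"
  have M: "M \<in> carrier_mat n n" by (simp add: M_def)
  then have M': "map_mat complex_of_int M \<in> carrier_mat n n" by simp
  have "vec n v \<noteq> 0\<^sub>v n"
  proof
    assume "vec n v = 0\<^sub>v n"
    then have "vec n v $ k = 0\<^sub>v n $ k" by simp
    then show False using v by simp
  qed
  moreover have "map_mat complex_of_int M *\<^sub>v vec n v = x \<cdot>\<^sub>v vec n v"
    using eig by (intro eq_vecI) (auto simp: M_def scalar_prod_def atLeast0LessThan)
  ultimately have "eigenvalue (map_mat complex_of_int M) x"
    unfolding eigenvalue_def eigenvector_def using M' by (intro exI[of _ "vec n v"]) auto
  then have "poly (char_poly (map_mat complex_of_int M)) x = 0"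
    using eigenvalue_root_char_poly[OF M'] by simp
  then have "poly (map_poly of_int (char_poly M)) x = 0"
    by (simp add: of_int_hom.char_poly_hom[OF M])
  moreover have "lead_coeff (char_poly M) = 1" using degree_monic_char_poly[OF M] by simp
  ultimately show ?thesis unfolding algebraic_int_altdef_ipoly by blast
qed

text \<open>The ring Z[z]. Congruences modulo a prime q will be written as equalities up to q times
  an element of this ring.\<close>

definition int_polys_at :: "complex \<Rightarrow> complex set" where
  "int_polys_at z = range (\<lambda>p :: int poly. poly (map_poly of_int p) z)"

lemma int_polys_at_closed:
  shows int_polys_at_of_int: "of_int a \<in> int_polys_at z"
    and int_polys_at_self: "z \<in> int_polys_at z"
    and int_polys_at_add: "x \<in> int_polys_at z \<Longrightarrow> y \<in> int_polys_at z \<Longrightarrow> x + y \<in> int_polys_at z"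
    and int_polys_at_mult: "x \<in> int_polys_at z \<Longrightarrow> y \<in> int_polys_at z \<Longrightarrow> x * y \<in> int_polys_at z"
proof -
  show "of_int a \<in> int_polys_at z"
    unfolding int_polys_at_def by (rule image_eqI[of _ _ "[:a:]"]) (simp_all add: of_int_hom.map_poly_pCons_hom)
  show "z \<in> int_polys_at z"
    unfolding int_polys_at_def by (rule image_eqI[of _ _ "[:0, 1:]"]) (simp_all add: of_int_hom.map_poly_pCons_hom)
  show "x + y \<in> int_polys_at z" if xy: "x \<in> int_polys_at z" "y \<in> int_polys_at z"
  proof -
    obtain p q :: "int poly" where "x = poly (map_poly of_int p) z" "y = poly (map_poly of_int q) z"
      using xy unfolding int_polys_at_def by blast
    then have "x + y = poly (map_poly of_int (p + q)) z" by (simp add: of_int_poly_hom.hom_add)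
    then show ?thesis unfolding int_polys_at_def by blast
  qed
  show "x * y \<in> int_polys_at z" if xy: "x \<in> int_polys_at z" "y \<in> int_polys_at z"
  proof -
    obtain p q :: "int poly" where "x = poly (map_poly of_int p) z" "y = poly (map_poly of_int q) z"
      using xy unfolding int_polys_at_def by blast
    then have "x * y = poly (map_poly of_int (p * q)) z" by (simp add: of_int_poly_hom.hom_mult)
    then show ?thesis unfolding int_polys_at_def by blast
  qed
qed

lemma int_polys_at_power: "x \<in> int_polys_at z \<Longrightarrow> x ^ k \<in> int_polys_at z"
  using int_polys_at_of_int[of 1 z] by (induction k) (auto intro: int_polys_at_mult)

lemma int_polys_at_sum: "(\<And>i. i \<in> I \<Longrightarrow> f i \<in> int_polys_at z) \<Longrightarrow> sum f I \<in> int_polys_at z"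
  using int_polys_at_of_int[of 0 z] by (induction I rule: infinite_finite_induct) (auto intro: int_polys_at_add)

lemma power_mod_exponent:
  fixes z :: "'b :: monoid_mult"
  assumes "z ^ n = 1" shows "z ^ k = z ^ (k mod n)"
proof -
  have "z ^ k = z ^ (n * (k div n) + k mod n)" by simp
  also have "\<dots> = (z ^ n) ^ (k div n) * z ^ (k mod n)" by (simp only: power_add power_mult)
  finally show ?thesis using assms by simp
qed

text \<open>Multiplication by x sends each of 1, z, ..., z^(n-1) to an integer combination of them,
  since exponents may be reduced modulo n. So x is an algebraic integer, and a rational algebraic
  integer is an integer.\<close>

lemma int_polys_at_rational:
  assumes z: "z ^ n = 1" "n > 0" and x: "x \<in> int_polys_at z" "x \<in> \<rat>"
  shows "x \<in> \<int>"
proof -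
  obtain p :: "int poly" where p: "x = poly (map_poly of_int p) z"
    using x(1) unfolding int_polys_at_def by blast
  note zmod = power_mod_exponent[OF z(1)]
  have px: "x = (\<Sum>l\<le>degree p. of_int (coeff p l) * z ^ l)"
    unfolding p poly_altdef by (simp add: degree_map_poly coeff_map_poly)
  \<comment> \<open>Coefficients of p whose shifted exponents agree modulo n are collected in one
    matrix entry.\<close>
  define A where "A i k = (\<Sum>l\<le>degree p. if (i + l) mod n = k then coeff p l else 0)" for i k
  have "x * z ^ i = (\<Sum>k<n. of_int (A i k) * z ^ k)" for i
  proof -
    have "(\<Sum>k<n. of_int (A i k) * z ^ k) = (\<Sum>k<n. \<Sum>l\<le>degree p. if (i + l) mod n = k then of_int (coeff p l) * z ^ k else 0)"
      by (auto simp: A_def of_int_sum sum_distrib_right intro!: sum.cong)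
    also have "\<dots> = (\<Sum>l\<le>degree p. \<Sum>k<n. if (i + l) mod n = k then of_int (coeff p l) * z ^ k else 0)"
      by (rule sum.swap)
    also have "\<dots> = (\<Sum>l\<le>degree p. of_int (coeff p l) * z ^ ((i + l) mod n))"
      using z(2) by (intro sum.cong refl) (simp add: sum.delta)
    also have "\<dots> = (\<Sum>l\<le>degree p. of_int (coeff p l) * z ^ (i + l))" by (simp only: zmod[of "i + _", symmetric])
    also have "\<dots> = x * z ^ i" unfolding px sum_distrib_right by (intro sum.cong refl) (simp add: power_add algebra_simps)
    finally show ?thesis by simp
  qed
  then have "algebraic_int x"
    by (intro algebraic_int_eigenvalue[of n x "\<lambda>i. z ^ i" A 0]) (use z in auto)
  then show ?thesis using x(2) by (rule rational_algebraic_int_is_int)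
qed

text \<open>The congruence (x + y)^q = x^q + y^q modulo q, iterated over the sum, with the error
  recorded in Z[z].\<close>

lemma int_polys_at_frobenius:
  assumes q: "prime q" and "\<And>i. i \<in> I \<Longrightarrow> f i \<in> int_polys_at z" "finite I"
  shows "\<exists>r\<in>int_polys_at z. (\<Sum>i\<in>I. f i) ^ q = (\<Sum>i\<in>I. f i ^ q) + of_nat q * r"
  using assms(3,2)
proof (induction I rule: finite_induct)
  case empty
  then show ?case using prime_gt_0_nat[OF q] int_polys_at_of_int[of 0 z] by (intro bexI[of _ 0]) auto
next
  case (insert i I)
  then obtain r where r: "r \<in> int_polys_at z" "(\<Sum>i\<in>I. f i) ^ q = (\<Sum>i\<in>I. f i ^ q) + of_nat q * r" by auto
  let ?x = "f i" and ?y = "\<Sum>i\<in>I. f i"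
  have y: "?y \<in> int_polys_at z" using insert.prems by (intro int_polys_at_sum) auto
  have x: "?x \<in> int_polys_at z" using insert.prems by auto
  \<comment> \<open>The inner binomial terms divided by q; the division is exact because q divides
    \<open>q choose k\<close> for 0 < k < q.\<close>
  define s where "s = (\<Sum>k\<in>{0<..<q}. of_int (int ((q choose k) div q)) * (?x ^ k * ?y ^ (q - k)))"
  have s: "s \<in> int_polys_at z" unfolding s_def
    by (intro int_polys_at_sum int_polys_at_mult int_polys_at_of_int int_polys_at_power x y)
  have q0: "0 < q" by (rule prime_gt_0_nat[OF q])
  have "(?x + ?y) ^ q = (\<Sum>k\<le>q. of_nat (q choose k) * ?x ^ k * ?y ^ (q - k))" by (rule binomial_ring)
  also have "{..q} = insert 0 (insert q {0<..<q})" using q0 by auto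
  also have "(\<Sum>k\<in>\<dots>. of_nat (q choose k) * ?x ^ k * ?y ^ (q - k)) =
     ?y ^ q + (?x ^ q + (\<Sum>k\<in>{0<..<q}. of_nat (q choose k) * ?x ^ k * ?y ^ (q - k)))"
    using q0 by simp
  also have "(\<Sum>k\<in>{0<..<q}. of_nat (q choose k) * ?x ^ k * ?y ^ (q - k)) = of_nat q * s"
    unfolding s_def sum_distrib_left
  proof (intro sum.cong refl)
    fix k assume "k \<in> {0<..<q}"
    then have "q dvd q choose k" by (intro dvd_choose_prime) (use q in auto)
    then obtain t where t: "q choose k = q * t" by blast
    then show "of_nat (q choose k) * ?x ^ k * ?y ^ (q - k) = of_nat q * (of_int (int ((q choose k) div q)) * (?x ^ k * ?y ^ (q - k)))"
      using q0 by simp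
  qed
  finally have "(?x + ?y) ^ q = ?x ^ q + (\<Sum>i\<in>I. f i ^ q) + of_nat q * (r + s)"
    unfolding r(2) by (simp add: algebra_simps)
  then show ?case using insert.hyps int_polys_at_add[OF r(1) s] by auto
qed

lemma int_power_prime_cong:
  assumes "prime q" shows "[a ^ q = a] (mod int q)"
proof -
  define b where "b = nat (a mod int q)"
  have q0: "q > 0" by (rule prime_gt_0_nat[OF assms])
  have ab: "[a = int b] (mod int q)" using q0 by (simp add: b_def cong_def)
  have "[b ^ q = b] (mod q)"
  proof (cases "q dvd b")
    case True
    then show ?thesis using q0 by (auto simp: cong_def power_0_left elim!: dvdE) (simp add: power_mult_distrib dvd_power mod_eq_0_iff_dvd)
  next
    case False
    have "[b ^ (q - 1) * b = 1 * b] (mod q)" by (intro cong_mult fermat_theorem[OF assms False] cong_refl)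
    then show ?thesis using q0 by (metis One_nat_def Suc_pred mult_1 mult.commute power_Suc)
  qed
  then have "[int b ^ q = int b] (mod int q)" by (metis cong_int_iff of_nat_power)
  then show ?thesis using cong_pow[OF ab, of q] ab by (meson cong_sym cong_trans)
qed

text \<open>If \<open>X(k) = \<Sum>\<^sub>j a\<^sub>j \<zeta>\<^sup>j\<^sup>k\<close> is always rational, then it is an integer, and \<open>X(qk) \<equiv> X(k)\<^sup>q \<equiv> X(k)\<close> modulo
  each prime \<open>q\<close>; for large \<open>q\<close> this means \<open>X(qk) = X(k)\<close>. So irreducibility of cyclotomic polynomials
  is not needed.\<close>

lemma rational_exp_sum_prime:
  fixes a :: "nat \<Rightarrow> int" and z :: complex
  assumes z: "z ^ n = 1" "n > 0" and X: "\<And>k. X k = (\<Sum>j<n. of_int (a j) * z ^ (j * k))"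
    and rat: "\<And>k. X k \<in> \<rat>" and q: "prime q" "int q > 2 * (\<Sum>j<n. \<bar>a j\<bar>)"
  shows "X (q * k) = X k"
proof -
  have trm: "of_int (a j) * z ^ (j * k) \<in> int_polys_at z" for j k
    by (intro int_polys_at_mult int_polys_at_of_int int_polys_at_power int_polys_at_self)
  have "X k \<in> int_polys_at z" for k unfolding X by (intro int_polys_at_sum trm)
  then have "X k \<in> \<int>" for k using int_polys_at_rational[OF z _ rat] by blast
  then have "\<exists>i. X k = of_int i" for k by (meson Ints_cases)
  then obtain x where x: "\<And>k. X k = of_int (x k)" by metis
  have "norm z ^ n = 1 ^ n" using z by (simp add: norm_power[symmetric])
  then have nz: "norm z = 1" using z(2) by (intro power_eq_imp_eq_base[of "norm z" n 1]) auto
  \<comment> \<open>Origin of the lower bound on q: integers of absolute value at most B that agree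
    modulo some q > 2 B are equal.\<close>
  have bound: "\<bar>x k\<bar> \<le> (\<Sum>j<n. \<bar>a j\<bar>)" for k
  proof -
    have "of_int \<bar>x k\<bar> = norm (X k)" by (simp add: x)
    also have "\<dots> \<le> (\<Sum>j<n. norm (of_int (a j) * z ^ (j * k)))" unfolding X by (rule norm_sum)
    also have "\<dots> = (\<Sum>j<n. of_int \<bar>a j\<bar>)" by (simp add: norm_mult norm_power nz)
    finally have "(of_int \<bar>x k\<bar> :: real) \<le> of_int (\<Sum>j<n. \<bar>a j\<bar>)" by simp
    then show ?thesis by linarith
  qed
  obtain r where r: "r \<in> int_polys_at z" "X k ^ q = (\<Sum>j<n. (of_int (a j) * z ^ (j * k)) ^ q) + of_nat q * r"
    using int_polys_at_frobenius[OF q(1), of "{..<n}" "\<lambda>j. of_int (a j) * z ^ (j * k)" z] trm unfolding X by blast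
  have "\<exists>t. a j ^ q = a j + int q * t" for j
    using int_power_prime_cong[OF q(1), of "a j"] by (metis cong_iff_lin cong_sym)
  then obtain t where t: "\<And>j. a j ^ q = a j + int q * t j" by metis
  define s where "s = (\<Sum>j<n. of_int (t j) * z ^ (j * (q * k)))"
  have s: "s \<in> int_polys_at z" unfolding s_def
    by (intro int_polys_at_sum int_polys_at_mult int_polys_at_of_int int_polys_at_power int_polys_at_self)
  have "(\<Sum>j<n. (of_int (a j) * z ^ (j * k)) ^ q) = (\<Sum>j<n. of_int (a j ^ q) * z ^ (j * (q * k)))"
    by (intro sum.cong refl) (simp add: power_mult_distrib power_mult[symmetric] mult_ac)
  also have "\<dots> = X (q * k) + of_nat q * s"
    unfolding X s_def t by (simp add: algebra_simps sum.distrib sum_distrib_left)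
  finally have eq: "X k ^ q = X (q * k) + of_nat q * (s + r)" using r(2) by (simp add: algebra_simps)
  have q0: "q > 0" by (rule prime_gt_0_nat[OF q(1)])
  \<comment> \<open>The error term is rational, hence an integer since it lies in Z[z]; so the
    congruence descends from Z[z] to Z.\<close>
  have "s + r = (X k ^ q - X (q * k)) / of_nat q" using eq q0 by simp
  also have "\<dots> \<in> \<rat>" using rat by auto
  finally have "s + r \<in> \<int>" by (intro int_polys_at_rational[OF z int_polys_at_add[OF s r(1)]])
  then obtain u where u: "s + r = of_int u" by (auto elim: Ints_cases)
  have "(of_int (x k ^ q) :: complex) = of_int (x (q * k) + int q * u)" using eq unfolding x u by simp
  then have "x k ^ q = x (q * k) + int q * u" using of_int_eq_iff by blast
  then have "[x k ^ q = x (q * k)] (mod int q)" by (simp add: cong_def)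
  then have "[x k = x (q * k)] (mod int q)" using int_power_prime_cong[OF q(1), of "x k"] by (meson cong_sym cong_trans)
  then have "int q dvd x k - x (q * k)" by (simp add: cong_iff_dvd_diff)
  moreover have "\<bar>x k - x (q * k)\<bar> < int q" using bound[of k] bound[of "q * k"] q(2) by linarith
  ultimately have "x k - x (q * k) = 0" using dvd_imp_le_int[of "x k - x (q * k)" "int q"] by linarith
  then show ?thesis unfolding x by simp
qed

text \<open>Removes the prime factors of t one at a time; each of them is above the bound of the
  prime case.\<close>

lemma rational_exp_sum:
  fixes a :: "nat \<Rightarrow> int" and z :: complex and t :: nat
  assumes z: "z ^ n = 1" "n > 0" and X: "\<And>k. X k = (\<Sum>j<n. of_int (a j) * z ^ (j * k))"
    and rat: "\<And>k. X k \<in> \<rat>" and t: "t > 0" "\<And>q. prime q \<Longrightarrow> q dvd t \<Longrightarrow> int q > 2 * (\<Sum>j<n. \<bar>a j\<bar>)"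
  shows "X (t * k) = X k"
  using t
proof (induction t arbitrary: k rule: less_induct)
  case (less t)
  show ?case
  proof (cases "t = 1")
    case False
    then obtain q where q: "prime q" "q dvd t" using prime_factor_nat by blast
    then obtain t' where t': "t = q * t'" by blast
    have t'0: "t' > 0" using t' less.prems(1) by auto
    have "1 * t' < q * t'" using t'0 prime_gt_1_nat[OF q(1)] by (intro mult_strict_right_mono)
    then have "t' < t" unfolding t' by (simp only: mult_1)
    have "X (t' * k) = X k"
      by (rule less.IH[OF \<open>t' < t\<close> t'0], rule less.prems(2)) (assumption, simp add: t')
    moreover have "X (q * (t' * k)) = X (t' * k)"
      using less.prems(2)[OF q] by (intro rational_exp_sum_prime[OF z X rat q(1)])
    ultimately show ?thesis by (simp add: t' mult.assoc)
  qed simp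
qed

text \<open>Equal gcds make i and j differ by a unit modulo n1 = n / d. The Chinese remainder
  theorem lifts this unit to a t that is 1 modulo every prime up to M not dividing n1, and primes
  dividing n1 cannot divide t because t is a unit there. So every prime factor of t is large,
  although t itself may be composite.\<close>

lemma unit_lift:
  fixes i j n M :: nat
  assumes n: "n > 0" and ij: "gcd i n = gcd j n"
  obtains t where "t > 0" "[t * i = j] (mod n)" "\<And>q. prime q \<Longrightarrow> q dvd t \<Longrightarrow> q > M"
proof -
  define d where "d = gcd i n"
  have d: "d > 0" using n by (simp add: d_def)
  define i1 j1 n1 where "i1 = i div d" "j1 = j div d" "n1 = n div d"
  have i: "i = d * i1" and j: "j = d * j1" and n1: "n = d * n1"
    unfolding i1_j1_n1_def d_def using ij by (simp_all) (metis dvd_mult_div_cancel gcd_dvd1)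
  have ci: "coprime i1 n1" unfolding i1_j1_n1_def d_def using div_gcd_coprime n by blast
  have cj: "coprime j1 n1" unfolding i1_j1_n1_def d_def ij using div_gcd_coprime n by blast
  obtain s where s: "[i1 * s = 1] (mod n1)" using cong_solve_coprime_nat[OF ci] by auto
  have cs: "coprime s n1"
  proof -
    have "coprime (i1 * s) n1" using s by (metis cong_imp_coprime cong_sym coprime_1_left)
    then show ?thesis by simp
  qed
  define K where "K = \<Prod>{q. prime q \<and> q \<le> M \<and> \<not> q dvd n1}"
  have fin: "finite {q. prime q \<and> q \<le> M \<and> \<not> q dvd n1}" by (rule finite_subset[of _ "{..M}"]) auto
  have K0: "K > 0" unfolding K_def by (intro prod_pos) (auto dest: prime_gt_0_nat)
  have cK: "coprime n1 K"
    unfolding K_def by (intro prod_coprime_right) (auto intro: prime_imp_coprime_nat simp: coprime_commute)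
  obtain t0 where t0: "[t0 = j1 * s] (mod n1)" "[t0 = 1] (mod K)"
    using binary_chinese_remainder_nat[OF cK, of "j1 * s" 1] by blast
  \<comment> \<open>Adding n1 K preserves both congruences and makes t positive.\<close>
  define t where "t = t0 + n1 * K"
  have n10: "n1 > 0" using n n1 by (cases n1) auto
  have t: "[t = j1 * s] (mod n1)" "[t = 1] (mod K)" using t0 by (auto simp: t_def cong_def)
  show thesis
  proof
    show "t > 0" using n10 K0 by (simp add: t_def)
    have "[t * i1 = j1 * s * i1] (mod n1)" by (intro cong_mult t cong_refl)
    also have "[j1 * s * i1 = j1 * 1] (mod n1)" using cong_mult[OF cong_refl s, of j1] by (simp add: mult_ac)
    finally have "[t * i1 = j1] (mod n1)" by simp
    then have "[d * (t * i1) = d * j1] (mod (d * n1))" by (simp add: cong_def mod_mult_mult1)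
    then show "[t * i = j] (mod n)" unfolding n1 using i j by (simp add: mult_ac)
    fix q assume q: "prime q" "q dvd t"
    show "q > M"
    proof (rule ccontr)
      assume "\<not> q > M"
      show False
      proof (cases "q dvd n1")
        case True
        have "coprime t n1" using cj cs t(1) by (metis cong_imp_coprime cong_sym coprime_mult_left_iff)
        then show False using True q by (meson coprime_common_divisor not_prime_unit)
      next
        case False
        then have "q dvd K" unfolding K_def using q \<open>\<not> q > M\<close> fin by (intro dvd_prodI) auto
        then have "[t = 1] (mod q)" using t(2) cong_dvd_modulus_nat by blast
        then have "q dvd 1" using q(2) cong_dvd_iff by blast
        then show False using q(1) by simp
      qed
    qed
  qed
qed

lemma sum_root_of_unity_powers:
  fixes z :: complex
  assumes "z ^ n = 1"
  shows "(\<Sum>k<n. z ^ k) = (if z = 1 then of_nat n else 0)"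
  using assms by (simp add: geometric_sum)

lemma cis_root_of_unity:
  assumes "n > 0"
  shows cis_root_power_self: "cis (2 * pi / real n) ^ n = 1"
    and cis_root_power_inj: "cis (2 * pi / real n) ^ k = cis (2 * pi / real n) ^ l \<Longrightarrow> k < n \<Longrightarrow> l < n \<Longrightarrow> k = l"
    and cis_root_power_eq_1: "cis (2 * pi / real n) ^ m = 1 \<longleftrightarrow> n dvd m"
proof -
  let ?z = "cis (2 * pi / real n)"
  show zn: "?z ^ n = 1" using assms by (simp add: DeMoivre)
  have inj: "k = l" if "?z ^ k = ?z ^ l" "k < n" "l < n" for k l
  proof -
    have "cis (2 * pi * real k / real n) = cis (2 * pi * real l / real n)"
      using that(1) by (simp add: DeMoivre mult.commute)
    then show ?thesis using inj_onD[OF bij_betw_imp_inj_on[OF bij_betw_roots_unity[OF assms]]] that by auto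
  qed
  then show "?z ^ k = ?z ^ l \<Longrightarrow> k < n \<Longrightarrow> l < n \<Longrightarrow> k = l" .
  have "?z ^ m = 1 \<longleftrightarrow> ?z ^ (m mod n) = ?z ^ 0"
    by (subst power_mod_exponent[OF zn]) simp
  also have "\<dots> \<longleftrightarrow> m mod n = 0"
    using inj[of "m mod n" 0] mod_less_divisor[OF assms, of m] assms by auto
  finally show "?z ^ m = 1 \<longleftrightarrow> n dvd m" by (simp add: dvd_eq_mod_eq_0)
qed

text \<open>The coefficients are recovered from X by Fourier inversion. With t i = j modulo n and
  X(t k) = X(k), substituting t k for k, a permutation of the residues, turns the formula for the
  j-th coefficient into that for the i-th.\<close>

lemma rational_exp_sum_coeffs:
  fixes a :: "nat \<Rightarrow> int"
  assumes n: "n > 0" and z: "z = cis (2 * pi / n)" and X: "\<And>k. X k = (\<Sum>j<n. of_int (a j) * z ^ (j * k))"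
    and rat: "\<And>k. X k \<in> \<rat>" and ij: "i < n" "j < n" "gcd i n = gcd j n"
  shows "a i = a j"
proof -
  note zn = cis_root_power_self[OF n, folded z]
  have z0: "z \<noteq> 0" by (simp add: z)
  define w where "w = inverse z"
  have wn: "w ^ n = 1" using zn by (simp add: w_def power_inverse)
  note inj = cis_root_power_inj[OF n, folded z]
  note wmod = power_mod_exponent[OF wn]
  note zmod = power_mod_exponent[OF zn]
  have coeff: "(\<Sum>k<n. X k * w ^ (l * k)) = of_nat n * of_int (a l)" if l: "l < n" for l
  proof -
    have "(\<Sum>k<n. X k * w ^ (l * k)) = (\<Sum>k<n. \<Sum>j<n. of_int (a j) * (z ^ j * w ^ l) ^ k)"
      unfolding X by (intro sum.cong refl) (simp add: sum_distrib_right power_mult power_mult_distrib mult.assoc)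
    also have "\<dots> = (\<Sum>j<n. of_int (a j) * (\<Sum>k<n. (z ^ j * w ^ l) ^ k))"
      by (subst sum.swap) (simp add: sum_distrib_left)
    also have "\<dots> = (\<Sum>j<n. if j = l then of_nat n * of_int (a l) else 0)"
    proof (intro sum.cong refl)
      fix j assume j: "j \<in> {..<n}"
      have "(z ^ j * w ^ l) ^ n = (z ^ n) ^ j * (w ^ n) ^ l" by (simp add: power_mult_distrib power_mult[symmetric] mult.commute)
      then have "(z ^ j * w ^ l) ^ n = 1" using zn wn by simp
      moreover have "z ^ j * w ^ l = 1 \<longleftrightarrow> j = l"
      proof -
        have "z ^ j * w ^ l = 1 \<longleftrightarrow> z ^ j = z ^ l" using z0 by (simp add: w_def field_simps power_inverse)
        then show ?thesis using inj[of j l] j l by auto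
      qed
      ultimately show "of_int (a j) * (\<Sum>k<n. (z ^ j * w ^ l) ^ k) = (if j = l then of_nat n * of_int (a l) else 0)"
        using sum_root_of_unity_powers[of "z ^ j * w ^ l" n] by auto
    qed
    finally show ?thesis using l by simp
  qed
  \<comment> \<open>Prime factors above n make t prime to n; prime factors above twice the
    coefficient sum admit \<open>rational_exp_sum\<close>.\<close>
  obtain t where t: "t > 0" "[t * i = j] (mod n)" "\<And>q. prime q \<Longrightarrow> q dvd t \<Longrightarrow> q > max n (nat (2 * (\<Sum>j<n. \<bar>a j\<bar>)))"
    by (rule unit_lift[OF n ij(3)]) (rule that)
  have Xt: "X (t * k) = X k" for k
  proof (rule rational_exp_sum[OF zn n X rat t(1)])
    fix q assume "prime q" "q dvd t"
    from t(3)[OF this] have "nat (2 * (\<Sum>j<n. \<bar>a j\<bar>)) < q" by simp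
    then show "2 * (\<Sum>j<n. \<bar>a j\<bar>) < int q" by linarith
  qed
  have Xmod: "X k = X (k mod n)" for k
    unfolding X by (intro sum.cong refl arg_cong2[where f = "(*)"]) (metis zmod mod_mult_right_eq)
  have ct: "coprime t n"
  proof (rule ccontr)
    assume "\<not> coprime t n"
    then obtain q where q: "prime q" "q dvd t" "q dvd n" by (metis coprime_iff_gcd_eq_1 gcd_greatest_iff prime_factor_nat)
    then show False using t(3)[OF q(1,2)] dvd_imp_le[OF q(3)] n by simp
  qed
  have bij: "bij_betw (\<lambda>k. (t * k) mod n) {..<n} {..<n}"
  proof -
    have "inj_on (\<lambda>k. (t * k) mod n) {..<n}"
    proof (rule inj_onI)
      fix k l assume kl: "k \<in> {..<n}" "l \<in> {..<n}" "(t * k) mod n = (t * l) mod n"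
      then have "[k = l] (mod n)" using cong_mult_lcancel_nat[OF ct] by (simp add: cong_def)
      then show "k = l" using kl by (simp add: cong_def)
    qed
    moreover have "(\<lambda>k. (t * k) mod n) ` {..<n} \<subseteq> {..<n}" using n by auto
    ultimately show ?thesis by (simp add: bij_betw_def endo_inj_surj)
  qed
  have "(\<Sum>k<n. X k * w ^ (j * k)) = (\<Sum>k<n. X ((t * k) mod n) * w ^ (i * ((t * k) mod n)))"
  proof (intro sum.cong refl)
    fix k
    have "[j * k = t * i * k] (mod n)" using cong_mult[OF t(2) cong_refl, of k] by (simp add: cong_sym)
    then have "w ^ (j * k) = w ^ (t * i * k)" using wmod[of "j * k"] wmod[of "t * i * k"] by (simp add: cong_def)
    also have "\<dots> = w ^ (i * ((t * k) mod n))" using wmod[of "t * i * k"] wmod[of "i * ((t * k) mod n)"]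
      by (simp add: mod_mult_right_eq mult_ac)
    finally show "X k * w ^ (j * k) = X ((t * k) mod n) * w ^ (i * ((t * k) mod n))"
      using Xt[of k] Xmod[of "t * k"] by simp
  qed
  also have "\<dots> = (\<Sum>k<n. X k * w ^ (i * k))" by (rule sum.reindex_bij_betw[OF bij])
  finally have "(of_nat n * of_int (a j) :: complex) = of_nat n * of_int (a i)" unfolding coeff[OF ij(1)] coeff[OF ij(2)] .
  then show ?thesis using n by simp
qed

section \<open>Moebius inversion over divisors\<close>

text \<open>The value of b at e is determined by its values at the proper divisors of e. Induction
  gives a solution on each range up to N, and these solutions agree at positive arguments in range,
  so their diagonal \<open>b d d\<close> works for all e.\<close>

lemma int_moebius_inversion:
  fixes u :: "nat \<Rightarrow> int"
  obtains b where "\<And>e. e > 0 \<Longrightarrow> u e = (\<Sum>d | d dvd e. b d)"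
proof -
  have "\<exists>b. \<forall>e. 0 < e \<and> e \<le> N \<longrightarrow> u e = (\<Sum>d | d dvd e. b d)" for N :: nat
  proof (induction N)
    case (Suc N)
    then obtain b where b: "\<forall>e. 0 < e \<and> e \<le> N \<longrightarrow> u e = (\<Sum>d | d dvd e. b d)" by blast
    define b' where "b' = b(Suc N := u (Suc N) - (\<Sum>d\<in>{d. d dvd Suc N} - {Suc N}. b d))"
    have "u e = (\<Sum>d | d dvd e. b' d)" if e: "0 < e" "e \<le> Suc N" for e
    proof (cases "e = Suc N")
      case True
      have "(\<Sum>d | d dvd Suc N. b' d) = b' (Suc N) + (\<Sum>d\<in>{d. d dvd Suc N} - {Suc N}. b' d)"
        by (rule sum.remove) auto
      also have "(\<Sum>d\<in>{d. d dvd Suc N} - {Suc N}. b' d) = (\<Sum>d\<in>{d. d dvd Suc N} - {Suc N}. b d)"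
        by (intro sum.cong) (auto simp: b'_def)
      finally show ?thesis using True by (simp add: b'_def)
    next
      case False
      have "(\<Sum>d | d dvd e. b' d) = (\<Sum>d | d dvd e. b d)"
        using e False by (intro sum.cong) (auto simp: b'_def dest: dvd_imp_le)
      then show ?thesis using b e False by auto
    qed
    then show ?case by blast
  qed auto
  then obtain b where b: "\<And>N e. 0 < e \<Longrightarrow> e \<le> N \<Longrightarrow> u e = (\<Sum>d | d dvd e. b N d)" by metis
  have stable: "b N e = b e e" if "0 < e" "e \<le> N" for e N
    using that
  proof (induction e arbitrary: N rule: less_induct)
    case (less e)
    have *: "(\<Sum>d | d dvd e. b M d) = b M e + (\<Sum>d\<in>{d. d dvd e} - {e}. b M d)" for M
      using less.prems by (intro sum.remove) auto
    have "(\<Sum>d\<in>{d. d dvd e} - {e}. b N d) = (\<Sum>d\<in>{d. d dvd e} - {e}. b e d)"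
    proof (intro sum.cong refl)
      fix d assume d: "d \<in> {d. d dvd e} - {e}"
      then have "0 < d" "d \<le> e" "d \<noteq> e" using less.prems(1) dvd_imp_le[of d e] by (auto intro: Nat.gr0I)
      then have "0 < d" "d < e" by auto
      then show "b N d = b e d" using less.IH[of d N] less.IH[of d e] less.prems by simp
    qed
    then show ?case using b[OF less.prems(1), of e] b[OF less.prems] * by simp
  qed
  show thesis
  proof (rule that[of "\<lambda>d. b d d"])
    fix e :: nat assume e: "e > 0"
    have "u e = (\<Sum>d | d dvd e. b e d)" using b[OF e, of e] by simp
    also have "\<dots> = (\<Sum>d | d dvd e. b d d)"
      using e by (intro sum.cong refl stable) (auto dest: dvd_imp_le intro: Nat.gr0I)
    finally show "u e = (\<Sum>d | d dvd e. b d d)" .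
  qed
qed

subsection \<open>Traces of matrices of finite order\<close>

lemma upper_triangular_mult:
  fixes A B :: "'k :: semiring_0 mat"
  assumes A: "A \<in> carrier_mat n n" "upper_triangular A" and B: "B \<in> carrier_mat n n" "upper_triangular B"
  shows "upper_triangular (A * B)" and "\<And>i. i < n \<Longrightarrow> (A * B) $$ (i, i) = A $$ (i, i) * B $$ (i, i)"
proof -
  have AB: "(A * B) $$ (i, j) = (\<Sum>k<n. A $$ (i, k) * B $$ (k, j))" if "i < n" "j < n" for i j
    using A B that by (simp add: scalar_prod_def atLeast0LessThan)
  have a: "A $$ (i, k) = 0" if "k < i" "i < n" for i k using upper_triangularD[OF A(2)] A(1) that by auto
  have b: "B $$ (i, k) = 0" if "k < i" "i < n" for i k using upper_triangularD[OF B(2)] B(1) that by auto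
  show "upper_triangular (A * B)"
  proof (rule upper_triangularI)
    fix i j assume ij: "j < i" "i < dim_row (A * B)"
    then have "A $$ (i, k) * B $$ (k, j) = 0" if "k < n" for k
      using a[of k i] b[of j k] A(1) that by (cases "k < i") auto
    then show "(A * B) $$ (i, j) = 0" using AB[of i j] ij A(1) by simp
  qed
  fix i assume i: "i < n"
  have "(\<Sum>k<n. A $$ (i, k) * B $$ (k, i)) = (\<Sum>k<n. if k = i then A $$ (i, i) * B $$ (i, i) else 0)"
  proof (intro sum.cong refl)
    fix k assume "k \<in> {..<n}"
    then show "A $$ (i, k) * B $$ (k, i) = (if k = i then A $$ (i, i) * B $$ (i, i) else 0)"
      using a[of k i] b[of i k] i by (cases k i rule: linorder_cases) auto
  qed
  then show "(A * B) $$ (i, i) = A $$ (i, i) * B $$ (i, i)" using AB[OF i i] i by simp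
qed

lemma upper_triangular_pow:
  fixes A :: "'k :: semiring_1 mat"
  assumes A: "A \<in> carrier_mat n n" "upper_triangular A"
  shows "upper_triangular (A ^\<^sub>m k) \<and> (\<forall>i<n. (A ^\<^sub>m k) $$ (i, i) = (A $$ (i, i)) ^ k)"
proof (induction k)
  case (Suc k)
  have "A ^\<^sub>m k \<in> carrier_mat n n" using A by simp
  then show ?case using upper_triangular_mult[OF _ _ A, of "A ^\<^sub>m k"] Suc by (simp add: power_commutes)
qed (use A in auto)

text \<open>In Schur form the trace of the k-th power is the sum of the k-th powers of the diagonal
  entries, and these are n-th roots of unity because the n-th power of the triangular matrix is 1.
  The coefficient a_j is the multiplicity of zeta^j, which does not depend on k.\<close>

lemma trace_pow_finite_order:
  fixes A :: "complex mat"
  assumes A: "A \<in> carrier_mat d d" and An: "A ^\<^sub>m n = 1\<^sub>m d" and n: "n > 0"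
  obtains a :: "nat \<Rightarrow> int" where
    "\<And>k. (\<Sum>i<d. (A ^\<^sub>m k) $$ (i, i)) = (\<Sum>j<n. of_int (a j) * cis (2 * pi / n) ^ (j * k))"
proof -
  obtain es where es: "char_poly A = (\<Prod>e\<leftarrow>es. [:- e, 1:])" using char_poly_factorized[OF A] by blast
  obtain B P Q where "schur_decomposition A es = (B, P, Q)" by (cases "schur_decomposition A es")
  then have wit: "similar_mat_wit A B P Q" and B: "upper_triangular B"
    using schur_decomposition[OF A es] by auto
  note w = similar_mat_witD2[OF A wit]
  have trace: "(\<Sum>i<d. (A ^\<^sub>m k) $$ (i, i)) = (\<Sum>i<d. (B $$ (i, i)) ^ k)" for k
  proof -
    note wk = similar_mat_witD2[OF pow_carrier_mat[OF A, of k] similar_mat_wit_pow[OF wit, of k]]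
    have "(\<Sum>i<d. (A ^\<^sub>m k) $$ (i, i)) = (\<Sum>i<d. (P * (B ^\<^sub>m k * Q)) $$ (i, i))"
      unfolding wk(3) using assoc_mult_mat[OF wk(6,5,7)] by simp
    also have "\<dots> = (\<Sum>i<d. (B ^\<^sub>m k * Q * P) $$ (i, i))" using wk by (intro trace_mult_commute) auto
    also have "B ^\<^sub>m k * Q * P = B ^\<^sub>m k * (Q * P)" using wk by (intro assoc_mult_mat) auto
    also have "\<dots> = B ^\<^sub>m k" unfolding wk(2) by (rule right_mult_one_mat[OF wk(5)])
    also have "(\<Sum>i<d. (B ^\<^sub>m k) $$ (i, i)) = (\<Sum>i<d. (B $$ (i, i)) ^ k)"
      using upper_triangular_pow[OF w(5) B, of k] by simp
    finally show ?thesis .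
  qed
  have "B ^\<^sub>m n = 1\<^sub>m d"
    using similar_mat_wit_pow_id[OF similar_mat_wit_sym[OF wit], of n] w An by simp
  then have root: "(B $$ (i, i)) ^ n = 1" if "i < d" for i
    using upper_triangular_pow[OF w(5) B, of n] that by auto
  have "\<exists>j<n. B $$ (i, i) = cis (2 * pi / n) ^ j" if i: "i < d" for i
  proof -
    have "B $$ (i, i) \<in> (\<lambda>k. cis (2 * pi * real k / real n)) ` {..<n}"
      using bij_betw_imp_surj_on[OF bij_betw_roots_unity[OF n]] root[OF i] by simp
    then obtain j where "j < n" "B $$ (i, i) = cis (2 * pi * real j / real n)" by auto
    then show ?thesis by (intro exI[of _ j]) (simp add: DeMoivre mult.commute)
  qed
  then obtain e where e: "\<And>i. i < d \<Longrightarrow> e i < n" "\<And>i. i < d \<Longrightarrow> B $$ (i, i) = cis (2 * pi / n) ^ e i" by metis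
  show thesis
  proof (rule that[of "\<lambda>j. int (card {i \<in> {..<d}. e i = j})"])
    fix k
    have "(\<Sum>i<d. (B $$ (i, i)) ^ k) = (\<Sum>i<d. cis (2 * pi / n) ^ (e i * k))"
      using e(2) by (simp add: power_mult)
    also have "\<dots> = (\<Sum>j<n. \<Sum>i\<in>{i \<in> {..<d}. e i = j}. cis (2 * pi / n) ^ (e i * k))"
      using e(1) by (intro sum.group[symmetric]) auto
    also have "\<dots> = (\<Sum>j<n. of_int (int (card {i \<in> {..<d}. e i = j})) * cis (2 * pi / n) ^ (j * k))"
      by (intro sum.cong refl) simp
    finally show "(\<Sum>i<d. (A ^\<^sub>m k) $$ (i, i)) = (\<Sum>j<n. of_int (int (card {i \<in> {..<d}. e i = j})) * cis (2 * pi / n) ^ (j * k))"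
      unfolding trace .
  qed
qed

subsection \<open>Cyclic groups\<close>

text \<open>Representations satisfy this by the trace formula, and the class functions of this form
  along the powers of g are a subgroup. Differences of characters are the reason for integer
  coefficients in place of multiplicities.\<close>

lemma virtual_character_cyclic:
  fixes G :: "'a monoid" (structure)
  assumes G: "group G" "finite (carrier G)" and g: "g \<in> carrier G" and \<chi>: "\<chi> \<in> virtual_characters G"
  obtains a :: "nat \<Rightarrow> int" where
    "\<And>k::nat. \<chi> (g [^] k) = (\<Sum>j<group.ord G g. of_int (a j) * cis (2 * pi / group.ord G g) ^ (j * k))"
proof -
  interpret group G by fact
  define n where "n = ord g"
  have n: "n > 0" using ord_ge_1[OF G(2) g] by (simp add: n_def)
  define P where "P \<chi> a \<longleftrightarrow> (\<forall>k::nat. \<chi> (g [^] k) = (\<Sum>j<n. of_int (a j) * cis (2 * pi / n) ^ (j * k)))"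
    for \<chi> and a :: "nat \<Rightarrow> int"
  have add: "P (\<lambda>x. \<chi> x + \<chi>' x) (\<lambda>j. a j + a' j)" if "P \<chi> a" "P \<chi>' a'" for \<chi> \<chi>' a a'
    using that unfolding P_def by (simp add: algebra_simps sum.distrib)
  have minus: "P (\<lambda>x. - \<chi> x) (\<lambda>j. - a j)" if "P \<chi> a" for \<chi> a
    using that unfolding P_def by (simp add: sum_negf)
  have "subgroup {\<chi> \<in> carrier (class_functions G). \<exists>a. P \<chi> a} (class_functions G)"
  proof (rule group.subgroupI[OF group_class_functions])
    interpret C: group "class_functions G" by (rule group_class_functions)
    have "P (\<lambda>_. 0) (\<lambda>_. 0)" by (simp add: P_def)
    then show "{\<chi> \<in> carrier (class_functions G). \<exists>a. P \<chi> a} \<noteq> {}" using C.one_closed by auto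
    fix f assume f: "f \<in> {\<chi> \<in> carrier (class_functions G). \<exists>a. P \<chi> a}"
    then show "inv\<^bsub>class_functions G\<^esub> f \<in> {\<chi> \<in> carrier (class_functions G). \<exists>a. P \<chi> a}"
      using C.inv_closed[of f] inv_class_functions[of f G] minus[of f] by auto
    fix f' assume f': "f' \<in> {\<chi> \<in> carrier (class_functions G). \<exists>a. P \<chi> a}"
    show "f \<otimes>\<^bsub>class_functions G\<^esub> f' \<in> {\<chi> \<in> carrier (class_functions G). \<exists>a. P \<chi> a}"
      using C.m_closed[of f f'] f f' add[of f _ f'] by auto
  qed auto
  moreover have "{rep_character G d \<rho> | d \<rho>. \<rho> \<in> matrix_reps G d} \<subseteq> {\<chi> \<in> carrier (class_functions G). \<exists>a. P \<chi> a}"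
  proof clarify
    fix d and \<rho> :: "'a \<Rightarrow> complex mat" assume \<rho>: "\<rho> \<in> matrix_reps G d"
    note r = \<rho>[unfolded matrix_reps_iff[OF G(1)]]
    have rg: "\<rho> g \<in> carrier_mat d d" using r g by blast
    have pow: "\<rho> (g [^] k) = (\<rho> g) ^\<^sub>m k" for k :: nat
    proof (induction k)
      case 0
      show ?case using r rg by simp
    next
      case (Suc k)
      have "\<rho> (g [^] Suc k) = \<rho> (g [^] k) * \<rho> g" using r g by simp
      then show ?case using Suc by simp
    qed
    have "(\<rho> g) ^\<^sub>m n = 1\<^sub>m d" using pow[of n] r pow_ord_eq_1[OF g] by (simp add: n_def)
    then obtain a :: "nat \<Rightarrow> int" where
      a: "\<And>k. (\<Sum>i<d. ((\<rho> g) ^\<^sub>m k) $$ (i, i)) = (\<Sum>j<n. of_int (a j) * cis (2 * pi / n) ^ (j * k))"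
      by (rule trace_pow_finite_order[OF rg _ n]) (rule that)
    have "P (rep_character G d \<rho>) a"
      unfolding P_def using a pow g by (simp add: rep_character_def)
    moreover have "rep_character G d \<rho> \<in> carrier (class_functions G)"
      unfolding carrier_class_functions using rep_character_class_function[OF G(1) \<rho>] by blast
    ultimately show "rep_character G d \<rho> \<in> carrier (class_functions G) \<and> (\<exists>a. P (rep_character G d \<rho>) a)" by blast
  qed
  ultimately have "virtual_characters G \<subseteq> {\<chi> \<in> carrier (class_functions G). \<exists>a. P \<chi> a}"
    unfolding virtual_characters_def by (intro group.generate_subgroup_incl[OF group_class_functions])
  then obtain a where "P \<chi> a" using \<chi> by blast
  then show thesis using that unfolding P_def n_def by blast
qed

lemma cyclic_group_nat_powers:
  assumes "group G" "finite (carrier G)" "g \<in> carrier G" "x \<in> range (\<lambda>n::int. g [^]\<^bsub>G\<^esub> n)"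
  obtains k :: nat where "x = g [^]\<^bsub>G\<^esub> k"
proof -
  interpret group G by fact
  obtain i :: int where i: "x = g [^]\<^bsub>G\<^esub> i" using assms(4) by blast
  have n: "int (ord g) > 0" using ord_ge_1[OF assms(2,3)] by simp
  have "g [^]\<^bsub>G\<^esub> i = g [^]\<^bsub>G\<^esub> (i mod int (ord g))"
    unfolding int_pow_eq[OF assms(3)] by (simp add: mod_eq_dvd_iff[symmetric])
  also have "i mod int (ord g) = int (nat (i mod int (ord g)))" using n by simp
  also have "g [^]\<^bsub>G\<^esub> \<dots> = g [^]\<^bsub>G\<^esub> nat (i mod int (ord g))" by (rule int_pow_int)
  finally show thesis using that i by blast
qed

lemma (in group) cyclic_subgroup_cyclic:
  assumes fin: "finite (carrier G)" and g: "g \<in> carrier G" and R: "subgroup R G" "R \<subseteq> range (\<lambda>n::int. g [^] n)"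
  obtains r where "r \<in> R" "R = range (\<lambda>n::int. r [^] n)"
proof -
  interpret R: subgroup R G by (rule R)
  define i where "i = (LEAST i::nat. i > 0 \<and> g [^] i \<in> R)"
  have "ord g > 0 \<and> g [^] ord g \<in> R" using ord_ge_1[OF fin g] g by simp
  then have i: "i > 0" "g [^] i \<in> R" unfolding i_def by (metis (mono_tags, lifting) LeastI)+
  have least: "\<not> (0 < m \<and> g [^] m \<in> R)" if "m < i" for m :: nat using not_less_Least that unfolding i_def by blast
  show thesis
  proof
    show "g [^] i \<in> R" by (rule i)
    show "R = range (\<lambda>n::int. (g [^] i) [^] n)"
    proof (intro equalityI subsetI)
      fix x assume "x \<in> range (\<lambda>n::int. (g [^] i) [^] n)"
      then show "x \<in> R" using subgroup_int_pow_closed[OF R(1) i(2)] by blast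
    next
      fix x assume x: "x \<in> R"
      obtain k :: nat where k: "x = g [^] k"
        by (rule cyclic_group_nat_powers[OF group_axioms fin g subsetD[OF R(2) x]])
      have "x = g [^] (i * (k div i) + k mod i)" unfolding k by simp
      also have "\<dots> = (g [^] i) [^] (k div i) \<otimes> g [^] (k mod i)"
        using g by (simp only: nat_pow_mult nat_pow_pow)
      finally have eq: "x = (g [^] i) [^] (k div i) \<otimes> g [^] (k mod i)" .
      have q: "(g [^] i) [^] (k div i) \<in> R" using subgroup_int_pow_closed[OF R(1) i(2), of "int (k div i)"] unfolding int_pow_int .
      have "g [^] (k mod i) = inv ((g [^] i) [^] (k div i)) \<otimes> x"
        unfolding eq using g by (simp add: mult_inv_cancel)
      then have "g [^] (k mod i) \<in> R" using q x by simp
      then have "k mod i = 0" using least[of "k mod i"] i(1) by auto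
      then have "x = (g [^] i) [^] (k div i)" using eq g by simp
      then have "x = (g [^] i) [^] int (k div i)" unfolding int_pow_int .
      then show "x \<in> range (\<lambda>n::int. (g [^] i) [^] n)" by blast
    qed
  qed
qed

text \<open>Expand the value at g^k as the sum of a_j zeta^(j k). Rational values force a_j to
  depend only on gcd(j, n), and Moebius inversion writes a_j as the sum of b_d over the common
  divisors d of j and n. The linear characters with d dividing j are those trivial on the subgroup
  H_d of order d, so they add up to the character of Q[G/H_d], and \<chi> is the combination of
  these with coefficients b_d.\<close>

lemma Char_Q_cyclic_subset_Perm:
  fixes G :: "'a monoid" (structure)
  assumes G: "group G" "finite (carrier G)" and cyc: "cyclic_group G"
  shows "Char_Q G \<subseteq> Perm G"
proof
  fix \<chi> assume \<chi>: "\<chi> \<in> Char_Q G"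
  interpret group G by fact
  obtain g where g: "g \<in> carrier G" "carrier G = range (\<lambda>n::int. g [^] n)" using cyc unfolding cyclic_group by blast
  define n where "n = ord g"
  have n: "n > 0" using ord_ge_1[OF G(2) g(1)] by (simp add: n_def)
  have cardG: "card (carrier G) = n"
    using generate_pow_card[OF g(1)] generate_pow[OF g(1)] g(2) by (simp add: n_def full_SetCompr_eq)
  have comm: "x \<otimes> y = y \<otimes> x" if "x \<in> carrier G" "y \<in> carrier G" for x y
    using cyclic_imp_abelian_group[OF cyc] that by (simp add: comm_group_def comm_monoid.m_comm)
  define z where "z = cis (2 * pi / real n)"
  obtain a :: "nat \<Rightarrow> int" where a: "\<And>k. \<chi> (g [^] k) = (\<Sum>j<n. of_int (a j) * z ^ (j * k))"
    by (rule virtual_character_cyclic[OF G g(1), of \<chi>, folded n_def, folded z_def])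
      (use \<chi> in \<open>simp add: Char_Q_def\<close>, rule that)
  have rat: "\<chi> (g [^] k) \<in> \<rat>" for k :: nat using \<chi> g(1) by (simp add: Char_Q_def)
  have aa: "a i = a j" if "i < n" "j < n" "gcd i n = gcd j n" for i j
    by (rule rational_exp_sum_coeffs[OF n z_def a rat that])
  \<comment> \<open>For j = 0 the divisor gcd(j, n) is n itself, outside the index range of a; hence
    the reduction modulo n.\<close>
  obtain b where b: "\<And>e. e > 0 \<Longrightarrow> a (e mod n) = (\<Sum>d | d dvd e. b d)"
    by (rule int_moebius_inversion[of "\<lambda>e. a (e mod n)"]) (rule that)
  have aj: "a j = (\<Sum>d | d dvd n. if d dvd j then b d else 0)" if j: "j < n" for j
  proof -
    have "gcd (gcd j n mod n) n = gcd (gcd j n) n" using gcd_red_nat[of "gcd j n" n] by (simp add: gcd.commute)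
    also have "\<dots> = gcd j n" by (rule gcd_nat.right_idem)
    finally have gcd_mod: "gcd (gcd j n mod n) n = gcd j n" .
    then have "a j = a (gcd j n mod n)" using n j by (intro aa) auto
    also have "\<dots> = (\<Sum>d | d dvd gcd j n. b d)" using n by (intro b) simp
    also have "\<dots> = (\<Sum>d | d dvd n. if d dvd j then b d else 0)"
      using n by (simp add: sum.inter_filter[symmetric]) (intro sum.cong, auto)
    finally show ?thesis .
  qed
  define H where "H d = generate G {g [^] (n div d)}" for d
  have H: "subgroup (H d) G" for d unfolding H_def using g(1) by (intro generate_is_subgroup) simp
  have permH: "perm_character G (H d) (g [^] k) = (\<Sum>j<n. if d dvd j then z ^ (j * k) else 0)"
    if d: "d dvd n" for d and k :: nat
  proof -
    obtain e where e: "n = d * e" using d by blast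
    have de: "d > 0" "e > 0" using e n by auto
    have ne: "n div d = e" using e de by simp
    have cardH: "card (H d) = d"
    proof -
      have "card (H d) = ord (g [^] e)" unfolding H_def ne using generate_pow_card[of "g [^] e"] g(1) by simp
      also have "\<dots> = n div e" using ord_pow[OF g(1), of e] e de by (simp add: n_def)
      finally show ?thesis using e de by simp
    qed
    have mem: "g [^] k \<in> H d \<longleftrightarrow> e dvd k"
    proof
      assume "g [^] k \<in> H d"
      then obtain l :: int where "g [^] k = (g [^] e) [^] l" unfolding H_def ne using generate_pow[of "g [^] e"] g(1) by auto
      then have "g [^] int k = g [^] (int e * l)" using int_pow_pow[OF g(1), of "int e" l] unfolding int_pow_int by simp
      then have "int n dvd int e * l - int k" unfolding int_pow_eq[OF g(1)] n_def .
      then have "int e dvd int e * l - int k" unfolding e by (metis dvd_mult_right of_nat_mult)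
      then have "int e dvd int k" by (metis dvd_diff_right_iff dvd_triv_left)
      then show "e dvd k" by simp
    next
      assume "e dvd k"
      then obtain l where "k = e * l" by blast
      then have "g [^] k = (g [^] e) [^] int l" unfolding int_pow_int using g(1) by (simp add: nat_pow_pow)
      then show "g [^] k \<in> H d" unfolding H_def ne using generate_pow[of "g [^] e"] g(1) by auto
    qed
    have "inv x \<otimes> (g [^] k) \<otimes> x = g [^] k" if "x \<in> carrier G" for x
      using that g(1) comm[of "g [^] k" x] by (simp add: m_assoc mult_inv_cancel)
    then have "perm_character G (H d) (g [^] k) = (if g [^] k \<in> H d then of_nat n / of_nat d else 0)"
      unfolding perm_character_eq_Ind[OF G H] using g(1) by (simp add: Ind_def Res_def cardG cardH)
    also have "\<dots> = (if e dvd k then of_nat e else 0)" unfolding mem using e de by simp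
    \<comment> \<open>The value e or 0 is the sum of the first e powers of the e-th root of unity
      z^(d k); its terms belong to the exponents j = d i.\<close>
    also have "\<dots> = (\<Sum>i<e. (z ^ (d * k)) ^ i)"
    proof -
      have "z ^ (d * k) = 1 \<longleftrightarrow> e dvd k"
        unfolding z_def cis_root_power_eq_1[OF n] using e de by simp
      moreover have "(z ^ (d * k)) ^ e = 1"
        using cis_root_power_eq_1[OF n, folded z_def, of "d * k * e"] by (simp add: power_mult[symmetric] e)
      ultimately show ?thesis using sum_root_of_unity_powers by simp
    qed
    also have "\<dots> = (\<Sum>i<e. z ^ (d * i * k))" by (intro sum.cong refl) (simp add: power_mult[symmetric] mult_ac)
    also have "\<dots> = (\<Sum>j\<in>{j\<in>{..<n}. d dvd j}. z ^ (j * k))"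
    proof (rule sum.reindex_bij_betw)
      show "bij_betw (\<lambda>i. d * i) {..<e} {j\<in>{..<n}. d dvd j}"
        using de unfolding e by (intro bij_betwI[where g = "\<lambda>j. j div d"]) auto
    qed
    also have "\<dots> = (\<Sum>j<n. if d dvd j then z ^ (j * k) else 0)" by (rule sum.inter_filter) simp
    finally show ?thesis .
  qed
  have eq: "\<chi> (g [^] k) = (\<Sum>d | d dvd n. of_int (b d) * perm_character G (H d) (g [^] k))" for k :: nat
  proof -
    have "\<chi> (g [^] k) = (\<Sum>j<n. \<Sum>d | d dvd n. of_int (b d) * (if d dvd j then z ^ (j * k) else 0))"
      unfolding a by (intro sum.cong refl) (simp add: aj sum_distrib_right, intro sum.cong, auto)
    also have "\<dots> = (\<Sum>d | d dvd n. of_int (b d) * (\<Sum>j<n. if d dvd j then z ^ (j * k) else 0))"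
      by (subst sum.swap) (simp add: sum_distrib_left)
    also have "\<dots> = (\<Sum>d | d dvd n. of_int (b d) * perm_character G (H d) (g [^] k))"
      using permH by (intro sum.cong refl) auto
    finally show ?thesis .
  qed
  have "\<chi> = (\<lambda>x. \<Sum>d | d dvd n. of_int (b d) * perm_character G (H d) x)"
  proof
    fix x
    show "\<chi> x = (\<Sum>d | d dvd n. of_int (b d) * perm_character G (H d) x)"
    proof (cases "x \<in> carrier G")
      case True
      then have "x \<in> range (\<lambda>n::int. g [^] n)" using g(2) by simp
      then obtain k :: nat where "x = g [^] k" by (rule cyclic_group_nat_powers[OF G g(1)])
      then show ?thesis using eq by simp
    next
      case False
      have "\<chi> \<in> carrier (class_functions G)"
        using subgroup.mem_carrier[OF mackey_closedD(1)[OF mackey_closed_Char_Q G] \<chi>] .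
      then show ?thesis using False class_function_outside by (simp add: perm_character_def)
    qed
  qed
  also have "\<dots> \<in> Perm G"
    using Perm_subgroup[OF G]
    by (intro subgroup_class_functions_sum subgroup_class_functions_scale perm_character_in_Perm H)
  finally show "\<chi> \<in> Perm G" .
qed

subsection \<open>Quasi-elementary groups\<close>

text \<open>The order of the q-group R is prime to |P|, so R lies in the cyclic normal subgroup C;
  hence R is cyclic, and conjugation in Q sends each element of R to a power of itself. As D is
  normal in H, commutators of D and R fall into their trivial intersection. So H is a product of two
  commuting cyclic groups of coprime orders.\<close>

lemma quasi_elementary_subgroup_cyclic:
  fixes Q :: "('a, 'b) monoid_scheme" (structure)
  assumes Q: "p_quasi_elementary p Q" and H: "subgroup H Q" "p_quasi_elementary q (Q\<lparr>carrier := H\<rparr>)"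
    and pq: "prime p" "prime q" "p \<noteq> q"
  shows "cyclic_group (Q\<lparr>carrier := H\<rparr>)"
proof -
  obtain C P k where G: "group Q" "finite (carrier Q)" and C: "C \<lhd> Q" "cyclic_group (Q\<lparr>carrier := C\<rparr>)"
    and P: "subgroup P Q" "card P = p ^ k" and CP: "C <#> P = carrier Q"
    using Q unfolding p_quasi_elementary_def by blast
  interpret group Q by (rule G)
  interpret H: subgroup H Q by (rule H)
  interpret C: normal C Q by (rule C)
  obtain D R l where D: "D \<lhd> Q\<lparr>carrier := H\<rparr>" "cyclic_group (Q\<lparr>carrier := H, carrier := D\<rparr>)" "coprime (card D) q"
    and R: "subgroup R (Q\<lparr>carrier := H\<rparr>)" "card R = q ^ l" and DR: "D \<inter> R = {\<one>}" "D <#>\<^bsub>Q\<lparr>carrier := H\<rparr>\<^esub> R = H"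
    using H(2) unfolding p_quasi_elementary_def by auto
  have DQ: "subgroup D Q" by (rule incl_subgroup[OF H(1) normal_imp_subgroup[OF D(1)]])
  have RQ: "subgroup R Q" by (rule incl_subgroup[OF H(1) R(1)])
  interpret D: subgroup D Q by (rule DQ)
  interpret R: subgroup R Q by (rule RQ)
  have DH: "D \<subseteq> H" using subgroup.subset[OF normal_imp_subgroup[OF D(1)]] by simp
  have RH: "R \<subseteq> H" using subgroup.subset[OF R(1)] by simp
  have RC: "R \<subseteq> C"
  proof
    fix r assume r: "r \<in> R"
    show "r \<in> C"
    proof (rule coprime_order_in_normal_factor[OF C.subgroup_axioms P(1)])
      show "finite P" by (rule finite_subset[OF subgroup.subset[OF P(1)] G(2)])
      show "r \<in> C <#> P" unfolding CP using r by simp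
      show "r [^] card R = \<one>" by (rule pow_card_subgroup[OF RQ r])
      show "coprime (card R) (card P)" unfolding R(2) P(2) using pq by (simp add: primes_coprime)
      show "u \<otimes> c \<otimes> inv u \<in> C" if "u \<in> P" "c \<in> C" for u c
        using C.inv_op_closed2 subgroup.mem_carrier[OF P(1)] that by blast
    qed
  qed
  obtain g where g: "g \<in> C" "C = range (\<lambda>n::int. g [^] n)"
    using C(2) cyclic_group_subgroup_iff[OF C.subgroup_axioms] by blast
  have gQ: "g \<in> carrier Q" using g(1) by simp
  obtain r where r: "r \<in> R" "R = range (\<lambda>n::int. r [^] n)"
    by (rule cyclic_subgroup_cyclic[OF G(2) gQ RQ]) (use RC g(2) in simp, rule that)
  obtain c where c: "c \<in> D" "D = range (\<lambda>n::int. c [^] n)"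
    using D(2) cyclic_group_subgroup_iff[OF DQ] by auto
  have comm: "d \<otimes> s = s \<otimes> d" if d: "d \<in> D" and s: "s \<in> R" for d s
  proof -
    have hom: "(\<lambda>z. d \<otimes> z \<otimes> inv d) \<in> hom Q Q"
      using d by (intro homI) (auto simp: m_assoc mult_inv_cancel)
    then interpret h: group_hom Q Q "\<lambda>z. d \<otimes> z \<otimes> inv d" by unfold_locales
    have "d \<otimes> g \<otimes> inv d \<in> C" using C.inv_op_closed2 g(1) d by simp
    then obtain i :: int where i: "d \<otimes> g \<otimes> inv d = g [^] i" using g(2) by auto
    obtain j :: int where j: "s = g [^] j" using s RC g(2) by blast
    have "d \<otimes> s \<otimes> inv d = (d \<otimes> g \<otimes> inv d) [^] j" unfolding j by (rule h.hom_int_pow[OF gQ])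
    also have "\<dots> = s [^] i" unfolding i j int_pow_pow[OF gQ] by (simp add: mult.commute)
    finally have 1: "d \<otimes> s \<otimes> inv d \<in> R" using subgroup_int_pow_closed[OF RQ s] by simp
    have "s \<otimes> inv d \<otimes> inv s \<in> D"
      using normal.inv_op_closed2[OF D(1), of s "inv d"] d s RH m_inv_consistent[OF H(1), of s] by auto
    then have "d \<otimes> (s \<otimes> inv d \<otimes> inv s) \<in> D" using d by simp
    moreover have "d \<otimes> (s \<otimes> inv d \<otimes> inv s) = (d \<otimes> s \<otimes> inv d) \<otimes> inv s" using d s by (simp add: m_assoc)
    moreover have "(d \<otimes> s \<otimes> inv d) \<otimes> inv s \<in> R" using 1 s by simp
    ultimately have "(d \<otimes> s \<otimes> inv d) \<otimes> inv s = \<one>" using DR(1) by auto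
    then have "d \<otimes> s \<otimes> inv d = s" using d s by (metis D.mem_carrier R.mem_carrier inv_closed inv_equality inv_inv m_closed)
    then show ?thesis using d s by (metis D.mem_carrier R.mem_carrier inv_closed inv_solve_right m_closed)
  qed
  define x where "x = c \<otimes> r"
  have xH: "x \<in> H" unfolding x_def using c(1) r(1) DH RH by blast
  have cQ: "c \<in> carrier Q" "r \<in> carrier Q" using c(1) r(1) by auto
  have "H = range (\<lambda>n::int. x [^] n)"
  proof (intro equalityI subsetI)
    fix h assume "h \<in> range (\<lambda>n::int. x [^] n)"
    then show "h \<in> H" using subgroup_int_pow_closed[OF H(1) xH] by blast
  next
    fix h assume "h \<in> H"
    then obtain d s where ds: "d \<in> D" "s \<in> R" "h = d \<otimes> s" using DR(2) unfolding set_mult_def by auto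
    obtain i j :: int where ij: "d = c [^] i" "s = r [^] j" using ds c(2) r(2) by auto
    have "coprime (int (card D)) (int (card R))" unfolding R(2) using D(3) by simp
    \<comment> \<open>With n = i modulo |D| and n = j modulo |R|, the n-th power of c r is c^i
      r^j.\<close>
    then obtain n :: int where n: "[n = i] (mod int (card D))" "[n = j] (mod int (card R))"
      using binary_chinese_remainder_int by blast
    have "ord c dvd card D" "ord r dvd card R" using pow_card_subgroup[OF DQ c(1)] pow_card_subgroup[OF RQ r(1)] cQ by (simp_all add: pow_eq_id)
    then have "int (ord c) dvd i - n" "int (ord r) dvd j - n"
      using n by (meson cong_iff_dvd_diff cong_sym dvd_trans int_dvd_int_iff)+
    then have "c [^] n = d" "r [^] n = s" unfolding ij using int_pow_eq cQ by blast+
    moreover have "x [^] n = c [^] n \<otimes> r [^] n" unfolding x_def by (rule int_pow_mult_distrib[OF comm[OF c(1) r(1)] cQ])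
    ultimately show "h \<in> range (\<lambda>n::int. x [^] n)" using ds(3) by (metis rangeI)
  qed
  then show ?thesis using cyclic_group_subgroup_iff[OF H(1)] xH by blast
qed

lemma mackey_decomposition:
  fixes G :: "'a monoid"
  assumes G: "group G" "finite (carrier G)" and F: "\<And>S. S \<in> F \<Longrightarrow> subgroup S G"
    and \<psi>: "\<And>S. S \<in> F \<Longrightarrow> \<psi> S \<in> Perm (G\<lparr>carrier := S\<rparr>)"
      "\<And>g. g \<in> carrier G \<Longrightarrow> (\<Sum>S\<in>F. Ind G S (\<psi> S) g) = of_nat m"
    and \<chi>: "\<chi> \<in> carrier (class_functions G)"
  shows "(\<lambda>g. of_nat m * \<chi> g) = (\<lambda>g. \<Sum>S\<in>F. Ind G S (\<lambda>h. \<psi> S h * Res S \<chi> h) g)"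
proof
  fix g
  have proj: "Ind G S (\<lambda>h. \<psi> S h * Res S \<chi> h) = (\<lambda>g. Ind G S (\<psi> S) g * \<chi> g)" if S: "S \<in> F" for S
  proof (rule Ind_projection[OF G(1) \<chi>])
    have GS: "group (G\<lparr>carrier := S\<rparr>)" "finite (carrier (G\<lparr>carrier := S\<rparr>))"
      using subgroup.subgroup_is_group[OF F[OF S] G(1)] finite_subset[OF subgroup.subset[OF F[OF S]] G(2)] by auto
    show "\<psi> S h = 0" if "h \<notin> S" for h
      using class_function_outside[OF subgroup.mem_carrier[OF Perm_subgroup[OF GS] \<psi>(1)[OF S]]] that by simp
  qed
  then have "(\<Sum>S\<in>F. Ind G S (\<lambda>h. \<psi> S h * Res S \<chi> h) g) = (\<Sum>S\<in>F. Ind G S (\<psi> S) g) * \<chi> g"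
    by (simp add: sum_distrib_right)
  then show "of_nat m * \<chi> g = (\<Sum>S\<in>F. Ind G S (\<lambda>h. \<psi> S h * Res S \<chi> h) g)"
    using \<psi>(2)[of g] class_function_outside[OF \<chi>, of g] by (cases "g \<in> carrier G") auto
qed

lemma quasi_elementary_exponent:
  fixes Q :: "'a monoid"
  assumes Q: "p_quasi_elementary p Q" and p: "prime p"
  obtains k where "\<And>\<chi>. \<chi> \<in> Char_Q Q \<Longrightarrow> (\<lambda>g. of_nat (p ^ k) * \<chi> g) \<in> Perm Q"
proof -
  have G: "group Q" "finite (carrier Q)" using Q by (simp_all add: p_quasi_elementary_def)
  note P = Perm_subgroup[OF G]
  interpret group Q by (rule G)
  \<comment> \<open>The integers that kill Char_Q(Q) / Perm(Q). They are closed under taking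
    remainders, so all are multiples of the least positive one, \<open>e\<close>.\<close>
  define I where "I m \<longleftrightarrow> (\<forall>\<chi>\<in>Char_Q Q. (\<lambda>g. of_nat m * \<chi> g) \<in> Perm Q)" for m :: nat
  have other: "\<exists>m. coprime m q \<and> I m" if q: "prime q" "q \<noteq> p" for q
  proof -
    let ?F = "{S. subgroup S Q \<and> cyclic_group (Q\<lparr>carrier := S\<rparr>)}"
    obtain m :: nat and \<psi> where m: "coprime m q" "\<And>S. S \<in> ?F \<Longrightarrow> \<psi> S \<in> Perm (Q\<lparr>carrier := S\<rparr>)"
      "\<And>g. g \<in> carrier Q \<Longrightarrow> (\<Sum>S\<in>?F. Ind Q S (\<psi> S) g) = of_nat m"
    proof (rule solomon_induction[OF G q(1), of ?F])
      fix H assume H: "subgroup H Q" "p_quasi_elementary q (Q\<lparr>carrier := H\<rparr>)"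
      have "H \<in> ?F" using quasi_elementary_subgroup_cyclic[OF Q H p q(1)] q(2) H(1) by blast
      moreover have "(\<lambda>h. \<one>\<^bsub>Q\<^esub> \<otimes>\<^bsub>Q\<^esub> h \<otimes>\<^bsub>Q\<^esub> inv\<^bsub>Q\<^esub> \<one>\<^bsub>Q\<^esub>) ` H \<subseteq> H"
        using subgroup.mem_carrier[OF H(1)] by auto
      ultimately show "\<exists>S\<in>?F. \<exists>g\<in>carrier Q. (\<lambda>h. g \<otimes>\<^bsub>Q\<^esub> h \<otimes>\<^bsub>Q\<^esub> inv\<^bsub>Q\<^esub> g) ` H \<subseteq> S"
        using one_closed by blast
    qed (blast, rule that)
    have "I m"
      unfolding I_def
    proof
      fix \<chi> assume \<chi>: "\<chi> \<in> Char_Q Q"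
      have \<chi>c: "\<chi> \<in> carrier (class_functions Q)"
        by (rule subgroup.mem_carrier[OF mackey_closedD(1)[OF mackey_closed_Char_Q G] \<chi>])
      have "Ind Q S (\<lambda>h. \<psi> S h * Res S \<chi> h) \<in> Perm Q" if S: "S \<in> ?F" for S
      proof -
        have SQ: "subgroup S Q" using S by blast
        have GS: "group (Q\<lparr>carrier := S\<rparr>)" "finite (carrier (Q\<lparr>carrier := S\<rparr>))"
          using subgroup_imp_group[OF SQ] finite_subset[OF subgroup.subset[OF SQ] G(2)] by auto
        have "Res S \<chi> \<in> Perm (Q\<lparr>carrier := S\<rparr>)"
          using mackey_closedD(2)[OF mackey_closed_Char_Q G SQ \<chi>] Char_Q_cyclic_subset_Perm[OF GS] S by blast
        then have "(\<lambda>h. \<psi> S h * Res S \<chi> h) \<in> Perm (Q\<lparr>carrier := S\<rparr>)"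
          by (rule mackey_closed_Perm_mult[OF mackey_closed_Perm GS _ m(2)[OF S]])
        then show ?thesis by (rule Perm_Ind[OF G SQ])
      qed
      then have "(\<lambda>g. \<Sum>S\<in>?F. Ind Q S (\<lambda>h. \<psi> S h * Res S \<chi> h) g) \<in> Perm Q"
        by (rule subgroup_class_functions_sum[OF P])
      moreover have "(\<lambda>g. of_nat m * \<chi> g) = (\<lambda>g. \<Sum>S\<in>?F. Ind Q S (\<lambda>h. \<psi> S h * Res S \<chi> h) g)"
        by (rule mackey_decomposition[OF G _ m(2,3) \<chi>c]) auto
      ultimately show "(\<lambda>g. of_nat m * \<chi> g) \<in> Perm Q" by simp
    qed
    then show ?thesis using m(1) by blast
  qed
  define e where "e = (LEAST m. m > 0 \<and> I m)"
  \<comment> \<open>Any prime other than p provides a positive annihilator, so that the minimum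
    exists.\<close>
  obtain q :: nat where q: "prime q" "q \<noteq> p"
    using bigger_prime[of p] by auto
  obtain m0 where "coprime m0 q" "I m0" using other[OF q] by blast
  then have "m0 > 0 \<and> I m0" using q(1) by (cases "m0 = 0") auto
  then have e: "e > 0" "I e" unfolding e_def by (metis (mono_tags, lifting) LeastI)+
  have dvd: "e dvd m" if m: "I m" for m
  proof -
    have "I (m mod e)"
      unfolding I_def
    proof
      fix \<chi> assume \<chi>: "\<chi> \<in> Char_Q Q"
      have "(\<lambda>g. of_nat m * \<chi> g + of_int (- int (m div e)) * (of_nat e * \<chi> g)) \<in> Perm Q"
        using m e(2) \<chi> unfolding I_def
        by (intro subgroup_class_functions_add[OF P] subgroup_class_functions_scale[OF P]) auto
      moreover have "of_nat m * x + of_int (- int (m div e)) * (of_nat e * x) = of_nat (m mod e) * x" for x :: complex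
      proof -
        have "of_nat m = (of_nat (m div e) * of_nat e + of_nat (m mod e) :: complex)"
          by (metis div_mult_mod_eq of_nat_add of_nat_mult)
        then show ?thesis by (simp add: algebra_simps)
      qed
      ultimately show "(\<lambda>g. of_nat (m mod e) * \<chi> g) \<in> Perm Q" by simp
    qed
    moreover have "\<not> (0 < m mod e \<and> I (m mod e))"
      using not_less_Least[of "m mod e" "\<lambda>m. m > 0 \<and> I m"] mod_less_divisor[OF e(1), of m] unfolding e_def[symmetric] by blast
    ultimately show ?thesis by (simp add: dvd_eq_mod_eq_0)
  qed
  obtain k l where kl: "e = p ^ k * l" "\<not> p dvd l" by (rule prime_power_factorization[of e p]) (use e p in auto)
  \<comment> \<open>A prime factor q of l would differ from p; but some annihilator is prime to q,
    and e divides it.\<close>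
  have "l = 1"
  proof (rule ccontr)
    assume "l \<noteq> 1"
    then obtain q where q: "prime q" "q dvd l" using prime_factor_nat by blast
    then obtain m where "coprime m q" "I m" using other[of q] kl(2) by blast
    moreover have "q dvd m" using dvd[OF \<open>I m\<close>] q(2) kl(1) by (meson dvd_trans dvd_triv_right)
    ultimately show False using q(1) by (metis coprime_common_divisor dvd_refl not_prime_unit)
  qed
  then show thesis using that e(2) kl(1) unfolding I_def by auto
qed

subsection \<open>Passing to tensor products\<close>

lemma finprod_of_homs:
  assumes A: "group A" and B: "comm_group B" and h: "\<And>i. i \<in> I \<Longrightarrow> h i \<in> hom A B"
  shows "(\<lambda>t. finprod B (\<lambda>i. h i t) I) \<in> hom A B"
proof -
  interpret B: comm_group B by fact
  have c: "(\<lambda>i. h i t) \<in> I \<rightarrow> carrier B" if "t \<in> carrier A" for t using hom_in_carrier[OF h that] by blast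
  show ?thesis
  proof (rule homI)
    fix x y assume xy: "x \<in> carrier A" "y \<in> carrier A"
    have "finprod B (\<lambda>i. h i (x \<otimes>\<^bsub>A\<^esub> y)) I = finprod B (\<lambda>i. h i x \<otimes>\<^bsub>B\<^esub> h i y) I"
      by (rule B.finprod_cong') (use hom_mult[OF h xy] c[OF xy(1)] c[OF xy(2)] in auto)
    also have "\<dots> = finprod B (\<lambda>i. h i x) I \<otimes>\<^bsub>B\<^esub> finprod B (\<lambda>i. h i y) I"
      by (rule B.finprod_multf[OF c[OF xy(1)] c[OF xy(2)]])
    finally show "finprod B (\<lambda>i. h i (x \<otimes>\<^bsub>A\<^esub> y)) I = finprod B (\<lambda>i. h i x) I \<otimes>\<^bsub>B\<^esub> finprod B (\<lambda>i. h i y) I" .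
  qed (rule B.finprod_closed[OF c])
qed

text \<open>The situation before tensoring: \<open>f\<close> stands for \<open>alpha\<close>, and
  \<open>w S\<close> for multiplication by the character \<open>\<psi> S\<close> of Solomon's
  theorem. Here \<open>w S\<close> is a homomorphism so that it can be tensored; \<open>eq\<close>
  is then an identity between homomorphisms and carries over to pure tensors.\<close>

locale mackey_data =
  fixes A :: "('a, 'b) monoid_scheme" and F :: "'i set" and B :: "'i \<Rightarrow> ('c, 'd) monoid_scheme"
    and ind res w f and p m :: nat
  assumes A: "comm_group A" and F: "finite F" and B: "\<And>S. S \<in> F \<Longrightarrow> comm_group (B S)"
    and ind: "\<And>S. S \<in> F \<Longrightarrow> ind S \<in> hom (B S) A"
    and res: "\<And>S. S \<in> F \<Longrightarrow> res S \<in> hom A (B S)"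
    and w: "\<And>S. S \<in> F \<Longrightarrow> w S \<in> hom (B S) (B S)"
    and f: "\<And>S T x. S \<in> F \<Longrightarrow> T \<in> F \<Longrightarrow> x \<in> carrier (B S) \<Longrightarrow> f S T x = res T (ind S x)"
    and p: "p > 0" and m: "coprime m p"
    and eq: "\<And>a. a \<in> carrier A \<Longrightarrow> a [^]\<^bsub>A\<^esub> m = finprod A (\<lambda>S. ind S (w S (res S a))) F"
begin

abbreviation Z where "Z \<equiv> add_monoid (padic_integers p)"
abbreviation TA where "TA \<equiv> tensor_Zp p A"
abbreviation TB where "TB S \<equiv> tensor_Zp p (B S)"
abbreviation tind where "tind S \<equiv> map_Zp p A (ind S)"
abbreviation tres where "tres S \<equiv> map_Zp p (B S) (res S)"
abbreviation tw where "tw S \<equiv> map_Zp p (B S) (w S)"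
abbreviation tf where "tf S T \<equiv> map_Zp p (B T) (f S T)"

lemma Z: "comm_group Z" by (rule comm_group_Zp[OF p])
lemma TA: "comm_group TA" by (rule comm_group_tensor_Zp[OF A p])
lemma TB: "S \<in> F \<Longrightarrow> comm_group (TB S)" by (rule comm_group_tensor_Zp[OF B p])

lemma f_hom:
  assumes ST: "S \<in> F" "T \<in> F" shows "f S T \<in> hom (B S) (B T)"
proof (rule homI)
  interpret BS: comm_group "B S" by (rule B[OF ST(1)])
  note h = hom_compose[OF ind[OF ST(1)] res[OF ST(2)]]
  fix x assume x: "x \<in> carrier (B S)"
  show "f S T x \<in> carrier (B T)" using hom_in_carrier[OF h x] f[OF ST x] by simp
  fix y assume y: "y \<in> carrier (B S)"
  show "f S T (x \<otimes>\<^bsub>B S\<^esub> y) = f S T x \<otimes>\<^bsub>B T\<^esub> f S T y"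
    using hom_mult[OF h x y] f[OF ST] x y by simp
qed

lemma tind_hom: "S \<in> F \<Longrightarrow> tind S \<in> hom (TB S) TA" by (rule tensor_map_hom[OF B A Z ind])
lemma tres_hom: "S \<in> F \<Longrightarrow> tres S \<in> hom TA (TB S)" by (rule tensor_map_hom[OF A B Z res])
lemma tw_hom: "S \<in> F \<Longrightarrow> tw S \<in> hom (TB S) (TB S)" by (rule tensor_map_hom[OF B B Z w])
lemma tf_hom: "S \<in> F \<Longrightarrow> T \<in> F \<Longrightarrow> tf S T \<in> hom (TB S) (TB T)" by (rule tensor_map_hom[OF B B Z f_hom])

lemmas hom_in = hom_in_carrier[OF ind] hom_in_carrier[OF res] hom_in_carrier[OF w] hom_in_carrier[OF f_hom]

lemma tf_eq:
  assumes ST: "S \<in> F" "T \<in> F" and x: "x \<in> carrier (TB S)"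
  shows "tf S T x = tres T (tind S x)"
proof (rule tensor_hom_eqI[OF B[OF ST(1)] Z comm_group.axioms(2)[OF TB[OF ST(2)]] tf_hom[OF ST] _ _ x])
  show "(\<lambda>x. tres T (tind S x)) \<in> hom (TB S) (TB T)"
    using hom_compose[OF tind_hom[OF ST(1)] tres_hom[OF ST(2)]] by (simp add: comp_def)
  fix a b assume ab: "a \<in> carrier (B S)" "b \<in> carrier Z"
  show "tf S T (pure_tensor (B S) Z a b) = tres T (tind S (pure_tensor (B S) Z a b))"
    unfolding tensor_map_pure[OF B[OF ST(1)] B[OF ST(2)] Z f_hom[OF ST] ab]
      tensor_map_pure[OF B[OF ST(1)] A Z ind[OF ST(1)] ab]
      tensor_map_pure[OF A B[OF ST(2)] Z res[OF ST(2)] hom_in(1)[OF ST(1) ab(1)] ab(2)] f[OF ST ab(1)] ..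
qed

lemma t_eq:
  assumes t: "t \<in> carrier TA"
  shows "t [^]\<^bsub>TA\<^esub> m = finprod TA (\<lambda>S. tind S (tw S (tres S t))) F"
proof (rule tensor_hom_eqI[OF A Z comm_group.axioms(2)[OF TA] nat_pow_hom[OF TA] _ _ t])
  show "(\<lambda>t. finprod TA (\<lambda>S. tind S (tw S (tres S t))) F) \<in> hom TA TA"
  proof (rule finprod_of_homs[OF comm_group.axioms(2)[OF TA] TA])
    fix S assume S: "S \<in> F"
    show "(\<lambda>t. tind S (tw S (tres S t))) \<in> hom TA TA"
      using hom_compose[OF hom_compose[OF tres_hom[OF S] tw_hom[OF S]] tind_hom[OF S]] by (simp add: comp_def)
  qed
  fix a b assume ab: "a \<in> carrier A" "b \<in> carrier Z"
  interpret TA: comm_group TA by (rule TA)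
  interpret l: group_hom A TA "\<lambda>a. pure_tensor A Z a b"
    using pure_tensor_hom_left[OF A Z ab(2)] A TA by (simp add: group_hom_def group_hom_axioms_def comm_group_def)
  have c: "ind S (w S (res S a)) \<in> carrier A" if "S \<in> F" for S using hom_in that ab(1) by blast
  have "pure_tensor A Z a b [^]\<^bsub>TA\<^esub> m = pure_tensor A Z (a [^]\<^bsub>A\<^esub> m) b" by (rule l.hom_nat_pow[OF ab(1), symmetric])
  also have "\<dots> = finprod TA (\<lambda>S. pure_tensor A Z (ind S (w S (res S a))) b) F"
    unfolding eq[OF ab(1)] by (rule hom_finprod[OF A TA l.homh F]) (use c in blast)
  also have "\<dots> = finprod TA (\<lambda>S. tind S (tw S (tres S (pure_tensor A Z a b)))) F"
  proof (rule TA.finprod_cong'[OF refl])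
    fix S assume S: "S \<in> F"
    show "pure_tensor A Z (ind S (w S (res S a))) b = tind S (tw S (tres S (pure_tensor A Z a b)))"
      unfolding tensor_map_pure[OF A B[OF S] Z res[OF S] ab]
        tensor_map_pure[OF B[OF S] B[OF S] Z w[OF S] hom_in(2)[OF S ab(1)] ab(2)]
        tensor_map_pure[OF B[OF S] A Z ind[OF S] hom_in(3)[OF S hom_in(2)[OF S ab(1)]] ab(2)] ..
  next
    have "tind S (tw S (tres S (pure_tensor A Z a b))) \<in> carrier TA" if "S \<in> F" for S
      using hom_in_carrier[OF tind_hom[OF that]] hom_in_carrier[OF tw_hom[OF that]] hom_in_carrier[OF tres_hom[OF that]]
        pure_tensor_closed[of a A b Z] ab by blast
    then show "(\<lambda>S. tind S (tw S (tres S (pure_tensor A Z a b)))) \<in> F \<rightarrow> carrier TA" by blast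
  qed
  finally show "pure_tensor A Z a b [^]\<^bsub>TA\<^esub> m = finprod TA (\<lambda>S. tind S (tw S (tres S (pure_tensor A Z a b)))) F" .
qed

text \<open>In the second part, testing all tensors reduces to testing a (x) 1: pure tensors
  generate, and f(a) (x) b is b times f(a) (x) 1.\<close>

lemma tensor_iso:
  "TA \<cong> image_group (prod_sum_map F TB tf) (product_group F TB) (product_group F TB)"
  and tensor_trivial: "trivial_group TA \<longleftrightarrow> (\<forall>S\<in>F. \<forall>T\<in>F. \<forall>a\<in>carrier (B S). to_tensor_Zp p (B T) (f S T a) = \<one>\<^bsub>TB T\<^esub>)"
proof -
  obtain h where h: "\<And>t. t \<in> carrier TA \<Longrightarrow> h t \<in> carrier TA"
    "\<And>t. t \<in> carrier TA \<Longrightarrow> h t [^]\<^bsub>TA\<^esub> m = t" "\<And>t. t \<in> carrier TA \<Longrightarrow> h (t [^]\<^bsub>TA\<^esub> m) = t"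
    by (rule tensor_Zp_pow_bij[OF A p m]) (rule that)
  have w1: "tw S \<one>\<^bsub>TB S\<^esub> = \<one>\<^bsub>TB S\<^esub>" if "S \<in> F" for S
    using hom_one[OF tw_hom[OF that]] TB[OF that] by (simp add: comm_group_def)
  note main = is_iso_image_group[OF TA F TB tind_hom tres_hom hom_in_carrier[OF tw_hom] w1 tf_eq h t_eq]
  show "TA \<cong> image_group (prod_sum_map F TB tf) (product_group F TB) (product_group F TB)"
    by (rule main(1))
  have "(\<forall>x\<in>carrier (TB S). tf S T x = \<one>\<^bsub>TB T\<^esub>) \<longleftrightarrow> (\<forall>a\<in>carrier (B S). to_tensor_Zp p (B T) (f S T a) = \<one>\<^bsub>TB T\<^esub>)"
    if ST: "S \<in> F" "T \<in> F" for S T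
  proof
    note one = Zp_one_closed[OF p]
    assume l: "\<forall>x\<in>carrier (TB S). tf S T x = \<one>\<^bsub>TB T\<^esub>"
    show "\<forall>a\<in>carrier (B S). to_tensor_Zp p (B T) (f S T a) = \<one>\<^bsub>TB T\<^esub>"
    proof
      fix a assume a: "a \<in> carrier (B S)"
      show "to_tensor_Zp p (B T) (f S T a) = \<one>\<^bsub>TB T\<^esub>"
        using l pure_tensor_closed[OF a one] tensor_map_pure[OF B[OF ST(1)] B[OF ST(2)] Z f_hom[OF ST] a one] by metis
    qed
  next
    assume r: "\<forall>a\<in>carrier (B S). to_tensor_Zp p (B T) (f S T a) = \<one>\<^bsub>TB T\<^esub>"
    interpret TBT: comm_group "TB T" by (rule TB[OF ST(2)])
    show "\<forall>x\<in>carrier (TB S). tf S T x = \<one>\<^bsub>TB T\<^esub>"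
    proof
      fix x assume x: "x \<in> carrier (TB S)"
      show "tf S T x = \<one>\<^bsub>TB T\<^esub>"
      proof (rule tensor_hom_eqI[OF B[OF ST(1)] Z TBT.is_group tf_hom[OF ST] _ _ x])
        show "(\<lambda>_. \<one>\<^bsub>TB T\<^esub>) \<in> hom (TB S) (TB T)"
          by (intro homI TBT.one_closed TBT.r_one[OF TBT.one_closed, symmetric])
        fix a b assume ab: "a \<in> carrier (B S)" "b \<in> carrier Z"
        show "tf S T (pure_tensor (B S) Z a b) = \<one>\<^bsub>TB T\<^esub>"
          unfolding tensor_map_pure[OF B[OF ST(1)] B[OF ST(2)] Z f_hom[OF ST] ab]
          by (rule to_tensor_Zp_trivial[OF B[OF ST(2)] p hom_in(4)[OF ST ab(1)] ab(2)]) (use r ab(1) in blast)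
      qed
    qed
  qed
  then show "trivial_group TA \<longleftrightarrow> (\<forall>S\<in>F. \<forall>T\<in>F. \<forall>a\<in>carrier (B S). to_tensor_Zp p (B T) (f S T a) = \<one>\<^bsub>TB T\<^esub>)"
    using main(2) by simp
qed

text \<open>Where a power of p kills \<open>B S\<close>, the map a -> a (x) 1 identifies
  \<open>B S\<close> with \<open>TB S\<close>. Composing induction and restriction with these
  identifications \<tau> and their inverses \<sigma> leaves f unchanged, so
  \<open>is_iso_image_group\<close> applies to \<open>TA\<close> with untensored targets.\<close>

lemma torsion_iso:
  assumes e: "\<And>S. S \<in> F \<Longrightarrow> \<exists>k. \<forall>a\<in>carrier (B S). a [^]\<^bsub>B S\<^esub> (p ^ k) = \<one>\<^bsub>B S\<^esub>"
  shows "TA \<cong> image_group (prod_sum_map F B f) (product_group F B) (product_group F B)"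
  and "trivial_group TA \<longleftrightarrow> (\<forall>S\<in>F. \<forall>T\<in>F. \<forall>a\<in>carrier (B S). f S T a = \<one>\<^bsub>B T\<^esub>)"
proof -
  note one = Zp_one_closed[OF p]
  define \<tau> where "\<tau> S = to_tensor_Zp p (B S)" for S
  define \<sigma> where "\<sigma> S = inv_into (carrier (B S)) (\<tau> S)" for S
  have \<tau>iso: "\<tau> S \<in> iso (B S) (TB S)" if S: "S \<in> F" for S
  proof -
    obtain k where "\<forall>a\<in>carrier (B S). a [^]\<^bsub>B S\<^esub> (p ^ k) = \<one>\<^bsub>B S\<^esub>" using e[OF S] by blast
    then show ?thesis unfolding \<tau>_def by (intro to_tensor_Zp_iso[OF B[OF S] p]) blast
  qed
  have \<tau>: "\<tau> S \<in> hom (B S) (TB S)" if "S \<in> F" for S using \<tau>iso[OF that] by (simp add: iso_def)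
  have \<sigma>: "\<sigma> S \<in> hom (TB S) (B S)" if "S \<in> F" for S
    using group.iso_set_sym[OF comm_group.axioms(2)[OF B[OF that]] \<tau>iso[OF that]] unfolding \<sigma>_def by (simp add: iso_def)
  have bij: "bij_betw (\<tau> S) (carrier (B S)) (carrier (TB S))" if "S \<in> F" for S using \<tau>iso[OF that] by (simp add: iso_def)
  have \<sigma>\<tau>: "\<sigma> S (\<tau> S x) = x" if "S \<in> F" "x \<in> carrier (B S)" for S x
    unfolding \<sigma>_def by (rule inv_into_f_f[OF bij_betw_imp_inj_on[OF bij[OF that(1)]] that(2)])
  have \<tau>\<sigma>: "\<tau> S (\<sigma> S y) = y" if "S \<in> F" "y \<in> carrier (TB S)" for S y
    unfolding \<sigma>_def by (rule f_inv_into_f) (use bij_betw_imp_surj_on[OF bij[OF that(1)]] that(2) in simp)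
  obtain h where h: "\<And>t. t \<in> carrier TA \<Longrightarrow> h t \<in> carrier TA"
    "\<And>t. t \<in> carrier TA \<Longrightarrow> h t [^]\<^bsub>TA\<^esub> m = t" "\<And>t. t \<in> carrier TA \<Longrightarrow> h (t [^]\<^bsub>TA\<^esub> m) = t"
    by (rule tensor_Zp_pow_bij[OF A p m]) (rule that)
  have ind': "(\<lambda>x. tind S (\<tau> S x)) \<in> hom (B S) TA" if "S \<in> F" for S
    using hom_compose[OF \<tau>[OF that] tind_hom[OF that]] by (simp add: comp_def)
  have res': "(\<lambda>t. \<sigma> S (tres S t)) \<in> hom TA (B S)" if "S \<in> F" for S
    using hom_compose[OF tres_hom[OF that] \<sigma>[OF that]] by (simp add: comp_def)
  have w1: "w S \<one>\<^bsub>B S\<^esub> = \<one>\<^bsub>B S\<^esub>" if "S \<in> F" for S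
    using hom_one[OF w[OF that]] B[OF that] by (simp add: comm_group_def)
  have f': "f S T x = \<sigma> T (tres T (tind S (\<tau> S x)))" if ST: "S \<in> F" "T \<in> F" and x: "x \<in> carrier (B S)" for S T x
  proof -
    have "tres T (tind S (\<tau> S x)) = tf S T (\<tau> S x)" by (rule tf_eq[OF ST hom_in_carrier[OF \<tau>[OF ST(1)] x], symmetric])
    also have "\<dots> = \<tau> T (f S T x)"
      unfolding \<tau>_def by (rule tensor_map_pure[OF B[OF ST(1)] B[OF ST(2)] Z f_hom[OF ST] x one])
    finally show ?thesis using \<sigma>\<tau>[OF ST(2) hom_in(4)[OF ST x]] by simp
  qed
  have eq': "t [^]\<^bsub>TA\<^esub> m = finprod TA (\<lambda>S. tind S (\<tau> S (w S (\<sigma> S (tres S t))))) F" if t: "t \<in> carrier TA" for t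
    unfolding t_eq[OF t]
  proof (rule comm_monoid.finprod_cong'[OF comm_group.axioms(1)[OF TA] refl])
    fix S assume S: "S \<in> F"
    have c: "tres S t \<in> carrier (TB S)" by (rule hom_in_carrier[OF tres_hom[OF S] t])
    have c': "\<sigma> S (tres S t) \<in> carrier (B S)" by (rule hom_in_carrier[OF \<sigma>[OF S] c])
    have "tw S (\<tau> S (\<sigma> S (tres S t))) = \<tau> S (w S (\<sigma> S (tres S t)))"
      unfolding \<tau>_def by (rule tensor_map_pure[OF B[OF S] B[OF S] Z w[OF S] c' one])
    then show "tind S (tw S (tres S t)) = tind S (\<tau> S (w S (\<sigma> S (tres S t))))" unfolding \<tau>\<sigma>[OF S c] by simp
  next
    have "tind S (\<tau> S (w S (\<sigma> S (tres S t)))) \<in> carrier TA" if S: "S \<in> F" for S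
      by (rule hom_in_carrier[OF ind'[OF S] hom_in(3)[OF S hom_in_carrier[OF res'[OF S] t]]])
    then show "(\<lambda>S. tind S (\<tau> S (w S (\<sigma> S (tres S t))))) \<in> F \<rightarrow> carrier TA" by blast
  qed
  note main = is_iso_image_group[OF TA F B ind' res' hom_in(3) w1 f' h eq']
  show "TA \<cong> image_group (prod_sum_map F B f) (product_group F B) (product_group F B)" by (rule main(1))
  show "trivial_group TA \<longleftrightarrow> (\<forall>S\<in>F. \<forall>T\<in>F. \<forall>a\<in>carrier (B S). f S T a = \<one>\<^bsub>B T\<^esub>)" by (rule main(2))
qed

end

subsection \<open>Quotients by permutation characters\<close>

text \<open>The common form of \<open>C_hat\<close> and \<open>C_rat\<close>, for R =
  \<open>Char_Q\<close> and R = \<open>R_Q\<close>.\<close>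

definition char_quotient :: "('a monoid \<Rightarrow> ('a \<Rightarrow> complex) set) \<Rightarrow> 'a monoid \<Rightarrow> ('a \<Rightarrow> complex) set monoid" where
  "char_quotient R G = (class_functions G)\<lparr>carrier := R G\<rparr> Mod Perm G"

locale character_ring =
  fixes R :: "'a monoid \<Rightarrow> ('a \<Rightarrow> complex) set"
  assumes mackey: "mackey_closed R"
    and Perm_subset: "\<And>G. group G \<Longrightarrow> finite (carrier G) \<Longrightarrow> Perm G \<subseteq> R G"
begin

lemma comm_group_R:
  assumes "group G" "finite (carrier G)" shows "comm_group ((class_functions G)\<lparr>carrier := R G\<rparr>)"
  by (rule group.group_comm_groupI[OF group.subgroup_imp_group[OF group_class_functions mackey_closedD(1)[OF mackey assms]]])
     (simp add: add.commute)

lemma Perm_subgroup_R: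
  assumes "group G" "finite (carrier G)" shows "subgroup (Perm G) ((class_functions G)\<lparr>carrier := R G\<rparr>)"
  by (rule group.subgroup_incl[OF group_class_functions Perm_subgroup mackey_closedD(1)[OF mackey] Perm_subset]) (use assms in auto)

lemma comm_group_char_quotient:
  assumes "group G" "finite (carrier G)" shows "comm_group (char_quotient R G)"
  unfolding char_quotient_def by (rule comm_group_FactGroup[OF comm_group_R[OF assms] Perm_subgroup_R[OF assms]])

lemma char_class_eq: "char_class G \<chi> = Perm G #>\<^bsub>(class_functions G)\<lparr>carrier := R G\<rparr>\<^esub> \<chi>"
  by (simp add: char_class_def r_coset_def)

lemma carrier_char_quotient: "carrier (char_quotient R G) = char_class G ` R G"
  unfolding char_quotient_def carrier_FactGroup char_class_eq[abs_def] by simp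

lemma one_char_quotient: "\<one>\<^bsub>char_quotient R G\<^esub> = Perm G"
  by (simp add: char_quotient_def)

lemma char_class_hom:
  assumes "group G" "finite (carrier G)"
  shows "char_class G \<in> hom ((class_functions G)\<lparr>carrier := R G\<rparr>) (char_quotient R G)"
proof -
  interpret comm_group "(class_functions G)\<lparr>carrier := R G\<rparr>" by (rule comm_group_R[OF assms])
  interpret normal "Perm G" "(class_functions G)\<lparr>carrier := R G\<rparr>"
    using Perm_subgroup_R[OF assms] normal_iff_subgroup by blast
  show ?thesis unfolding char_class_eq[abs_def] char_quotient_def by (rule r_coset_hom_Mod)
qed

lemma char_class_eq_one_iff:
  assumes G: "group G" "finite (carrier G)" and \<chi>: "\<chi> \<in> R G"
  shows "char_class G \<chi> = \<one>\<^bsub>char_quotient R G\<^esub> \<longleftrightarrow> \<chi> \<in> Perm G"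
proof -
  interpret group "class_functions G" by (rule group_class_functions)
  note P = Perm_subgroup[OF G]
  have c: "\<chi> \<in> carrier (class_functions G)" by (rule subgroup.mem_carrier[OF mackey_closedD(1)[OF mackey G] \<chi>])
  show ?thesis
    unfolding one_char_quotient char_class_def
    using coset_join1[OF _ c P] coset_join2[OF c P] by blast
qed

lemma char_class_nat_pow:
  assumes G: "group G" "finite (carrier G)" and \<chi>: "\<chi> \<in> R G"
  shows "char_class G \<chi> [^]\<^bsub>char_quotient R G\<^esub> (n::nat) = char_class G (\<lambda>g. of_nat n * \<chi> g)"
proof -
  interpret group_hom "(class_functions G)\<lparr>carrier := R G\<rparr>" "char_quotient R G" "char_class G"
    using char_class_hom[OF G] comm_group_R[OF G] comm_group_char_quotient[OF G]
    by (simp add: group_hom_def group_hom_axioms_def comm_group_def)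
  have "\<chi> [^]\<^bsub>(class_functions G)\<lparr>carrier := R G\<rparr>\<^esub> n = (\<lambda>g. of_nat n * \<chi> g)"
    by (simp add: monoid.nat_pow_consistent[OF group.is_monoid[OF group_class_functions], symmetric] nat_pow_class_functions)
  then show ?thesis using hom_nat_pow[of \<chi> n] \<chi> by simp
qed

lemma char_class_sum:
  assumes G: "group G" "finite (carrier G)" and I: "finite I" and \<chi>: "\<And>i. i \<in> I \<Longrightarrow> \<chi> i \<in> R G"
  shows "finprod (char_quotient R G) (\<lambda>i. char_class G (\<chi> i)) I = char_class G (\<lambda>g. \<Sum>i\<in>I. \<chi> i g)"
  using I \<chi>
proof (induction I rule: finite_induct)
  interpret C: comm_group "char_quotient R G" by (rule comm_group_char_quotient[OF G])
  note R = mackey_closedD(1)[OF mackey G]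
  {
    case empty
    have "char_class G (\<lambda>g. 0) = \<one>\<^bsub>char_quotient R G\<^esub>"
      using char_class_eq_one_iff[OF G subgroup_class_functions_zero[OF R]]
        subgroup_class_functions_zero[OF Perm_subgroup[OF G]] by blast
    then show ?case by simp
  next
    case (insert i I)
    have c: "char_class G (\<chi> j) \<in> carrier (char_quotient R G)" if "j \<in> insert i I" for j
      unfolding carrier_char_quotient using insert.prems that by blast
    have s: "(\<lambda>g. \<Sum>i\<in>I. \<chi> i g) \<in> R G" using insert.prems by (intro subgroup_class_functions_sum[OF R]) auto
    have "finprod (char_quotient R G) (\<lambda>i. char_class G (\<chi> i)) (insert i I) =
      char_class G (\<chi> i) \<otimes>\<^bsub>char_quotient R G\<^esub> char_class G (\<lambda>g. \<Sum>i\<in>I. \<chi> i g)"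
      using insert c by (subst C.finprod_insert) auto
    also have "\<dots> = char_class G (\<lambda>g. \<chi> i g + (\<Sum>i\<in>I. \<chi> i g))"
      using hom_mult[OF char_class_hom[OF G], of "\<chi> i" "\<lambda>g. \<Sum>i\<in>I. \<chi> i g"] insert.prems s by simp
    finally show ?case using insert.hyps by simp
  }
qed

lemma char_quotient_map:
  assumes S: "group S" "finite (carrier S)" and G: "group G" "finite (carrier G)"
    and \<phi>: "\<phi> \<in> hom (class_functions S) (class_functions G)"
    and \<phi>P: "\<And>\<chi>. \<chi> \<in> Perm S \<Longrightarrow> \<phi> \<chi> \<in> Perm G" and \<phi>R: "\<And>\<chi>. \<chi> \<in> R S \<Longrightarrow> \<phi> \<chi> \<in> R G"
  defines "q \<equiv> quotient_map (class_functions G) (Perm G) \<phi>"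
  shows "\<And>\<chi>. \<chi> \<in> R S \<Longrightarrow> q (char_class S \<chi>) = char_class G (\<phi> \<chi>)"
    and "q \<in> hom (char_quotient R S) (char_quotient R G)"
proof -
  note RS = mackey_closedD(1)[OF mackey S] and RG = mackey_closedD(1)[OF mackey G]
  have c: "\<chi> \<in> carrier (class_functions S)" if "\<chi> \<in> R S" for \<chi> by (rule subgroup.mem_carrier[OF RS that])
  show q: "q (char_class S \<chi>) = char_class G (\<phi> \<chi>)" if "\<chi> \<in> R S" for \<chi>
    unfolding q_def char_class_def
    by (rule quotient_map_rcoset[OF group_class_functions group_class_functions \<phi> Perm_subgroup[OF S] Perm_subgroup[OF G] _ c[OF that]])
       (use \<phi>P in blast)
  show "q \<in> hom (char_quotient R S) (char_quotient R G)"
  proof (rule homI)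
    fix x assume "x \<in> carrier (char_quotient R S)"
    then obtain \<chi> where \<chi>: "\<chi> \<in> R S" "x = char_class S \<chi>" unfolding carrier_char_quotient by blast
    then show "q x \<in> carrier (char_quotient R G)" using q \<phi>R unfolding carrier_char_quotient by simp
    fix y assume "y \<in> carrier (char_quotient R S)"
    then obtain \<chi>' where \<chi>': "\<chi>' \<in> R S" "y = char_class S \<chi>'" unfolding carrier_char_quotient by blast
    have s: "(\<lambda>g. \<chi> g + \<chi>' g) \<in> R S" by (rule subgroup_class_functions_add[OF RS \<chi>(1) \<chi>'(1)])
    have "x \<otimes>\<^bsub>char_quotient R S\<^esub> y = char_class S (\<lambda>g. \<chi> g + \<chi>' g)"
      using hom_mult[OF char_class_hom[OF S], of \<chi> \<chi>'] \<chi> \<chi>' by simp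
    moreover have "\<phi> (\<lambda>g. \<chi> g + \<chi>' g) = (\<lambda>g. \<phi> \<chi> g + \<phi> \<chi>' g)"
      using hom_mult[OF \<phi> c[OF \<chi>(1)] c[OF \<chi>'(1)]] by simp
    moreover have "char_class G (\<lambda>g. \<phi> \<chi> g + \<phi> \<chi>' g) = char_class G (\<phi> \<chi>) \<otimes>\<^bsub>char_quotient R G\<^esub> char_class G (\<phi> \<chi>')"
      using hom_mult[OF char_class_hom[OF G], of "\<phi> \<chi>" "\<phi> \<chi>'"] \<phi>R \<chi>(1) \<chi>'(1) by simp
    ultimately show "q (x \<otimes>\<^bsub>char_quotient R S\<^esub> y) = q x \<otimes>\<^bsub>char_quotient R G\<^esub> q y"
      using q[OF s] q[OF \<chi>(1)] q[OF \<chi>'(1)] \<chi>(2) \<chi>'(2) by simp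
  qed
qed

lemma alpha_char_class:
  fixes G :: "'a monoid"
  assumes G: "group G" "finite (carrier G)" and S: "subgroup S G" and T: "subgroup T G" and \<chi>: "\<chi> \<in> R (G\<lparr>carrier := S\<rparr>)"
  shows "alpha G S T (char_class (G\<lparr>carrier := S\<rparr>) \<chi>) = char_class (G\<lparr>carrier := T\<rparr>) (Res T (Ind G S \<chi>))"
    and "Res T (Ind G S \<chi>) \<in> R (G\<lparr>carrier := T\<rparr>)"
    and "\<chi> \<in> Perm (G\<lparr>carrier := S\<rparr>) \<Longrightarrow> Res T (Ind G S \<chi>) \<in> Perm (G\<lparr>carrier := T\<rparr>)"
proof -
  have GS: "group (G\<lparr>carrier := U\<rparr>)" "finite (carrier (G\<lparr>carrier := U\<rparr>))" if "subgroup U G" for U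
    using subgroup.subgroup_is_group[OF that G(1)] finite_subset[OF subgroup.subset[OF that] G(2)] by auto
  note RG = mackey_closedD[OF mackey G] and PG = mackey_closedD[OF mackey_closed_Perm G]
  have mult: "monoid.mult (class_functions (G\<lparr>carrier := S\<rparr>)) = (\<lambda>f f' g. f g + f' g)"
    by (simp add: class_functions_def)
  have h: "(\<lambda>\<chi>. Res T (Ind G S \<chi>)) \<in> hom (class_functions (G\<lparr>carrier := S\<rparr>)) (class_functions (G\<lparr>carrier := T\<rparr>))"
    using Group.hom_compose[OF Ind_hom[OF G(1) mult] Res_hom[OF G(1) T]] by (simp add: comp_def)
  show "alpha G S T (char_class (G\<lparr>carrier := S\<rparr>) \<chi>) = char_class (G\<lparr>carrier := T\<rparr>) (Res T (Ind G S \<chi>))"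
    unfolding alpha_def
    by (rule char_quotient_map(1)[OF GS[OF S] GS[OF T] h _ _ \<chi>])
       (rule PG(2)[OF T PG(3)[OF S]], assumption, rule RG(2)[OF T RG(3)[OF S]], assumption)
  show "Res T (Ind G S \<chi>) \<in> R (G\<lparr>carrier := T\<rparr>)" by (rule RG(2)[OF T RG(3)[OF S \<chi>]])
  show "Res T (Ind G S \<chi>) \<in> Perm (G\<lparr>carrier := T\<rparr>)" if "\<chi> \<in> Perm (G\<lparr>carrier := S\<rparr>)"
    by (rule PG(2)[OF T PG(3)[OF S that]])
qed

text \<open>\<open>ind\<close> and \<open>res\<close> come from \<open>Ind\<close> and
  \<open>Res\<close>, and \<open>w S\<close> from multiplication by \<open>\<psi> S\<close>, which
  preserves R because R is a module over Perm. The identity required in the locale is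
  \<open>mackey_decomposition\<close> read modulo Perm.\<close>

lemma mackey_data_characters:
  fixes G :: "'a monoid"
  assumes G: "group G" "finite (carrier G)" and p: "prime p"
    and F: "\<And>Q. Q \<in> F \<Longrightarrow> subgroup Q G"
    and qe: "\<And>H. subgroup H G \<Longrightarrow> p_quasi_elementary p (G\<lparr>carrier := H\<rparr>) \<Longrightarrow>
           \<exists>Q\<in>F. \<exists>g\<in>carrier G. (\<lambda>h. g \<otimes>\<^bsub>G\<^esub> h \<otimes>\<^bsub>G\<^esub> inv\<^bsub>G\<^esub> g) ` H \<subseteq> Q"
  obtains ind res w m where
    "mackey_data (char_quotient R G) F (\<lambda>S. char_quotient R (G\<lparr>carrier := S\<rparr>)) ind res w (alpha G) p m"
proof -
  interpret group G by (rule G)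
  have finF: "finite F"
    using F subgroup.subset by (intro finite_subset[of F "Pow (carrier G)"]) (auto simp: G(2))
  have GS: "group (G\<lparr>carrier := S\<rparr>)" "finite (carrier (G\<lparr>carrier := S\<rparr>))" if "S \<in> F" for S
    using subgroup_imp_group[OF F[OF that]] finite_subset[OF subgroup.subset[OF F[OF that]] G(2)] by auto
  obtain m \<psi> where m: "coprime m p" and \<psi>: "\<And>S. S \<in> F \<Longrightarrow> \<psi> S \<in> Perm (G\<lparr>carrier := S\<rparr>)"
    "\<And>g. g \<in> carrier G \<Longrightarrow> (\<Sum>S\<in>F. Ind G S (\<psi> S) g) = of_nat m"
    by (rule solomon_induction[OF G p F qe]) (assumption | rule that)+
  have mult: "monoid.mult (class_functions S) = (\<lambda>f f' g. f g + f' g)" for S :: "'a monoid"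
    by (simp add: class_functions_def)
  define ind where "ind S = quotient_map (class_functions G) (Perm G) (Ind G S)" for S
  define res where "res S = quotient_map (class_functions (G\<lparr>carrier := S\<rparr>)) (Perm (G\<lparr>carrier := S\<rparr>)) (Res S)" for S
  define w where "w S = quotient_map (class_functions (G\<lparr>carrier := S\<rparr>)) (Perm (G\<lparr>carrier := S\<rparr>)) (\<lambda>\<chi> g. \<psi> S g * \<chi> g)" for S
  note RG = mackey_closedD[OF mackey G] and PG = mackey_closedD[OF mackey_closed_Perm G]
  have RInd: "Ind G S \<chi> \<in> R G" if "S \<in> F" "\<chi> \<in> R (G\<lparr>carrier := S\<rparr>)" for S \<chi> using RG(3)[OF F] that by blast
  have RRes: "Res S \<chi> \<in> R (G\<lparr>carrier := S\<rparr>)" if "S \<in> F" "\<chi> \<in> R G" for S \<chi> using RG(2)[OF F] that by blast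
  have PInd: "Ind G S \<chi> \<in> Perm G" if "S \<in> F" "\<chi> \<in> Perm (G\<lparr>carrier := S\<rparr>)" for S \<chi> using PG(3)[OF F] that by blast
  have PRes: "Res S \<chi> \<in> Perm (G\<lparr>carrier := S\<rparr>)" if "S \<in> F" "\<chi> \<in> Perm G" for S \<chi> using PG(2)[OF F] that by blast
  have hind: "Ind G S \<in> hom (class_functions (G\<lparr>carrier := S\<rparr>)) (class_functions G)" for S
    by (rule Ind_hom[OF G(1) mult])
  have hres: "Res S \<in> hom (class_functions G) (class_functions (G\<lparr>carrier := S\<rparr>))" if "S \<in> F" for S
    by (rule Res_hom[OF G(1) F[OF that]])
  have hw: "(\<lambda>\<chi> g. \<psi> S g * \<chi> g) \<in> hom (class_functions (G\<lparr>carrier := S\<rparr>)) (class_functions (G\<lparr>carrier := S\<rparr>))"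
    if S: "S \<in> F" for S
  proof (rule homI)
    fix f f'
    show "(\<lambda>g. \<psi> S g * (f \<otimes>\<^bsub>class_functions (G\<lparr>carrier := S\<rparr>)\<^esub> f') g) =
      (\<lambda>g. \<psi> S g * f g) \<otimes>\<^bsub>class_functions (G\<lparr>carrier := S\<rparr>)\<^esub> (\<lambda>g. \<psi> S g * f' g)"
      by (simp add: algebra_simps)
    assume f: "f \<in> carrier (class_functions (G\<lparr>carrier := S\<rparr>))"
    have "\<psi> S \<in> carrier (class_functions (G\<lparr>carrier := S\<rparr>))"
      by (rule subgroup.mem_carrier[OF Perm_subgroup[OF GS[OF S]] \<psi>(1)[OF S]])
    with f show "(\<lambda>g. \<psi> S g * f g) \<in> carrier (class_functions (G\<lparr>carrier := S\<rparr>))"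
      unfolding carrier_class_functions by simp
  qed
  have wR: "(\<lambda>g. \<psi> S g * \<chi> g) \<in> R (G\<lparr>carrier := S\<rparr>)" if "S \<in> F" "\<chi> \<in> R (G\<lparr>carrier := S\<rparr>)" for S \<chi>
    by (rule mackey_closed_Perm_mult[OF mackey GS[OF that(1)] that(2) \<psi>(1)[OF that(1)]])
  have wP: "(\<lambda>g. \<psi> S g * \<chi> g) \<in> Perm (G\<lparr>carrier := S\<rparr>)" if "S \<in> F" "\<chi> \<in> Perm (G\<lparr>carrier := S\<rparr>)" for S \<chi>
    by (rule mackey_closed_Perm_mult[OF mackey_closed_Perm GS[OF that(1)] that(2) \<psi>(1)[OF that(1)]])
  have ind: "\<And>\<chi>. \<chi> \<in> R (G\<lparr>carrier := S\<rparr>) \<Longrightarrow> ind S (char_class (G\<lparr>carrier := S\<rparr>) \<chi>) = char_class G (Ind G S \<chi>)"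
    "ind S \<in> hom (char_quotient R (G\<lparr>carrier := S\<rparr>)) (char_quotient R G)" if S: "S \<in> F" for S
    unfolding ind_def by (rule char_quotient_map[OF GS[OF S] G hind PInd[OF S] RInd[OF S]]; assumption)+
  have res: "\<And>\<chi>. \<chi> \<in> R G \<Longrightarrow> res S (char_class G \<chi>) = char_class (G\<lparr>carrier := S\<rparr>) (Res S \<chi>)"
    "res S \<in> hom (char_quotient R G) (char_quotient R (G\<lparr>carrier := S\<rparr>))" if S: "S \<in> F" for S
    unfolding res_def by (rule char_quotient_map[OF G GS[OF S] hres[OF S] PRes[OF S] RRes[OF S]]; assumption)+
  have w: "\<And>\<chi>. \<chi> \<in> R (G\<lparr>carrier := S\<rparr>) \<Longrightarrow>
      w S (char_class (G\<lparr>carrier := S\<rparr>) \<chi>) = char_class (G\<lparr>carrier := S\<rparr>) (\<lambda>g. \<psi> S g * \<chi> g)"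
    "w S \<in> hom (char_quotient R (G\<lparr>carrier := S\<rparr>)) (char_quotient R (G\<lparr>carrier := S\<rparr>))" if S: "S \<in> F" for S
    unfolding w_def by (rule char_quotient_map[OF GS[OF S] GS[OF S] hw[OF S] wP[OF S] wR[OF S]]; assumption)+
  have "mackey_data (char_quotient R G) F (\<lambda>S. char_quotient R (G\<lparr>carrier := S\<rparr>)) ind res w (alpha G) p m"
  proof (rule mackey_data.intro)
    show "comm_group (char_quotient R G)" by (rule comm_group_char_quotient[OF G])
    show "finite F" by (rule finF)
    show "p > 0" by (rule prime_gt_0_nat[OF p])
    show "coprime m p" by (rule m)
    show "comm_group (char_quotient R (G\<lparr>carrier := S\<rparr>))" if "S \<in> F" for S
      by (rule comm_group_char_quotient[OF GS[OF that]])
    show "ind S \<in> hom (char_quotient R (G\<lparr>carrier := S\<rparr>)) (char_quotient R G)" if "S \<in> F" for S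
      by (rule ind(2)[OF that])
    show "res S \<in> hom (char_quotient R G) (char_quotient R (G\<lparr>carrier := S\<rparr>))" if "S \<in> F" for S
      by (rule res(2)[OF that])
    show "w S \<in> hom (char_quotient R (G\<lparr>carrier := S\<rparr>)) (char_quotient R (G\<lparr>carrier := S\<rparr>))" if "S \<in> F" for S
      by (rule w(2)[OF that])
    show "alpha G S T x = res T (ind S x)" if ST: "S \<in> F" "T \<in> F" and x: "x \<in> carrier (char_quotient R (G\<lparr>carrier := S\<rparr>))" for S T x
    proof -
      obtain \<chi> where \<chi>: "\<chi> \<in> R (G\<lparr>carrier := S\<rparr>)" "x = char_class (G\<lparr>carrier := S\<rparr>) \<chi>"
        using x unfolding carrier_char_quotient by blast
      have "alpha G S T x = char_class (G\<lparr>carrier := T\<rparr>) (Res T (Ind G S \<chi>))"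
        unfolding \<chi>(2) by (rule alpha_char_class(1)[OF G F[OF ST(1)] F[OF ST(2)] \<chi>(1)])
      also have "\<dots> = res T (char_class G (Ind G S \<chi>))"
        using res(1)[OF ST(2) RInd[OF ST(1) \<chi>(1)]] by simp
      also have "char_class G (Ind G S \<chi>) = ind S x"
        unfolding \<chi>(2) using ind(1)[OF ST(1) \<chi>(1)] by simp
      finally show ?thesis .
    qed
    show "a [^]\<^bsub>char_quotient R G\<^esub> m = finprod (char_quotient R G) (\<lambda>S. ind S (w S (res S a))) F"
      if a: "a \<in> carrier (char_quotient R G)" for a
    proof -
      interpret C: comm_group "char_quotient R G" by (rule comm_group_char_quotient[OF G])
      obtain \<chi> where \<chi>: "\<chi> \<in> R G" "a = char_class G \<chi>" using a unfolding carrier_char_quotient by blast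
      have \<chi>c: "\<chi> \<in> carrier (class_functions G)" by (rule subgroup.mem_carrier[OF RG(1) \<chi>(1)])
      have cR: "Ind G S (\<lambda>h. \<psi> S h * Res S \<chi> h) \<in> R G" if "S \<in> F" for S
        by (rule RInd[OF that wR[OF that RRes[OF that \<chi>(1)]]])
      have "a [^]\<^bsub>char_quotient R G\<^esub> m = char_class G (\<lambda>g. of_nat m * \<chi> g)"
        unfolding \<chi>(2) by (rule char_class_nat_pow[OF G \<chi>(1)])
      also have "(\<lambda>g. of_nat m * \<chi> g) = (\<lambda>g. \<Sum>S\<in>F. Ind G S (\<lambda>h. \<psi> S h * Res S \<chi> h) g)"
        by (rule mackey_decomposition[OF G F \<psi> \<chi>c])
      also have "char_class G \<dots> = finprod (char_quotient R G) (\<lambda>S. char_class G (Ind G S (\<lambda>h. \<psi> S h * Res S \<chi> h))) F"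
        by (rule char_class_sum[OF G finF cR, symmetric])
      also have "\<dots> = finprod (char_quotient R G) (\<lambda>S. ind S (w S (res S a))) F"
      proof (rule C.finprod_cong'[OF refl])
        have e: "ind S (w S (res S a)) = char_class G (Ind G S (\<lambda>h. \<psi> S h * Res S \<chi> h))" if S: "S \<in> F" for S
        proof -
          have "res S a = char_class (G\<lparr>carrier := S\<rparr>) (Res S \<chi>)"
            unfolding \<chi>(2) by (rule res(1)[OF S \<chi>(1)])
          moreover have "w S (char_class (G\<lparr>carrier := S\<rparr>) (Res S \<chi>)) = char_class (G\<lparr>carrier := S\<rparr>) (\<lambda>h. \<psi> S h * Res S \<chi> h)"
            by (rule w(1)[OF S RRes[OF S \<chi>(1)]])
          moreover have "ind S (char_class (G\<lparr>carrier := S\<rparr>) (\<lambda>h. \<psi> S h * Res S \<chi> h)) = char_class G (Ind G S (\<lambda>h. \<psi> S h * Res S \<chi> h))"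
            by (rule ind(1)[OF S wR[OF S RRes[OF S \<chi>(1)]]])
          ultimately show ?thesis by simp
        qed
        then show "char_class G (Ind G S (\<lambda>h. \<psi> S h * Res S \<chi> h)) = ind S (w S (res S a))" if "S \<in> F" for S
          using that by simp
        show "(\<lambda>S. ind S (w S (res S a))) \<in> F \<rightarrow> carrier (char_quotient R G)"
          using e cR unfolding carrier_char_quotient by auto
      qed
      finally show ?thesis .
    qed
  qed
  then show thesis by (rule that)
qed

end

section \<open>The two character rings and the theorem\<close>

lemma character_ring_Char_Q: "character_ring Char_Q"
proof
  fix G :: "'a monoid" assume "group G" "finite (carrier G)"
  then show "Perm G \<subseteq> Char_Q G" using Perm_subset_R_Q R_Q_subset_Char_Q by blast
qed (rule mackey_closed_Char_Q)

lemma character_ring_R_Q: "character_ring R_Q"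
  by unfold_locales (auto simp: mackey_closed_R_Q dest: Perm_subset_R_Q)

theorem corollary3p2:
  fixes G :: "'a monoid" and p :: nat and F :: "'a set set"
    and R :: "'a monoid \<Rightarrow> ('a \<Rightarrow> complex) set"
    and C :: "'a monoid \<Rightarrow> ('a \<Rightarrow> complex) set monoid"
  assumes "group G" and "finite (carrier G)" and "prime p"
    and "\<And>Q. Q \<in> F \<Longrightarrow> subgroup Q G"
    and "\<And>H. subgroup H G \<Longrightarrow> p_quasi_elementary p (G\<lparr>carrier := H\<rparr>) \<Longrightarrow>
           \<exists>Q\<in>F. \<exists>g\<in>carrier G. (\<lambda>h. g \<otimes>\<^bsub>G\<^esub> h \<otimes>\<^bsub>G\<^esub> inv\<^bsub>G\<^esub> g) ` H \<subseteq> Q"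
    and "(R, C) \<in> {(Char_Q, C_hat), (R_Q, C_rat)}"
  shows
    "tensor_Zp p (C G) \<cong>
       image_group
         (prod_sum_map F (\<lambda>T. tensor_Zp p (C (G\<lparr>carrier := T\<rparr>)))
            (\<lambda>S T. map_Zp p (C (G\<lparr>carrier := T\<rparr>)) (alpha G S T)))
         (product_group F (\<lambda>S. tensor_Zp p (C (G\<lparr>carrier := S\<rparr>))))
         (product_group F (\<lambda>T. tensor_Zp p (C (G\<lparr>carrier := T\<rparr>))))
     \<and> (trivial_group (tensor_Zp p (C G)) \<longleftrightarrow>
         (\<forall>S\<in>F. \<forall>T\<in>F. \<forall>\<rho>\<in>R (G\<lparr>carrier := S\<rparr>).
            to_tensor_Zp p (C (G\<lparr>carrier := T\<rparr>))
              (char_class (G\<lparr>carrier := T\<rparr>) (Res T (Ind G S \<rho>)))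
            = \<one>\<^bsub>tensor_Zp p (C (G\<lparr>carrier := T\<rparr>))\<^esub>))
     \<and> (trivial_group (tensor_Zp p (C G)) \<longleftrightarrow>
         (\<forall>S\<in>F. \<forall>T\<in>F. \<forall>\<rho>\<in>R (G\<lparr>carrier := S\<rparr>).
            char_class (G\<lparr>carrier := S\<rparr>) \<rho> \<noteq> \<one>\<^bsub>C (G\<lparr>carrier := S\<rparr>)\<^esub> \<longrightarrow>
            to_tensor_Zp p (C (G\<lparr>carrier := T\<rparr>))
              (char_class (G\<lparr>carrier := T\<rparr>) (Res T (Ind G S \<rho>)))
            = \<one>\<^bsub>tensor_Zp p (C (G\<lparr>carrier := T\<rparr>))\<^esub>))
     \<and> ((\<forall>Q\<in>F. p_quasi_elementary p (G\<lparr>carrier := Q\<rparr>)) \<longrightarrow>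
         tensor_Zp p (C G) \<cong>
           image_group
             (prod_sum_map F (\<lambda>T. C (G\<lparr>carrier := T\<rparr>)) (alpha G))
             (product_group F (\<lambda>S. C (G\<lparr>carrier := S\<rparr>)))
             (product_group F (\<lambda>T. C (G\<lparr>carrier := T\<rparr>)))
         \<and> (trivial_group (tensor_Zp p (C G)) \<longleftrightarrow>
             (\<forall>S\<in>F. \<forall>T\<in>F. \<forall>\<rho>\<in>R (G\<lparr>carrier := S\<rparr>).
                Res T (Ind G S \<rho>) \<in> Perm (G\<lparr>carrier := T\<rparr>)))
         \<and> (trivial_group (tensor_Zp p (C G)) \<longleftrightarrow>
             (\<forall>S\<in>F. \<forall>T\<in>F. \<forall>\<rho>\<in>R (G\<lparr>carrier := S\<rparr>).
                char_class (G\<lparr>carrier := S\<rparr>) \<rho> \<noteq> \<one>\<^bsub>C (G\<lparr>carrier := S\<rparr>)\<^esub> \<longrightarrow>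
                Res T (Ind G S \<rho>) \<in> Perm (G\<lparr>carrier := T\<rparr>))))"
proof -
  note G = assms(1,2) and p = assms(3) and F = assms(4)
  have C: "C = char_quotient R"
    using assms(6) by (auto simp: fun_eq_iff char_quotient_def C_hat_def C_rat_def)
  interpret character_ring R
    using assms(6) character_ring_Char_Q character_ring_R_Q by auto
  \<comment> \<open>Transfers the p-power exponent, proved for Char_Q(H) / Perm(H), to R(H) /
    Perm(H).\<close>
  have R_Char: "R H \<subseteq> Char_Q H" if "group H" "finite (carrier H)" for H
    using assms(6) R_Q_subset_Char_Q[OF that] by auto
  have GS: "group (G\<lparr>carrier := S\<rparr>)" "finite (carrier (G\<lparr>carrier := S\<rparr>))" if "S \<in> F" for S
    using subgroup.subgroup_is_group[OF F[OF that] G(1)] finite_subset[OF subgroup.subset[OF F[OF that]] G(2)] by auto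
  obtain ind res w m where
    "mackey_data (char_quotient R G) F (\<lambda>S. char_quotient R (G\<lparr>carrier := S\<rparr>)) ind res w (alpha G) p m"
    by (rule mackey_data_characters[OF G p F assms(5)]) (assumption | rule that)+
  then interpret M: mackey_data "char_quotient R G" F "\<lambda>S. char_quotient R (G\<lparr>carrier := S\<rparr>)" ind res w "alpha G" p m .
  note \<alpha> = alpha_char_class[OF G F F]
  have one: "char_class (G\<lparr>carrier := S\<rparr>) \<chi> = \<one>\<^bsub>C (G\<lparr>carrier := S\<rparr>)\<^esub> \<longleftrightarrow> \<chi> \<in> Perm (G\<lparr>carrier := S\<rparr>)"
    if "S \<in> F" "\<chi> \<in> R (G\<lparr>carrier := S\<rparr>)" for S \<chi>
    unfolding C by (rule char_class_eq_one_iff[OF GS[OF that(1)] that(2)])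
  have t1: "to_tensor_Zp p (C (G\<lparr>carrier := T\<rparr>)) \<one>\<^bsub>C (G\<lparr>carrier := T\<rparr>)\<^esub> = \<one>\<^bsub>tensor_Zp p (C (G\<lparr>carrier := T\<rparr>))\<^esub>"
    if "T \<in> F" for T
    unfolding C using hom_one[OF pure_tensor_hom_left[OF M.B[OF that] M.Z Zp_one_closed[OF M.p]]] M.B[OF that] M.TB[OF that]
    by (simp only: comm_group_def)
  have tensor: "trivial_group (tensor_Zp p (C G)) \<longleftrightarrow>
         (\<forall>S\<in>F. \<forall>T\<in>F. \<forall>\<rho>\<in>R (G\<lparr>carrier := S\<rparr>).
            to_tensor_Zp p (C (G\<lparr>carrier := T\<rparr>))
              (char_class (G\<lparr>carrier := T\<rparr>) (Res T (Ind G S \<rho>)))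
            = \<one>\<^bsub>tensor_Zp p (C (G\<lparr>carrier := T\<rparr>))\<^esub>)"
    unfolding C M.tensor_trivial carrier_char_quotient ball_simps using \<alpha>(1) by simp
  have tensor': "(\<forall>S\<in>F. \<forall>T\<in>F. \<forall>\<rho>\<in>R (G\<lparr>carrier := S\<rparr>).
            to_tensor_Zp p (C (G\<lparr>carrier := T\<rparr>)) (char_class (G\<lparr>carrier := T\<rparr>) (Res T (Ind G S \<rho>)))
            = \<one>\<^bsub>tensor_Zp p (C (G\<lparr>carrier := T\<rparr>))\<^esub>) \<longleftrightarrow>
         (\<forall>S\<in>F. \<forall>T\<in>F. \<forall>\<rho>\<in>R (G\<lparr>carrier := S\<rparr>).
            char_class (G\<lparr>carrier := S\<rparr>) \<rho> \<noteq> \<one>\<^bsub>C (G\<lparr>carrier := S\<rparr>)\<^esub> \<longrightarrow>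
            to_tensor_Zp p (C (G\<lparr>carrier := T\<rparr>)) (char_class (G\<lparr>carrier := T\<rparr>) (Res T (Ind G S \<rho>)))
            = \<one>\<^bsub>tensor_Zp p (C (G\<lparr>carrier := T\<rparr>))\<^esub>)"
  \<comment> \<open>The two conditions differ only for rho in Perm(S); then Res Ind rho lies in
    Perm(T), and its tensor is trivial.\<close>
  proof (intro ball_cong refl)
    fix S T \<rho> assume *: "S \<in> F" "T \<in> F" "\<rho> \<in> R (G\<lparr>carrier := S\<rparr>)"
    have "to_tensor_Zp p (C (G\<lparr>carrier := T\<rparr>)) (char_class (G\<lparr>carrier := T\<rparr>) (Res T (Ind G S \<rho>)))
            = \<one>\<^bsub>tensor_Zp p (C (G\<lparr>carrier := T\<rparr>))\<^esub>"
      if "char_class (G\<lparr>carrier := S\<rparr>) \<rho> = \<one>\<^bsub>C (G\<lparr>carrier := S\<rparr>)\<^esub>"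
      using one[OF *(1,3)] one[OF *(2) \<alpha>(2)[OF *]] \<alpha>(3)[OF *] t1[OF *(2)] that by simp
    then show "(to_tensor_Zp p (C (G\<lparr>carrier := T\<rparr>)) (char_class (G\<lparr>carrier := T\<rparr>) (Res T (Ind G S \<rho>)))
            = \<one>\<^bsub>tensor_Zp p (C (G\<lparr>carrier := T\<rparr>))\<^esub>) \<longleftrightarrow>
        (char_class (G\<lparr>carrier := S\<rparr>) \<rho> \<noteq> \<one>\<^bsub>C (G\<lparr>carrier := S\<rparr>)\<^esub> \<longrightarrow>
         to_tensor_Zp p (C (G\<lparr>carrier := T\<rparr>)) (char_class (G\<lparr>carrier := T\<rparr>) (Res T (Ind G S \<rho>)))
            = \<one>\<^bsub>tensor_Zp p (C (G\<lparr>carrier := T\<rparr>))\<^esub>)" by blast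
  qed
  have torsion: "tensor_Zp p (C G) \<cong>
           image_group
             (prod_sum_map F (\<lambda>T. C (G\<lparr>carrier := T\<rparr>)) (alpha G))
             (product_group F (\<lambda>S. C (G\<lparr>carrier := S\<rparr>)))
             (product_group F (\<lambda>T. C (G\<lparr>carrier := T\<rparr>)))
         \<and> (trivial_group (tensor_Zp p (C G)) \<longleftrightarrow>
             (\<forall>S\<in>F. \<forall>T\<in>F. \<forall>\<rho>\<in>R (G\<lparr>carrier := S\<rparr>).
                Res T (Ind G S \<rho>) \<in> Perm (G\<lparr>carrier := T\<rparr>)))"
    if q: "\<forall>Q\<in>F. p_quasi_elementary p (G\<lparr>carrier := Q\<rparr>)"
  proof -
    have e: "\<exists>k. \<forall>a\<in>carrier (char_quotient R (G\<lparr>carrier := S\<rparr>)).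
        a [^]\<^bsub>char_quotient R (G\<lparr>carrier := S\<rparr>)\<^esub> (p ^ k) = \<one>\<^bsub>char_quotient R (G\<lparr>carrier := S\<rparr>)\<^esub>" if S: "S \<in> F" for S
    proof -
      obtain k where k: "\<And>\<chi>. \<chi> \<in> Char_Q (G\<lparr>carrier := S\<rparr>) \<Longrightarrow> (\<lambda>g. of_nat (p ^ k) * \<chi> g) \<in> Perm (G\<lparr>carrier := S\<rparr>)"
        by (rule quasi_elementary_exponent[OF _ p]) (use q S in blast, rule that)
      show ?thesis
        unfolding carrier_char_quotient ball_simps
      proof (intro exI ballI)
        fix \<chi> assume \<chi>: "\<chi> \<in> R (G\<lparr>carrier := S\<rparr>)"
        have P: "(\<lambda>g. of_nat (p ^ k) * \<chi> g) \<in> Perm (G\<lparr>carrier := S\<rparr>)" using k R_Char[OF GS[OF S]] \<chi> by blast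
        have "(\<lambda>g. of_nat (p ^ k) * \<chi> g) \<in> R (G\<lparr>carrier := S\<rparr>)" using P Perm_subset[OF GS[OF S]] by blast
        then show "char_class (G\<lparr>carrier := S\<rparr>) \<chi> [^]\<^bsub>char_quotient R (G\<lparr>carrier := S\<rparr>)\<^esub> (p ^ k) = \<one>\<^bsub>char_quotient R (G\<lparr>carrier := S\<rparr>)\<^esub>"
          unfolding char_class_nat_pow[OF GS[OF S] \<chi>] using char_class_eq_one_iff[OF GS[OF S]] P by blast
      qed
    qed
    have "(alpha G S T (char_class (G\<lparr>carrier := S\<rparr>) \<rho>) = \<one>\<^bsub>char_quotient R (G\<lparr>carrier := T\<rparr>)\<^esub>) \<longleftrightarrow>
        Res T (Ind G S \<rho>) \<in> Perm (G\<lparr>carrier := T\<rparr>)" if "S \<in> F" "T \<in> F" "\<rho> \<in> R (G\<lparr>carrier := S\<rparr>)" for S T \<rho>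
      unfolding \<alpha>(1)[OF that] by (rule char_class_eq_one_iff[OF GS[OF that(2)] \<alpha>(2)[OF that]])
    then show ?thesis
      using M.torsion_iso[OF e] unfolding C carrier_char_quotient ball_simps by simp
  qed
  have "(\<forall>S\<in>F. \<forall>T\<in>F. \<forall>\<rho>\<in>R (G\<lparr>carrier := S\<rparr>). Res T (Ind G S \<rho>) \<in> Perm (G\<lparr>carrier := T\<rparr>)) \<longleftrightarrow>
     (\<forall>S\<in>F. \<forall>T\<in>F. \<forall>\<rho>\<in>R (G\<lparr>carrier := S\<rparr>). char_class (G\<lparr>carrier := S\<rparr>) \<rho> \<noteq> \<one>\<^bsub>C (G\<lparr>carrier := S\<rparr>)\<^esub> \<longrightarrow>
        Res T (Ind G S \<rho>) \<in> Perm (G\<lparr>carrier := T\<rparr>))"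
    using one \<alpha>(3) by blast
  then show ?thesis
    using M.tensor_iso[folded C] tensor tensor' torsion by blast
qed

end
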